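(* Let $G=(V,E)$ be a directed series-parallel graph with source $s$ and sink $t$, and let $c_1,\dots,c_k$ be $k$ nonnegative edge cost functions on $E$. Let $H$ be the height of the decomposition tree of $G$. There is a polynomial-time randomized algorithm for the robust $s$-$t$ path problem on this instance that returns an $s$-$t$ path $\mathcal{P}$ with $\max_{i\in[k]} c_i(\mathcal{P}) \le O(H\log k)\cdot \mathrm{OPT}$ with probability at least $1-\left(\frac{1}{k}+\frac{1}{kH}\right)$, where $\mathrm{OPT}$ is the optimal value of the instance.
   Context: Robust $s$-$t$ path problem: given a directed graph $G=(V,E)$ with two vertices $s,t$ and $k$ cost functions (agents/scenarios) $c_i:E\to\mathbb{R}_{\ge 0}$, $i\in[k]$, with $c_i(\mathcal{P}):=\sum_{e\in\mathcal{P}}c_i(e)$, find an $s$-$t$ path $\mathcal{P}$ minimizing $\max_{i\in[k]}c_i(\mathcal{P})$; $\mathrm{OPT}$ denotes the minimum value. A directed graph with source $s$ and sink $t$ is series-parallel if it is a single edge from $s$ to $t$, or is obtained from two series-parallel graphs $G_1=(V_1,E_1,s_1,t_1)$, $G_2=(V_2,E_2,s_2,t_2)$ by series composition (identify $t_1$ with $s_2$; new source $s_1$, new sink $t_2$) or parallel composition (identify $s_1$ with $s_2$ and $t_1$ with $t_2$, these being the new source and sink). The decomposition tree of a series-parallel graph is a rooted tree whose leaves correspond bijectively to the edges of $G$, whose internal nodes are series nodes or parallel nodes indicating how the subgraphs of their children (the subgraph of a node consists of the edges at the leaves below it) are combined by series resp. parallel composition, and in which the children of a parallel node are leaves or series nodes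 and the children of a series node are leaves or parallel nodes. $H$ is the height of this tree. *)

theory Defs
  imports
    "Graph_Theory.Digraph_Component"
    "HOL-Probability.Probability_Mass_Function"
    "HOL-Computational_Algebra.Polynomial"
    "HOL-Library.Log_Nat"
begin

section \<open>Series-parallel digraphs and their decomposition trees\<close>

text \<open>
  The composed graph \<open>G\<close> is the union of two parts that already share exactly the identified
  vertices; up to isomorphism this is the composition of two disjoint graphs by identification.
  The arcs of the parts stay distinct, so parallel arcs may arise.  \<open>compatible\<close> says that the parts
  have the same tail and head functions.  As these are total, it also constrains the irrelevant
  values outside the arc sets, but every \<open>G\<close> can be split into parts that inherit its own functions.
\<close>

definition single_arc :: "('v, 'e) pre_digraph \<Rightarrow> 'v \<Rightarrow> 'v \<Rightarrow> 'e \<Rightarrow> bool" where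
  "single_arc G s t e \<longleftrightarrow>
     s \<noteq> t \<and> verts G = {s, t} \<and> arcs G = {e} \<and> tail G e = s \<and> head G e = t"

definition glued_at ::
    "'v set \<Rightarrow> ('v, 'e) pre_digraph \<Rightarrow> ('v, 'e) pre_digraph \<Rightarrow> ('v, 'e) pre_digraph \<Rightarrow> bool" where
  "glued_at W G1 G2 G \<longleftrightarrow>
     compatible G1 G2 \<and> G = Digraph_Component.union G1 G2 \<and>
     arcs G1 \<inter> arcs G2 = {} \<and> verts G1 \<inter> verts G2 = W"

inductive series_parallel :: "('v, 'e) pre_digraph \<Rightarrow> 'v \<Rightarrow> 'v \<Rightarrow> bool" where
  sp_arc: "single_arc G s t e \<Longrightarrow> series_parallel G s t"
| sp_series: "\<lbrakk>series_parallel G1 s m; series_parallel G2 m t; glued_at {m} G1 G2 G\<rbrakk>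
    \<Longrightarrow> series_parallel G s t"
| sp_parallel: "\<lbrakk>series_parallel G1 s t; series_parallel G2 s t; glued_at {s, t} G1 G2 G\<rbrakk>
    \<Longrightarrow> series_parallel G s t"

datatype 'e sp_tree =
  Leaf 'e
| Series "'e sp_tree list"
| Parallel "'e sp_tree list"

fun is_series_node :: "'e sp_tree \<Rightarrow> bool" where
  "is_series_node (Series Ts) = True"
| "is_series_node _ = False"

fun is_parallel_node :: "'e sp_tree \<Rightarrow> bool" where
  "is_parallel_node (Parallel Ts) = True"
| "is_parallel_node _ = False"

text \<open>The height counts edges on a longest path from the root to a leaf.\<close>

primrec tree_height :: "'e sp_tree \<Rightarrow> nat" where
  "tree_height (Leaf e) = 0"
| "tree_height (Series Ts) = Suc (Max (set (map tree_height Ts)))"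
| "tree_height (Parallel Ts) = Suc (Max (set (map tree_height Ts)))"

text \<open>
  \<open>decomposition_tree T G s t\<close>: \<open>T\<close> is a decomposition tree of \<open>G\<close> with source \<open>s\<close> and sink \<open>t\<close>.
  Adjacent internal nodes have different kinds, so a node may need more than two children.  Their
  graphs are combined by iterated binary composition; \<open>series_children\<close> and \<open>parallel_children\<close>
  describe this for a nonempty list of children.
\<close>

inductive decomposition_tree :: "'e sp_tree \<Rightarrow> ('v, 'e) pre_digraph \<Rightarrow> 'v \<Rightarrow> 'v \<Rightarrow> bool"
  and series_children :: "'e sp_tree list \<Rightarrow> ('v, 'e) pre_digraph \<Rightarrow> 'v \<Rightarrow> 'v \<Rightarrow> bool"
  and parallel_children :: "'e sp_tree list \<Rightarrow> ('v, 'e) pre_digraph \<Rightarrow> 'v \<Rightarrow> 'v \<Rightarrow> bool"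
where
  dt_leaf: "single_arc G s t e \<Longrightarrow> decomposition_tree (Leaf e) G s t"
| dt_series: "\<lbrakk>length Ts \<ge> 2; \<forall>T \<in> set Ts. \<not> is_series_node T; series_children Ts G s t\<rbrakk>
    \<Longrightarrow> decomposition_tree (Series Ts) G s t"
| dt_parallel: "\<lbrakk>length Ts \<ge> 2; \<forall>T \<in> set Ts. \<not> is_parallel_node T; parallel_children Ts G s t\<rbrakk>
    \<Longrightarrow> decomposition_tree (Parallel Ts) G s t"
| sc_one: "decomposition_tree T G s t \<Longrightarrow> series_children [T] G s t"
| sc_more: "\<lbrakk>decomposition_tree T G1 s m; series_children Ts G2 m t; glued_at {m} G1 G2 G\<rbrakk>
    \<Longrightarrow> series_children (T # Ts) G s t"
| pc_one: "decomposition_tree T G s t \<Longrightarrow> parallel_children [T] G s t"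
| pc_more: "\<lbrakk>decomposition_tree T G1 s t; parallel_children Ts G2 s t; glued_at {s, t} G1 G2 G\<rbrakk>
    \<Longrightarrow> parallel_children (T # Ts) G s t"


section \<open>The robust path problem\<close>

text \<open>A path is the list of its arcs, and \<open>c i e\<close> is the cost of arc \<open>e\<close> for agent \<open>i \<in> {1..k}\<close>.\<close>

definition path_cost :: "('e \<Rightarrow> real) \<Rightarrow> 'e list \<Rightarrow> real" where
  "path_cost f p = (\<Sum>e\<leftarrow>p. f e)"

definition robust_cost :: "nat \<Rightarrow> (nat \<Rightarrow> 'e \<Rightarrow> real) \<Rightarrow> 'e list \<Rightarrow> real" where
  "robust_cost k c p = Max ((\<lambda>i. path_cost (c i) p) ` {1..k})"

definition OPT ::
    "('v, 'e) pre_digraph \<Rightarrow> 'v \<Rightarrow> 'v \<Rightarrow> nat \<Rightarrow> (nat \<Rightarrow> 'e \<Rightarrow> real) \<Rightarrow> real" where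
  "OPT G s t k c = Min (robust_cost k c ` {p. pre_digraph.apath G s p t})"

definition sp_instance ::
    "('v, 'e) pre_digraph \<Rightarrow> 'v \<Rightarrow> 'v \<Rightarrow> nat \<Rightarrow> (nat \<Rightarrow> 'e \<Rightarrow> real) \<Rightarrow> bool" where
  "sp_instance G s t k c \<longleftrightarrow>
     series_parallel G s t \<and> k \<ge> 1 \<and> (\<forall>i\<in>{1..k}. \<forall>e\<in>arcs G. 0 \<le> c i e)"


section \<open>Randomized algorithms\<close>

text \<open>
  Algorithms are programs of a small imperative language: Jones' WHILE language over binary trees,
  with real numbers at the leaves, exact field operations and comparison on them as in the
  Blum-Shub-Smale model, and a command for tossing a fair coin.  The only constants are 0 and 1, and
  there is no rounding.  Every command performs a bounded number of primitive operations; \<open>Pair\<close> is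
  thought of as allocating a cell with two references, so that no copying takes place.
\<close>

datatype val = Atom real | Null | Pair val val

fun num_of :: "val \<Rightarrow> real" where
  "num_of (Atom r) = r"
| "num_of _ = 0"

fun fst_of :: "val \<Rightarrow> val" where
  "fst_of (Pair u v) = u"
| "fst_of _ = Null"

fun snd_of :: "val \<Rightarrow> val" where
  "snd_of (Pair u v) = v"
| "snd_of _ = Null"

type_synonym var = nat
type_synonym store = "var \<Rightarrow> val"

datatype oper =
  Copy var | MkNull | MkPair var var | First var | Second var
| Zero | One | Add var var | Sub var var | Mult var var | Divide var var

datatype test = IsPair var | IsAtom var | Less var var

datatype com =
  SKIP
| Assign var oper
| Toss var
| Seq com com
| If test com com
| While test com

primrec eval_oper :: "oper \<Rightarrow> store \<Rightarrow> val" where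
  "eval_oper (Copy x) \<sigma> = \<sigma> x"
| "eval_oper MkNull \<sigma> = Null"
| "eval_oper (MkPair x y) \<sigma> = Pair (\<sigma> x) (\<sigma> y)"
| "eval_oper (First x) \<sigma> = fst_of (\<sigma> x)"
| "eval_oper (Second x) \<sigma> = snd_of (\<sigma> x)"
| "eval_oper Zero \<sigma> = Atom 0"
| "eval_oper One \<sigma> = Atom 1"
| "eval_oper (Add x y) \<sigma> = Atom (num_of (\<sigma> x) + num_of (\<sigma> y))"
| "eval_oper (Sub x y) \<sigma> = Atom (num_of (\<sigma> x) - num_of (\<sigma> y))"
| "eval_oper (Mult x y) \<sigma> = Atom (num_of (\<sigma> x) * num_of (\<sigma> y))"
| "eval_oper (Divide x y) \<sigma> = Atom (num_of (\<sigma> x) / num_of (\<sigma> y))"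

primrec eval_test :: "test \<Rightarrow> store \<Rightarrow> bool" where
  "eval_test (IsPair x) \<sigma> = (\<exists>u v. \<sigma> x = Pair u v)"
| "eval_test (IsAtom x) \<sigma> = (\<exists>r. \<sigma> x = Atom r)"
| "eval_test (Less x y) \<sigma> = (num_of (\<sigma> x) < num_of (\<sigma> y))"

text \<open>
  \<open>step\<close> is the small-step semantics: a configuration, i.e. the remaining program and the store, is
  mapped to the distribution of its successor.  A configuration has halted if its program is \<open>SKIP\<close>,
  and then it does not change any more.
\<close>

type_synonym config = "com \<times> store"

primrec step_com :: "com \<Rightarrow> store \<Rightarrow> config pmf" where
  "step_com SKIP \<sigma> = return_pmf (SKIP, \<sigma>)"
| "step_com (Assign x a) \<sigma> = return_pmf (SKIP, \<sigma>(x := eval_oper a \<sigma>))"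
| "step_com (Toss x) \<sigma> =
     map_pmf (\<lambda>b. (SKIP, \<sigma>(x := Atom (if b then 1 else 0)))) (bernoulli_pmf (1 / 2))"
| "step_com (Seq c1 c2) \<sigma> =
     (if c1 = SKIP then return_pmf (c2, \<sigma>)
      else map_pmf (\<lambda>(c', \<sigma>'). (Seq c' c2, \<sigma>')) (step_com c1 \<sigma>))"
| "step_com (If b c1 c2) \<sigma> = return_pmf (if eval_test b \<sigma> then c1 else c2, \<sigma>)"
| "step_com (While b c) \<sigma> =
     return_pmf (if eval_test b \<sigma> then Seq c (While b c) else SKIP, \<sigma>)"

definition step :: "config \<Rightarrow> config pmf" where
  "step cfg = step_com (fst cfg) (snd cfg)"

definition halted :: "config \<Rightarrow> bool" where
  "halted cfg \<longleftrightarrow> fst cfg = SKIP"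

text \<open>The input is placed in variable 0, where the output is also read off at the end.\<close>

primrec run :: "com \<Rightarrow> val \<Rightarrow> nat \<Rightarrow> config pmf" where
  "run P x 0 = return_pmf (P, (\<lambda>_. Null)(0 := x))"
| "run P x (Suc n) = bind_pmf (run P x n) step"

definition halts_within :: "com \<Rightarrow> val \<Rightarrow> nat \<Rightarrow> bool" where
  "halts_within P x n \<longleftrightarrow> (\<forall>cfg \<in> set_pmf (run P x n). halted cfg)"

definition running_time :: "com \<Rightarrow> val \<Rightarrow> nat" where
  "running_time P x = (LEAST n. halts_within P x n)"

text \<open>Only meaningful if the running time is bounded, i.e. \<open>halts_within P x n\<close> for some \<open>n\<close>.\<close>

definition output_dist :: "com \<Rightarrow> val \<Rightarrow> val pmf" where
  "output_dist P x = map_pmf (\<lambda>cfg. snd cfg 0) (run P x (running_time P x))"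


section \<open>Polynomial time\<close>

primrec cells :: "val \<Rightarrow> nat" where
  "cells (Atom r) = 1"
| "cells Null = 1"
| "cells (Pair u v) = 1 + cells u + cells v"

text \<open>Bit length of a rational number, written as a reduced fraction with a sign.\<close>

definition num_bits :: "real \<Rightarrow> nat" where
  "num_bits r = (case quotient_of (THE q. of_rat q = r) of
     (a, b) \<Rightarrow> 1 + floorlog 2 (nat \<bar>a\<bar>) + floorlog 2 (nat b))"

primrec bit_size :: "val \<Rightarrow> nat" where
  "bit_size (Atom r) = 1 + num_bits r"
| "bit_size Null = 1"
| "bit_size (Pair u v) = 1 + bit_size u + bit_size v"

primrec atoms_of :: "val \<Rightarrow> real set" where
  "atoms_of (Atom r) = {r}"
| "atoms_of Null = {}"
| "atoms_of (Pair u v) = atoms_of u \<union> atoms_of v"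

text \<open>
  Inputs may contain arbitrary real numbers, so time is measured by the number of elementary steps,
  which must be polynomial in the number of cells of the input whatever the coin tosses are.  To rule
  out that exact arithmetic on huge numbers is used for free, all numbers that ever occur in a run on
  a rational input must have a bit length polynomial in the bit size of the input.  On
  rational inputs the program therefore runs in polynomial time in the Turing machine model.
\<close>

definition polynomial_time :: "com \<Rightarrow> val set \<Rightarrow> bool" where
  "polynomial_time P X \<longleftrightarrow>
     (\<exists>q :: nat poly. \<forall>x\<in>X.
        halts_within P x (poly q (cells x)) \<and>
        (atoms_of x \<subseteq> \<rat> \<longrightarrow>
           (\<forall>n. \<forall>(c, \<sigma>) \<in> set_pmf (run P x n). \<forall>y. \<forall>r \<in> atoms_of (\<sigma> y).
              num_bits r \<le> poly q (bit_size x))))"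


section \<open>Encoding of inputs and outputs\<close>

fun enc_list :: "val list \<Rightarrow> val" where
  "enc_list [] = Null"
| "enc_list (v # vs) = Pair v (enc_list vs)"

definition enc_nat :: "nat \<Rightarrow> val" where
  "enc_nat n = Atom (real n)"

definition enc_path :: "nat list \<Rightarrow> val" where
  "enc_path p = enc_list (map enc_nat p)"

definition enc_arc :: "(nat, nat) pre_digraph \<Rightarrow> nat \<Rightarrow> (nat \<Rightarrow> nat \<Rightarrow> real) \<Rightarrow> nat \<Rightarrow> val" where
  "enc_arc G k c e =
     enc_list [enc_nat e, enc_nat (tail G e), enc_nat (head G e),
               enc_list (map (\<lambda>i. Atom (c i e)) [1..<Suc k])]"

text \<open>
  Vertices and arcs are named by natural numbers and may be listed in any order.  The decomposition
  tree is not part of the input.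
\<close>

definition encodes ::
    "val \<Rightarrow> (nat, nat) pre_digraph \<Rightarrow> nat \<Rightarrow> nat \<Rightarrow> nat \<Rightarrow> (nat \<Rightarrow> nat \<Rightarrow> real) \<Rightarrow> bool" where
  "encodes x G s t k c \<longleftrightarrow>
     (\<exists>vs es. distinct vs \<and> set vs = verts G \<and> distinct es \<and> set es = arcs G \<and>
        x = enc_list [enc_nat s, enc_nat t, enc_list (map enc_nat vs),
                      enc_list (map (enc_arc G k c) es)])"

end

theory Submission
  imports Defs
begin

text \<open>
  The algorithm is deterministic.  For a threshold \<open>D\<close> put \<open>M\<^sub>i(p) = \<Prod>\<^sub>e (1 + c\<^sub>i(e) / D)\<close> for a path
  \<open>p\<close>, discard the arcs with \<open>c\<^sub>i(e) > D\<close> for some \<open>i\<close>, and label every vertex, in reverse topological order,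
  with a path to \<open>t\<close>: among the arcs \<open>e\<close> that leave the vertex, take the one for which \<open>e\<close> followed
  by the label of its head has the smallest potential \<open>\<Sum>\<^sub>i M\<^sub>i\<close>.

  Let \<open>Q\<close> be an optimal path, \<open>w\<^sub>i\<close> the factors of the label at the sink of a subgraph of height
  \<open>h\<close>, and let \<open>D \<ge> (H + 2) OPT\<close>, so that \<open>\<kappa>\<^sub>i(Q) = c\<^sub>i(Q) / D \<le> \<epsilon> = 1 / (H + 2)\<close>.  Then running
  through the subgraph raises the potential by at most \<open>\<gamma>\<^sub>h \<Sum>\<^sub>i w\<^sub>i \<kappa>\<^sub>i(Q)\<close>, where
  \<open>\<gamma>\<^sub>h = 1 / (1 - h \<epsilon>)\<close>.  At a parallel node this is clear, as the smallest potential is taken.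
  At a series node, adding up the bounds of the children gives \<open>E \<le> \<gamma> \<Sum>\<^sub>i w'\<^sub>i \<kappa>\<^sub>i(Q)\<close> for the increase
  \<open>E\<close> and the final factors \<open>w'\<^sub>i\<close>; this is at most
  \<open>\<gamma> (\<epsilon> E + \<Sum>\<^sub>i w\<^sub>i \<kappa>\<^sub>i(Q))\<close>, and \<open>\<gamma> / (1 - \<gamma> \<epsilon>)\<close> is the next \<open>\<gamma>\<close>.  So the label of \<open>s\<close> has
  potential at most \<open>2 k\<close>, and every path of potential at most \<open>2 k\<close> has costs \<open>O(D log k)\<close>.
  Neither \<open>H\<close> nor the tree is needed: some \<open>D = 4\<^sup>j c\<^sub>i(e)\<close> is within a factor \<open>4\<close> of
  \<open>(H + 2) OPT\<close>, and the path found for the smallest successful such \<open>D\<close> is returned.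
\<close>

section \<open>Series-parallel digraphs\<close>

text \<open>A label need not be the path of least potential: a suffix that minimises a sum of
  products can be a bad one once a prefix multiplies its terms. The factors of the suffix act as
  weights on the agents. In a series composition these weights grow from child to child, and only
  the final ones dominate all of them; going back to the weights at the sink costs one step of
  \<open>\<gamma>\<close>, and this happens at series nodes only. Factors \<open>1 + x\<close> stand
  in for \<open>exp x\<close> because the machine has field operations only and rational inputs must
  lead to rational numbers. Time is counted in cells of the input, so the number of thresholds must
  not depend on the magnitude of the costs: a search over magnitudes is replaced by multiples of
  single arc costs, with exponents up to the number of arcs.\<close>

abbreviation walk :: "('v, 'e) pre_digraph \<Rightarrow> 'v \<Rightarrow> 'e list \<Rightarrow> 'v \<Rightarrow> bool" where
  "walk G u p v \<equiv> set p \<subseteq> arcs G \<and> pre_digraph.cas G u p v"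

section \<open>Walks and ranks in series-parallel digraphs\<close>

lemma cas_append_iff:
  "pre_digraph.cas G u (p @ q) v \<longleftrightarrow>
    (\<exists>w. pre_digraph.cas G u p w \<and> pre_digraph.cas G w q v)"
  by (induction p arbitrary: u) (auto simp: pre_digraph.cas.simps)

lemma glued_atD:
  assumes "glued_at W G1 G2 G"
  shows "verts G = verts G1 \<union> verts G2" "arcs G = arcs G1 \<union> arcs G2"
    "arcs G1 \<inter> arcs G2 = {}" "verts G1 \<inter> verts G2 = W"
    "tail G1 = tail G" "head G1 = head G" "tail G2 = tail G" "head G2 = head G"
  using assms by (auto simp: glued_at_def compatible_def Digraph_Component.union_def)

lemma cas_glued:
  assumes "glued_at W G1 G2 G"
  shows "pre_digraph.cas G1 = pre_digraph.cas G" "pre_digraph.cas G2 = pre_digraph.cas G"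
  using glued_atD[OF assms] by (auto intro!: compatible_cas simp: compatible_def)

text \<open>That nothing leaves \<open>t\<close> or enters \<open>s\<close> is part of the
  induction: it keeps a walk from re-entering a part through a shared terminal.\<close>

lemma series_parallel_basics:
  assumes "series_parallel G s t"
  shows "fin_digraph G \<and> s \<in> verts G \<and> t \<in> verts G \<and> s \<noteq> t \<and> arcs G \<noteq> {} \<and>
    (\<forall>e\<in>arcs G. tail G e \<noteq> t \<and> head G e \<noteq> s)"
  using assms
proof (induction rule: series_parallel.induct)
  case (sp_arc G s t e)
  then show ?case
    by (auto simp: single_arc_def fin_digraph_def wf_digraph_def fin_digraph_axioms_def)
next
  case (sp_series G1 s m G2 t G)
  note D = glued_atD[OF sp_series.hyps(3)]
  have wf: "wf_digraph G1" "wf_digraph G2" "fin_digraph G1" "fin_digraph G2"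
    using sp_series.IH by (auto simp: fin_digraph_def)
  have "fin_digraph G"
    using wf D by (auto simp: fin_digraph_def wf_digraph_def fin_digraph_axioms_def)
  moreover have "s \<notin> verts G2" "t \<notin> verts G1"
    using sp_series.IH D(4) by auto
  ultimately show ?case
    using sp_series.IH D wf unfolding wf_digraph_def by auto
next
  case (sp_parallel G1 s t G2 G)
  note D = glued_atD[OF sp_parallel.hyps(3)]
  have wf: "wf_digraph G1" "wf_digraph G2" "fin_digraph G1" "fin_digraph G2"
    using sp_parallel.IH by (auto simp: fin_digraph_def)
  have "fin_digraph G"
    using wf D by (auto simp: fin_digraph_def wf_digraph_def fin_digraph_axioms_def)
  then show ?case
    using sp_parallel.IH D by auto
qed

lemma series_parallel_simps:
  assumes "series_parallel G s t"
  shows "fin_digraph G" "wf_digraph G" "finite (arcs G)" "finite (verts G)"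
    "s \<in> verts G" "t \<in> verts G" "s \<noteq> t" "arcs G \<noteq> {}"
    "\<And>e. e \<in> arcs G \<Longrightarrow> tail G e \<noteq> t" "\<And>e. e \<in> arcs G \<Longrightarrow> head G e \<noteq> s"
    "\<And>e. e \<in> arcs G \<Longrightarrow> tail G e \<in> verts G" "\<And>e. e \<in> arcs G \<Longrightarrow> head G e \<in> verts G"
  using series_parallel_basics[OF assms]
  by (auto simp: fin_digraph_def wf_digraph_def fin_digraph_axioms_def)

text \<open>The rank certifies that \<open>G\<close> is acyclic. Its bound by the number of arcs
  limits both the length of walks and the number of rounds after which the labels are
  stable.\<close>

lemma series_parallel_rank:
  assumes "series_parallel G s t"
  shows "\<exists>r :: 'v \<Rightarrow> nat. r t = 0 \<and> (\<forall>e\<in>arcs G. r (head G e) < r (tail G e)) \<and>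
    (\<forall>v\<in>verts G. r v \<le> r s) \<and> r s \<le> card (arcs G)"
  using assms
proof (induction rule: series_parallel.induct)
  case (sp_arc G s t e)
  then show ?case
    by (intro exI[of _ "\<lambda>v. if v = s then 1 else 0"]) (auto simp: single_arc_def)
next
  case (sp_series G1 s m G2 t G)
  note D = glued_atD[OF sp_series.hyps(3)]
  note S1 = series_parallel_simps[OF sp_series.hyps(1)]
  note S2 = series_parallel_simps[OF sp_series.hyps(2)]
  obtain r1 :: "'v \<Rightarrow> nat" where r1: "r1 m = 0" "\<forall>e\<in>arcs G1. r1 (head G e) < r1 (tail G e)"
    "\<forall>v\<in>verts G1. r1 v \<le> r1 s" "r1 s \<le> card (arcs G1)" using sp_series.IH D by auto
  obtain r2 :: "'v \<Rightarrow> nat" where r2: "r2 t = 0" "\<forall>e\<in>arcs G2. r2 (head G e) < r2 (tail G e)"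
    "\<forall>v\<in>verts G2. r2 v \<le> r2 m" "r2 m \<le> card (arcs G2)" using sp_series.IH D by auto
  \<comment> \<open>Since \<open>r1 m = 0\<close>, the shift by \<open>r2 m\<close> makes the two
    ranks agree at the identified vertex.\<close>
  define r where "r v = (if v \<in> verts G2 then r2 v else r1 v + r2 m)" for v
  have m: "m \<in> verts G2" "s \<notin> verts G2" using S1 S2 D by auto
  have r_1: "r v = r1 v + r2 m" if "v \<in> verts G1" for v
  proof -
    have "v = m" if "v \<in> verts G2" using \<open>v \<in> verts G1\<close> that D by blast
    then show ?thesis using r1 by (auto simp: r_def)
  qed
  have "card (arcs G) = card (arcs G1) + card (arcs G2)"
    using D S1 S2 by (simp add: card_Un_disjoint)
  moreover have "r (head G e) < r (tail G e)" if "e \<in> arcs G1" for e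
    using that S1(11,12)[OF that] r1 D by (auto simp: r_1)
  moreover have "r (head G e) < r (tail G e)" if "e \<in> arcs G2" for e
    using that S2(11,12)[OF that] r2 D by (auto simp: r_def)
  moreover have rs: "r s = r1 s + r2 m" "r t = 0" using m r2 S2(6) by (auto simp: r_def)
  moreover have "r v \<le> r s" if "v \<in> verts G" for v
  proof (cases "v \<in> verts G2")
    case True
    then have "r2 v \<le> r2 m" using r2 by blast
    then show ?thesis using True rs by (simp add: r_def)
  next
    case False
    then have "r1 v \<le> r1 s" using r1 D that by blast
    then show ?thesis using False rs by (simp add: r_def)
  qed
  moreover have "r s \<le> card (arcs G1) + card (arcs G2)" using r1(4) r2(4) rs by simp
  ultimately show ?case using D(2) by (intro exI[of _ r]) (metis UnE)
next
  case (sp_parallel G1 s t G2 G)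
  note D = glued_atD[OF sp_parallel.hyps(3)]
  note S1 = series_parallel_simps[OF sp_parallel.hyps(1)]
  note S2 = series_parallel_simps[OF sp_parallel.hyps(2)]
  obtain r1 :: "'v \<Rightarrow> nat" where r1: "r1 t = 0" "\<forall>e\<in>arcs G1. r1 (head G e) < r1 (tail G e)"
    "\<forall>v\<in>verts G1. r1 v \<le> r1 s" "r1 s \<le> card (arcs G1)" using sp_parallel.IH D by auto
  obtain r2 :: "'v \<Rightarrow> nat" where r2: "r2 t = 0" "\<forall>e\<in>arcs G2. r2 (head G e) < r2 (tail G e)"
    "\<forall>v\<in>verts G2. r2 v \<le> r2 s" "r2 s \<le> card (arcs G2)" using sp_parallel.IH D by auto
  \<comment> \<open>Raising the rank of the common source is harmless because no arc enters
    \<open>s\<close>; at \<open>t\<close> both ranks are 0.\<close>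
  define r where "r v = (if v = s then max (r1 s) (r2 s) else if v \<in> verts G1 then r1 v else r2 v)" for v
  have "card (arcs G) = card (arcs G1) + card (arcs G2)"
    using D S1 S2 by (simp add: card_Un_disjoint)
  moreover have "r (head G e) < r (tail G e)" if "e \<in> arcs G1" for e
    using that S1(9-12)[OF that] r1 D by (fastforce simp: r_def)
  moreover have "r (head G e) < r (tail G e)" if "e \<in> arcs G2" for e
  proof -
    have eq: "r v = r2 v" if "v \<in> verts G2" "v \<noteq> s" for v
      using that D r1 r2 by (auto simp: r_def)
    have "r2 (head G e) < r2 (tail G e)" using that r2 by auto
    moreover have "r (head G e) = r2 (head G e)" using eq S2(10,12)[OF that] D by auto
    moreover have "r (tail G e) \<ge> r2 (tail G e)"
      using eq[of "tail G e"] S2(11)[OF that] D by (cases "tail G e = s") (auto simp: r_def)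
    ultimately show ?thesis by simp
  qed
  moreover have "r v \<le> r s" if "v \<in> verts G" for v
  proof (cases "v \<in> verts G1")
    case True
    then have "r1 v \<le> r1 s" using r1 by blast
    then show ?thesis using True by (auto simp: r_def)
  next
    case False
    then have "r2 v \<le> r2 s" using r2 D(1) that by blast
    then show ?thesis using False by (auto simp: r_def)
  qed
  moreover have "r t = 0" using r1(1) S1(6,7) by (simp add: r_def)
  moreover have "r s \<le> card (arcs G1) + card (arcs G2)" using r1(4) r2(4) by (simp add: r_def)
  ultimately show ?case using D(2) by (intro exI[of _ r]) (metis UnE)
qed

lemma series_parallel_walk:
  assumes "series_parallel G s t"
  shows "\<exists>p. walk G s p t"
  using assms
proof (induction rule: series_parallel.induct)
  case (sp_arc G s t e)
  then show ?case
    by (intro exI[of _ "[e]"]) (auto simp: single_arc_def pre_digraph.cas.simps)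
next
  case (sp_series G1 s m G2 t G)
  then obtain p q where "walk G1 s p m" "walk G2 m q t" by blast
  then show ?case
    using glued_atD[OF sp_series.hyps(3)] cas_glued[OF sp_series.hyps(3)]
    by (intro exI[of _ "p @ q"]) (auto simp: cas_append_iff)
next
  case (sp_parallel G1 s t G2 G)
  then obtain p where "walk G1 s p t" by blast
  then show ?case
    using glued_atD[OF sp_parallel.hyps(3)] cas_glued[OF sp_parallel.hyps(3)]
    by (intro exI[of _ p]) auto
qed

section \<open>How walks split along series and parallel compositions\<close>

lemma walk_confined:
  assumes "pre_digraph.cas G u p v" "u \<in> A" "set p \<subseteq> E"
    and "\<And>e. \<lbrakk>e \<in> E; tail G e \<in> A\<rbrakk> \<Longrightarrow> e \<in> F \<and> head G e \<in> A"
  shows "set p \<subseteq> F"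
  using assms(1-3)
  by (induction p arbitrary: u) (auto simp: pre_digraph.cas.simps dest: assms(4))

text \<open>Induction along the walk, which may start anywhere in \<open>G1\<close>. The first arc
  outside \<open>G1\<close> starts at \<open>m\<close>; from then on the walk is confined to
  \<open>G2\<close>, because no arc of \<open>G1\<close> leaves its sink \<open>m\<close>.\<close>

lemma walk_series_split:
  assumes sp: "series_parallel G1 s m" "series_parallel G2 m t" and gl: "glued_at {m} G1 G2 G"
    and walk: "walk G u p t" and u: "u \<in> verts G1"
  shows "\<exists>p1 p2. p = p1 @ p2 \<and> walk G1 u p1 m \<and> walk G2 m p2 t"
  using walk u
proof (induction p arbitrary: u)
  note D = glued_atD[OF gl] and C = cas_glued[OF gl]
  note S1 = series_parallel_simps[OF sp(1)] and S2 = series_parallel_simps[OF sp(2)]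
  {
    case Nil
    have "t \<notin> verts G1" using D(4) S2(6,7) by auto
    then show ?case using Nil by (auto simp: pre_digraph.cas.simps)
  next
    case (Cons e p)
    have e: "tail G e = u" "pre_digraph.cas G (head G e) p t" "e \<in> arcs G" "set p \<subseteq> arcs G"
      using Cons.prems by (auto simp: pre_digraph.cas.simps)
    show ?case
    proof (cases "e \<in> arcs G1")
      case True
      then obtain p1 p2 where "p = p1 @ p2" "walk G1 (head G e) p1 m" "walk G2 m p2 t"
        using Cons.IH[of "head G e"] e S1(12)[of e] D by auto
      then show ?thesis
        using e True D C
        by (intro exI[of _ "e # p1"] exI[of _ p2]) (auto simp: pre_digraph.cas.simps)
    next
      case False
      then have e2: "e \<in> arcs G2" using e D by auto
      then have "u = m" using S2(11)[of e] e Cons.prems D by auto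
      have "set (e # p) \<subseteq> arcs G2"
      proof (rule walk_confined[where A = "verts G2" and E = "arcs G" and G = G and u = u and v = t])
        fix e assume e: "e \<in> arcs G" "tail G e \<in> verts G2"
        have "e \<notin> arcs G1" using e S1(9,11)[of e] D by auto
        then show "e \<in> arcs G2 \<and> head G e \<in> verts G2" using e D S2(12)[of e] by auto
      qed (use Cons.prems \<open>u = m\<close> S2 in auto)
      then show ?thesis
        using \<open>u = m\<close> Cons.prems C
        by (intro exI[of _ "[]"] exI[of _ "e # p"]) (auto simp: pre_digraph.cas.simps)
    qed
  }
qed

text \<open>The two sides share only \<open>s\<close> and \<open>t\<close>. Nothing enters
  \<open>s\<close> and nothing leaves \<open>t\<close>, so a walk that starts in \<open>G1\<close>
  away from \<open>s\<close> has no way to change sides.\<close>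

lemma walk_from_interior:
  assumes sp: "series_parallel G1 s t" "series_parallel G2 s t" and gl: "glued_at {s, t} G1 G2 G"
    and walk: "walk G u p t" and u: "u \<in> verts G1" "u \<noteq> s"
  shows "walk G1 u p t"
proof -
  note D = glued_atD[OF gl] and C = cas_glued[OF gl]
  note S1 = series_parallel_simps[OF sp(1)] and S2 = series_parallel_simps[OF sp(2)]
  have "set p \<subseteq> arcs G1"
  proof (rule walk_confined[where A = "verts G1 - {s}" and E = "arcs G" and G = G and u = u and v = t])
    fix e assume e: "e \<in> arcs G" "tail G e \<in> verts G1 - {s}"
    have "e \<notin> arcs G2" using e S2(9,11)[of e] D by auto
    then show "e \<in> arcs G1 \<and> head G e \<in> verts G1 - {s}" using e D S1(10,12)[of e] by auto
  qed (use walk u in auto)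
  then show ?thesis using walk C by simp
qed

lemma glued_at_commute: "glued_at W G1 G2 G \<Longrightarrow> glued_at W G2 G1 G"
  by (auto simp: glued_at_def compatible_def Digraph_Component.union_def)

text \<open>The first arc decides: its head is not the source, so the rest stays on the same
  side.\<close>

lemma walk_parallel_split:
  assumes sp: "series_parallel G1 s t" "series_parallel G2 s t" and gl: "glued_at {s, t} G1 G2 G"
    and walk: "walk G s p t"
  shows "walk G1 s p t \<or> walk G2 s p t"
proof (cases p)
  case Nil
  then show ?thesis using walk series_parallel_simps[OF sp(1)] by (auto simp: pre_digraph.cas.simps)
next
  case (Cons e q)
  note D = glued_atD[OF gl] and C = cas_glued[OF gl]
  note gl' = glued_at_commute[OF gl]
  show ?thesis
  proof (cases "e \<in> arcs G1")
    case True
    then have "walk G1 (head G e) q t"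
      using walk_from_interior[OF sp gl, where u = "head G e" and p = q] series_parallel_simps[OF sp(1)] walk Cons D
      by (auto simp: pre_digraph.cas.simps)
    then show ?thesis using True walk Cons C by (auto simp: pre_digraph.cas.simps)
  next
    case False
    then have e: "e \<in> arcs G2" using walk Cons D by auto
    then have "walk G2 (head G e) q t"
      using walk_from_interior[OF sp(2,1) gl', where u = "head G e" and p = q] series_parallel_simps[OF sp(2)]
        walk Cons D by (auto simp: pre_digraph.cas.simps)
    then show ?thesis using e walk Cons C by (auto simp: pre_digraph.cas.simps)
  qed
qed

section \<open>Decomposition trees and their height\<close>

lemma
  shows decomposition_tree_series_parallel:
    "decomposition_tree T G s t \<Longrightarrow> series_parallel G s t"
  and series_children_series_parallel: "series_children Ts G s t \<Longrightarrow> series_parallel G s t"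
  and parallel_children_series_parallel: "parallel_children Ts G s t \<Longrightarrow> series_parallel G s t"
  by (induction rule: decomposition_tree_series_children_parallel_children.inducts)
    (auto intro: series_parallel.intros)

text \<open>A node has at least two children, and every sibling of a deepest child contributes an
  arc of its own. The bound lets exponents up to the number of arcs cover the unknown
  height.\<close>

lemma Suc_tree_height_le_card:
  shows "decomposition_tree T G s t \<Longrightarrow> Suc (tree_height T) \<le> card (arcs G)"
  and "series_children Ts G s t \<Longrightarrow> T \<in> set Ts \<Longrightarrow> tree_height T + length Ts \<le> card (arcs G)"
  and "parallel_children Ts G s t \<Longrightarrow> T \<in> set Ts \<Longrightarrow> tree_height T + length Ts \<le> card (arcs G)"
proof (induction arbitrary: and T and T
    rule: decomposition_tree_series_children_parallel_children.inducts)
  case (dt_series Ts G s t)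
  have "Max (tree_height ` set Ts) \<in> tree_height ` set Ts"
    using dt_series.hyps(1) by (intro Max_in) auto
  then obtain T where "T \<in> set Ts" "Max (tree_height ` set Ts) = tree_height T" by auto
  then show ?case using dt_series.IH[of T] dt_series.hyps(1) by simp
next
  case (dt_parallel Ts G s t)
  have "Max (tree_height ` set Ts) \<in> tree_height ` set Ts"
    using dt_parallel.hyps(1) by (intro Max_in) auto
  then obtain T where "T \<in> set Ts" "Max (tree_height ` set Ts) = tree_height T" by auto
  then show ?case using dt_parallel.IH[of T] dt_parallel.hyps(1) by simp
next
  case (sc_more T1 G1 s m Ts G2 t G)
  have "card (arcs G) = card (arcs G1) + card (arcs G2)"
    using glued_atD[OF sc_more.hyps(3)]
      series_parallel_simps[OF decomposition_tree_series_parallel[OF sc_more.hyps(1)]]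
      series_parallel_simps[OF series_children_series_parallel[OF sc_more.hyps(2)]]
    by (simp add: card_Un_disjoint)
  moreover have "length Ts \<le> card (arcs G2)"
    using sc_more.IH(2)[of "hd Ts"] by (cases Ts) auto
  moreover have "tree_height T + length Ts \<le> card (arcs G2)" if "T \<in> set Ts"
    using sc_more.IH(2) that by blast
  ultimately show ?case using sc_more.IH(1) sc_more.prems by auto
next
  case (pc_more T1 G1 s t Ts G2 G)
  have "card (arcs G) = card (arcs G1) + card (arcs G2)"
    using glued_atD[OF pc_more.hyps(3)]
      series_parallel_simps[OF decomposition_tree_series_parallel[OF pc_more.hyps(1)]]
      series_parallel_simps[OF parallel_children_series_parallel[OF pc_more.hyps(2)]]
    by (simp add: card_Un_disjoint)
  moreover have "length Ts \<le> card (arcs G2)"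
    using pc_more.IH(2)[of "hd Ts"] by (cases Ts) auto
  moreover have "tree_height T + length Ts \<le> card (arcs G2)" if "T \<in> set Ts"
    using pc_more.IH(2) that by blast
  ultimately show ?case using pc_more.IH(1) pc_more.prems by auto
qed (auto simp: single_arc_def)

section \<open>The potential of greedy labels\<close>

definition factor_prod :: "(nat \<Rightarrow> 'e \<Rightarrow> real) \<Rightarrow> nat \<Rightarrow> 'e list \<Rightarrow> real" where
  "factor_prod f i p = (\<Prod>e\<leftarrow>p. 1 + f i e)"

text \<open>A smooth substitute for the maximum over the agents.\<close>

definition potential :: "nat \<Rightarrow> (nat \<Rightarrow> 'e \<Rightarrow> real) \<Rightarrow> 'e list \<Rightarrow> real" where
  "potential k f p = (\<Sum>i=1..k. factor_prod f i p)"

text \<open>The arc set is a parameter since the same notion serves for all of \<open>G\<close>, for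
  the subgraph of a tree node, and for the arcs scanned so far.\<close>

definition extensions ::
    "('v, 'e) pre_digraph \<Rightarrow> ('e \<Rightarrow> bool) \<Rightarrow> ('v \<Rightarrow> 'e list option) \<Rightarrow> 'e set \<Rightarrow> 'v \<Rightarrow> 'e list set" where
  "extensions G ok lab A a =
     {e # q | e q. e \<in> A \<and> ok e \<and> tail G e = a \<and> lab (head G e) = Some q}"

text \<open>
  Arcs leaving an inner vertex of such a part \<open>v\<close> stay in \<open>v\<close>, so the label of that vertex passes
  through \<open>b\<close> and continues there with the label of \<open>b\<close>.
\<close>

definition part_of ::
    "('v, 'e) pre_digraph \<Rightarrow> 'v \<Rightarrow> ('v, 'e) pre_digraph \<Rightarrow> 'v \<Rightarrow> 'v \<Rightarrow> bool" where
  "part_of G t v a b \<longleftrightarrow> arcs v \<subseteq> arcs G \<and> tail v = tail G \<and> head v = head G \<and>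
     (\<forall>x\<in>verts v - {a, b}. x \<noteq> t \<and> (\<forall>e\<in>arcs G. tail G e = x \<longrightarrow> e \<in> arcs v))"

section \<open>Subgraphs of tree nodes inside the whole graph\<close>

lemma part_ofD:
  assumes "part_of G t v a b"
  shows "arcs v \<subseteq> arcs G" "tail v = tail G" "head v = head G"
    "\<And>x. x \<in> verts v - {a, b} \<Longrightarrow> x \<noteq> t"
    "\<And>x e. \<lbrakk>x \<in> verts v - {a, b}; e \<in> arcs G; tail G e = x\<rbrakk> \<Longrightarrow> e \<in> arcs v"
proof -
  note P = assms[unfolded part_of_def]
  show "arcs v \<subseteq> arcs G" "tail v = tail G" "head v = head G"
    using P by simp_all
  have Q: "\<forall>x\<in>verts v - {a, b}. x \<noteq> t \<and> (\<forall>e\<in>arcs G. tail G e = x \<longrightarrow> e \<in> arcs v)"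
    using P by (elim conjE)
  show "x \<noteq> t" if "x \<in> verts v - {a, b}" for x using bspec[OF Q that] by (rule conjunct1)
  show "e \<in> arcs v" if "x \<in> verts v - {a, b}" "e \<in> arcs G" "tail G e = x" for x e
    using bspec[OF conjunct2[OF bspec[OF Q that(1)]] that(2)] that(3) by (rule mp)
qed

text \<open>\<open>m\<close> is an inner vertex of \<open>v\<close>, so all arcs of \<open>G\<close>
  that leave it lie in \<open>v2\<close>; the label of \<open>m\<close>, although chosen over all of
  \<open>G\<close>, is thus a choice within \<open>v2\<close>.\<close>

lemma part_of_series:
  assumes sp: "series_parallel v1 a m" "series_parallel v2 m b" and gl: "glued_at {m} v1 v2 v"
    and part: "part_of G t v a b"
  shows "part_of G t v1 a m" "part_of G t v2 m b" "m \<in> verts v - {a, b}"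
    "\<And>e. \<lbrakk>e \<in> arcs G; tail G e = m\<rbrakk> \<Longrightarrow> e \<in> arcs v2"
    "\<And>e. \<lbrakk>e \<in> arcs v; tail G e = a\<rbrakk> \<Longrightarrow> e \<in> arcs v1"
proof -
  note D = glued_atD[OF gl] and S1 = series_parallel_simps[OF sp(1)]
    and S2 = series_parallel_simps[OF sp(2)]
  have tl: "tail v = tail G" "head v = head G" using part_ofD[OF part] by simp_all
  have share: "x = m" if "x \<in> verts v1" "x \<in> verts v2" for x
    using IntI[OF that] unfolding D(4) by simp
  have nb: "b \<notin> verts v1" "a \<notin> verts v2"
    using share[of a] share[of b] S1(5,7) S2(6,7) by metis+
  have arc1: "tail G e \<in> verts v1" "tail G e \<noteq> m" if "e \<in> arcs v1" for e
    using S1(9,11)[OF that] D(5) tl by simp_all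
  have arc2: "tail G e \<in> verts v2" if "e \<in> arcs v2" for e
    using S2(11)[OF that] D(7) tl by simp
  have out: "e \<in> arcs v" if "x \<in> verts v - {a, b}" "e \<in> arcs G" "tail G e = x" for e x
    using part_ofD(5)[OF part] that by simp
  show m: "m \<in> verts v - {a, b}" using S1(6,7) S2(6,7) D(1) by auto
  show "part_of G t v1 a m"
    unfolding part_of_def
  proof (intro conjI ballI impI)
    fix x assume x: "x \<in> verts v1 - {a, m}"
    then have x': "x \<in> verts v - {a, b}" "x \<notin> verts v2" using nb(1) share[of x] D(1) by auto
    then show "x \<noteq> t" using part_ofD(4)[OF part] by simp
    fix e assume e: "e \<in> arcs G" "tail G e = x"
    have "e \<notin> arcs v2" using arc2[of e] x'(2) e(2) by auto
    then show "e \<in> arcs v1" using out[OF x'(1) e] D(2) by simp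
  qed (use part_ofD(1-3)[OF part] D(2,5-8) in auto)
  show "part_of G t v2 m b"
    unfolding part_of_def
  proof (intro conjI ballI impI)
    fix x assume x: "x \<in> verts v2 - {m, b}"
    then have x': "x \<in> verts v - {a, b}" "x \<notin> verts v1" using nb(2) share[of x] D(1) by auto
    then show "x \<noteq> t" using part_ofD(4)[OF part] by simp
    fix e assume e: "e \<in> arcs G" "tail G e = x"
    have "e \<notin> arcs v1" using arc1(1)[of e] x'(2) e(2) by auto
    then show "e \<in> arcs v2" using out[OF x'(1) e] D(2) by simp
  qed (use part_ofD(1-3)[OF part] D(2,5-8) in auto)
  show "e \<in> arcs v2" if "e \<in> arcs G" "tail G e = m" for e
    using out[OF m that] arc1(2)[of e] that(2) D(2) by auto
  show "e \<in> arcs v1" if "e \<in> arcs v" "tail G e = a" for e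
    using that nb(2) arc2[of e] D(2) by auto
qed

lemma part_of_parallel:
  assumes sp: "series_parallel v1 a b" "series_parallel v2 a b" and gl: "glued_at {a, b} v1 v2 v"
    and part: "part_of G t v a b"
  shows "part_of G t v1 a b"
  unfolding part_of_def
proof (intro conjI ballI impI)
  note D = glued_atD[OF gl] and S2 = series_parallel_simps[OF sp(2)]
  have tl: "tail v = tail G" "head v = head G" using part_ofD[OF part] by simp_all
  fix x assume x: "x \<in> verts v1 - {a, b}"
  then have x': "x \<in> verts v - {a, b}" "x \<notin> verts v2" using D(1,4) by auto
  then show "x \<noteq> t" using part_ofD(4)[OF part] by simp
  fix e assume "e \<in> arcs G" "tail G e = x"
  then have "e \<in> arcs v" using part_ofD(5)[OF part x'(1)] by simp
  moreover have "e \<notin> arcs v2" using S2(11)[of e] x'(2) \<open>tail G e = x\<close> D tl by auto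
  ultimately show "e \<in> arcs v1" using D(2) by blast
qed (use part_ofD(1-3)[OF part] glued_atD(2,5-8)[OF gl] in auto)

section \<open>Factors, costs and the local optimality of labels\<close>

lemma factor_prod_simps [simp]:
  "factor_prod f i [] = 1" "factor_prod f i (e # p) = (1 + f i e) * factor_prod f i p"
  "factor_prod f i (p @ q) = factor_prod f i p * factor_prod f i q"
  by (simp_all add: factor_prod_def)

lemma path_cost_simps [simp]:
  "path_cost f [] = 0" "path_cost f (e # p) = f e + path_cost f p"
  "path_cost f (p @ q) = path_cost f p + path_cost f q"
  by (simp_all add: path_cost_def)

lemma path_cost_nonneg: "(\<And>e. e \<in> set p \<Longrightarrow> 0 \<le> f e) \<Longrightarrow> 0 \<le> path_cost f p"
  by (auto simp: path_cost_def intro!: sum_list_nonneg)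

lemma factor_prod_ge_1:
  "(\<And>e. e \<in> set p \<Longrightarrow> 0 \<le> f i e) \<Longrightarrow> 1 \<le> factor_prod f i p"
proof (induction p)
  case (Cons e p)
  then show ?case using mult_mono[of 1 "1 + f i e" 1 "factor_prod f i p"] by auto
qed simp

lemma tree_height_le_Max: "T \<in> set Ts \<Longrightarrow> tree_height T \<le> Max (tree_height ` set Ts)"
  by simp

text \<open>Only the local optimality of a fixpoint is assumed, so the analysis is independent of
  how the labels are computed and how ties are broken.\<close>

locale greedy_labels =
  fixes G :: "('v, 'e) pre_digraph" and s t :: 'v and k :: nat
    and f :: "nat \<Rightarrow> 'e \<Rightarrow> real" and ok :: "'e \<Rightarrow> bool" and lab :: "'v \<Rightarrow> 'e list option"
  assumes sp: "series_parallel G s t"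
    and nonneg: "\<And>i e. \<lbrakk>i \<in> {1..k}; e \<in> arcs G\<rbrakk> \<Longrightarrow> 0 \<le> f i e"
    and lab_t: "lab t = Some []"
    and lab_None: "\<And>a. \<lbrakk>a \<noteq> t; lab a = None\<rbrakk> \<Longrightarrow> extensions G ok lab (arcs G) a = {}"
    and lab_Some: "\<And>a p. \<lbrakk>a \<noteq> t; lab a = Some p\<rbrakk> \<Longrightarrow> p \<in> extensions G ok lab (arcs G) a \<and>
      (\<forall>q\<in>extensions G ok lab (arcs G) a. potential k f p \<le> potential k f q)"
begin

abbreviation "ext v a \<equiv> extensions G ok lab (arcs v) a"

lemma lab_subset: "lab x = Some p \<Longrightarrow> set p \<subseteq> arcs G"
proof (induction p arbitrary: x)
  case (Cons e p)
  then have "x \<noteq> t" using lab_t by auto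
  then have "e \<in> arcs G" "lab (head G e) = Some p"
    using lab_Some[OF _ Cons.prems] by (auto simp: extensions_def)
  then show ?case using Cons.IH by auto
qed simp

lemma factor_prod_lab_ge_1:
  assumes "lab x = Some p" "i \<in> {1..k}"
  shows "1 \<le> factor_prod f i p"
  using lab_subset[OF assms(1)] assms(2) by (intro factor_prod_ge_1 nonneg) auto

text \<open>A label without its first arc is the label of the next vertex. Arcs from inner vertices
  stay in \<open>v\<close>, none of them enters \<open>a\<close>, and the labels get shorter, so
  \<open>b\<close> is reached.\<close>

lemma lab_through:
  assumes "series_parallel v a b" "part_of G t v a b"
  shows "\<lbrakk>x \<in> verts v; x \<noteq> a; lab x = Some p\<rbrakk> \<Longrightarrow>
    \<exists>q pb. lab b = Some pb \<and> p = q @ pb \<and> set q \<subseteq> arcs v"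
proof (induction p arbitrary: x rule: length_induct)
  case (1 p)
  show ?case
  proof (cases "x = b")
    case False
    then have x: "x \<noteq> t" "\<forall>e\<in>arcs G. tail G e = x \<longrightarrow> e \<in> arcs v"
      using assms(2) 1 by (auto simp: part_of_def)
    then obtain e q where e: "p = e # q" "e \<in> arcs G" "tail G e = x" "lab (head G e) = Some q"
      using lab_Some[OF x(1) 1(4)] by (auto simp: extensions_def)
    then have "e \<in> arcs v" using x by auto
    moreover have "head G e \<in> verts v" "head G e \<noteq> a"
      using series_parallel_simps(10,12)[OF assms(1) calculation] assms(2)
      by (auto simp: part_of_def)
    ultimately obtain q' pb where "lab b = Some pb" "q = q' @ pb" "set q' \<subseteq> arcs v"
      using 1(1)[rule_format, of q "head G e"] e by auto
    then show ?thesis using e \<open>e \<in> arcs v\<close> by (intro exI[of _ "e # q'"] exI[of _ pb]) auto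
  qed (use 1 in auto)
qed

lemma ext_through:
  assumes "series_parallel v a b" "part_of G t v a b" "p \<in> ext v a"
  shows "\<exists>q pb. lab b = Some pb \<and> p = q @ pb \<and> set q \<subseteq> arcs v"
proof -
  obtain e q where e: "p = e # q" "e \<in> arcs v" "lab (head G e) = Some q"
    using assms(3) by (auto simp: extensions_def)
  moreover have "head G e \<in> verts v" "head G e \<noteq> a"
    using series_parallel_simps(10,12)[OF assms(1) e(2)] assms(2)
    by (auto simp: part_of_def)
  ultimately obtain q' pb where "lab b = Some pb" "q = q' @ pb" "set q' \<subseteq> arcs v"
    using lab_through[OF assms(1,2), of "head G e" q] by auto
  then show ?thesis using e by (intro exI[of _ "e # q'"] exI[of _ pb]) auto
qed

text \<open>Every extension from \<open>a\<close> ends with the label of \<open>b\<close>, and the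
  arcs in front of it contribute factors of at least 1.\<close>

lemma factor_prod_mono:
  assumes "series_parallel v a b" "part_of G t v a b" "p \<in> ext v a" "lab b = Some pb" "i \<in> {1..k}"
  shows "factor_prod f i pb \<le> factor_prod f i p"
proof -
  obtain q where q: "p = q @ pb" "set q \<subseteq> arcs v" using ext_through[OF assms(1-3)] assms(4) by auto
  have "1 \<le> factor_prod f i q"
    using q assms(2,5) by (intro factor_prod_ge_1 nonneg) (auto simp: part_of_def)
  moreover have "1 \<le> factor_prod f i pb" by (rule factor_prod_lab_ge_1[OF assms(4,5)])
  ultimately show ?thesis using q mult_mono[of 1 "factor_prod f i q" "factor_prod f i pb"] by simp
qed

text \<open>To first order, the increase of the potential when \<open>Q\<close> is put in front of
  \<open>p\<close>.\<close>

abbreviation wcost :: "'e list \<Rightarrow> 'e list \<Rightarrow> real" where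
  "wcost p Q \<equiv> (\<Sum>i=1..k. factor_prod f i p * path_cost (f i) Q)"

text \<open>
  Every cost of \<open>Q\<close> is at most \<open>\<epsilon>\<close>, so the part of \<open>wcost p Q\<close> that is due to the increase itself is at
  most \<open>\<epsilon>\<close> times the increase and can be absorbed.
\<close>

lemma series_gain:
  fixes \<epsilon> :: real
  assumes "h * \<epsilon> < 1 - \<epsilon>" "0 \<le> \<epsilon>" "0 \<le> h"
    and le: "\<And>i. i \<in> {1..k} \<Longrightarrow> factor_prod f i pb \<le> factor_prod f i p"
    and Q: "\<And>i. i \<in> {1..k} \<Longrightarrow> path_cost (f i) Q \<le> \<epsilon>"
    and E: "potential k f p - potential k f pb \<le> wcost p Q / (1 - h * \<epsilon>)"
  shows "potential k f p - potential k f pb \<le> wcost pb Q / (1 - (h + 1) * \<epsilon>)"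
proof -
  define E where "E = potential k f p - potential k f pb"
  have "wcost p Q - wcost pb Q
      = (\<Sum>i=1..k. (factor_prod f i p - factor_prod f i pb) * path_cost (f i) Q)"
    by (simp add: sum_subtractf left_diff_distrib)
  also have "\<dots> \<le> (\<Sum>i=1..k. (factor_prod f i p - factor_prod f i pb) * \<epsilon>)"
    using le Q by (intro sum_mono mult_left_mono) auto
  also have "\<dots> = E * \<epsilon>"
    by (simp add: E_def potential_def sum_subtractf sum_distrib_right[symmetric])
  finally have "wcost p Q \<le> E * \<epsilon> + wcost pb Q" by simp
  moreover have "E * (1 - h * \<epsilon>) \<le> wcost p Q"
    using E assms(1,2) unfolding E_def[symmetric] by (simp add: pos_le_divide_eq)
  ultimately have "E * (1 - (h + 1) * \<epsilon>) \<le> wcost pb Q" by (simp add: algebra_simps)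
  moreover have "0 < 1 - (h + 1) * \<epsilon>" using assms(1) by (simp add: algebra_simps)
  ultimately show ?thesis by (simp add: E_def pos_le_divide_eq)
qed

lemma wcost_nonneg:
  assumes "lab x = Some p" "set Q \<subseteq> arcs G"
  shows "0 \<le> wcost p Q"
  using assms(2) order_trans[OF zero_le_one factor_prod_lab_ge_1[OF assms(1)]]
  by (intro sum_nonneg mult_nonneg_nonneg path_cost_nonneg) (auto intro: nonneg)

text \<open>The series clause differs from the other two in two ways. It weights the costs by the
  factors of \<open>p'\<close> itself, since only these dominate the factors met by all children;
  the series node then returns to the factors of \<open>pb\<close> by \<open>series_gain\<close>.
  And it speaks about every \<open>p'\<close> that is no worse than the witness \<open>p\<close>,
  since the label at the start of the remaining children is chosen by its potential and need not be
  the witness. All children use a common height bound \<open>h\<close>, so their estimates have the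
  same denominator and can be added.\<close>

lemma greedy_gain:
  fixes \<epsilon> :: real
  assumes \<epsilon>: "0 \<le> \<epsilon>"
  shows "decomposition_tree T v a b \<Longrightarrow> part_of G t v a b \<Longrightarrow> walk v a Q b \<Longrightarrow>
      (\<And>e. e \<in> set Q \<Longrightarrow> ok e) \<Longrightarrow> (\<And>i. i \<in> {1..k} \<Longrightarrow> path_cost (f i) Q \<le> \<epsilon>) \<Longrightarrow>
      tree_height T \<le> h \<Longrightarrow> real h * \<epsilon> < 1 \<Longrightarrow> lab b = Some pb \<Longrightarrow>
      \<exists>p\<in>ext v a. potential k f p - potential k f pb \<le> wcost pb Q / (1 - real h * \<epsilon>)"
  and "series_children Ts v a b \<Longrightarrow> part_of G t v a b \<Longrightarrow> walk v a Q b \<Longrightarrow>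
      (\<And>e. e \<in> set Q \<Longrightarrow> ok e) \<Longrightarrow> (\<And>i. i \<in> {1..k} \<Longrightarrow> path_cost (f i) Q \<le> \<epsilon>) \<Longrightarrow>
      (\<And>T. T \<in> set Ts \<Longrightarrow> tree_height T \<le> h) \<Longrightarrow> real h * \<epsilon> < 1 \<Longrightarrow> lab b = Some pb \<Longrightarrow>
      \<exists>p\<in>ext v a. \<forall>p'\<in>ext v a. potential k f p' \<le> potential k f p \<longrightarrow>
        potential k f p' - potential k f pb \<le> wcost p' Q / (1 - real h * \<epsilon>)"
  and "parallel_children Ts v a b \<Longrightarrow> part_of G t v a b \<Longrightarrow> walk v a Q b \<Longrightarrow>
      (\<And>e. e \<in> set Q \<Longrightarrow> ok e) \<Longrightarrow> (\<And>i. i \<in> {1..k} \<Longrightarrow> path_cost (f i) Q \<le> \<epsilon>) \<Longrightarrow>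
      (\<And>T. T \<in> set Ts \<Longrightarrow> tree_height T \<le> h) \<Longrightarrow> real h * \<epsilon> < 1 \<Longrightarrow> lab b = Some pb \<Longrightarrow>
      \<exists>p\<in>ext v a. potential k f p - potential k f pb \<le> wcost pb Q / (1 - real h * \<epsilon>)"
proof (induction arbitrary: Q h pb and Q h pb and Q h pb
    rule: decomposition_tree_series_children_parallel_children.inducts)
  case (dt_leaf v a b e)
  have v: "arcs v = {e}" "tail G e = a" "head G e = b" "e \<in> arcs G" "a \<noteq> b"
    using dt_leaf.hyps part_ofD(1-3)[OF dt_leaf.prems(1)] by (auto simp: single_arc_def)
  have Q: "Q = [e]"
    using dt_leaf.prems(2) v part_ofD(2,3)[OF dt_leaf.prems(1)]
    by (cases Q rule: list.exhaust; cases "tl Q") (auto simp: pre_digraph.cas.simps)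
  have "e # pb \<in> ext v a"
    using v Q dt_leaf.prems by (auto simp: extensions_def)
  \<comment> \<open>For a single arc \<open>wcost\<close> is the exact increase; a positive
    denominator of at most 1 can only enlarge it.\<close>
  moreover have "potential k f (e # pb) - potential k f pb = wcost pb Q"
    by (simp add: potential_def Q sum_subtractf[symmetric] algebra_simps)
  moreover have "wcost pb Q \<le> wcost pb Q / (1 - real h * \<epsilon>)"
    using wcost_nonneg[OF dt_leaf.prems(7), of Q] v Q dt_leaf.prems(6) \<epsilon>
    by (simp add: le_divide_eq mult_left_le)
  ultimately show ?case by (intro bexI[of _ "e # pb"]) auto
next
  case (dt_series Ts v a b)
  note sp' = series_children_series_parallel[OF dt_series.hyps(3)]
  obtain h' where h: "h = Suc h'" using dt_series.prems(5) by (cases h) auto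
  have le: "tree_height T \<le> h'" if "T \<in> set Ts" for T
    using tree_height_le_Max[OF that] dt_series.prems(5) h by simp
  \<comment> \<open>The children have height at most \<open>h'\<close>, so one
    \<open>\<epsilon>\<close> is left for absorbing the increase at this node.\<close>
  have h\<epsilon>: "real h' * \<epsilon> < 1 - \<epsilon>" using dt_series.prems(6) h by (simp add: algebra_simps)
  then have "real h' * \<epsilon> < 1" using \<epsilon> by simp
  then obtain p where p: "p \<in> ext v a"
    "potential k f p - potential k f pb \<le> wcost p Q / (1 - real h' * \<epsilon>)"
    using dt_series.IH[OF dt_series.prems(1,2,3,4) le _ dt_series.prems(7)] by blast
  have "potential k f p - potential k f pb \<le> wcost pb Q / (1 - (real h' + 1) * \<epsilon>)"
    using factor_prod_mono[OF sp' dt_series.prems(1) p(1) dt_series.prems(7)] dt_series.prems(4)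
    by (intro series_gain[OF h\<epsilon> \<epsilon> _ _ _ p(2)]) auto
  then show ?case using p h by (auto simp: add.commute)
next
  case (dt_parallel Ts v a b)
  show ?case
    using dt_parallel.prems(5)
    by (intro dt_parallel.IH[OF dt_parallel.prems(1,2,3,4) _ dt_parallel.prems(6,7)])
      (auto dest: tree_height_le_Max)
next
  case (sc_one T v a b)
  note sp' = decomposition_tree_series_parallel[OF sc_one.hyps(1)]
  obtain p where p: "p \<in> ext v a"
    "potential k f p - potential k f pb \<le> wcost pb Q / (1 - real h * \<epsilon>)"
    using sc_one.IH[OF sc_one.prems(1,2,3,4) _ sc_one.prems(6,7)] sc_one.prems(5) by auto
  \<comment> \<open>The bound for a single child has the weights of \<open>pb\<close>; the series
    clause asks for those of \<open>p'\<close>, which are larger.\<close>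
  have "wcost pb Q \<le> wcost p' Q" if "p' \<in> ext v a" for p'
    using subsetD[OF part_ofD(1)[OF sc_one.prems(1)]] sc_one.prems(2)
    by (intro sum_mono mult_right_mono path_cost_nonneg nonneg
        factor_prod_mono[OF sp' sc_one.prems(1) that sc_one.prems(7)]) auto
  then have "wcost pb Q / (1 - real h * \<epsilon>) \<le> wcost p' Q / (1 - real h * \<epsilon>)" if "p' \<in> ext v a" for p'
    using that sc_one.prems(6) by (simp add: divide_right_mono)
  then have "\<forall>p'\<in>ext v a. potential k f p' \<le> potential k f p \<longrightarrow>
      potential k f p' - potential k f pb \<le> wcost p' Q / (1 - real h * \<epsilon>)"
    using p(2) by (meson diff_right_mono order_trans)
  then show ?case using p(1) by (rule bexI)
next
  case (sc_more T v1 a m Ts v2 b v)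
  note sp1 = decomposition_tree_series_parallel[OF sc_more.hyps(1)]
  note sp2 = series_children_series_parallel[OF sc_more.hyps(2)]
  note part = part_of_series[OF sp1 sp2 sc_more.hyps(3) sc_more.prems(1)]
  note D = glued_atD[OF sc_more.hyps(3)]
  obtain Q1 Q2 where Q: "Q = Q1 @ Q2" "walk v1 a Q1 m" "walk v2 m Q2 b"
    using walk_series_split[OF sp1 sp2 sc_more.hyps(3) sc_more.prems(2)]
      series_parallel_simps(5)[OF sp1] by blast
  have sub: "set Q1 \<subseteq> arcs G" "set Q2 \<subseteq> arcs G"
    using Q(2,3) part_ofD(1)[OF part(1)] part_ofD(1)[OF part(2)] by auto
  have cost: "path_cost (f i) Q1 \<le> \<epsilon>" "path_cost (f i) Q2 \<le> \<epsilon>" if i: "i \<in> {1..k}" for i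
  proof -
    have "0 \<le> path_cost (f i) Q1" "0 \<le> path_cost (f i) Q2"
      using sub by (auto intro!: path_cost_nonneg nonneg[OF i])
    then show "path_cost (f i) Q1 \<le> \<epsilon>" "path_cost (f i) Q2 \<le> \<epsilon>"
      using sc_more.prems(4)[OF i] unfolding Q(1) path_cost_simps by linarith+
  qed
  obtain p2 where p2: "p2 \<in> ext v2 m" "\<And>p'. \<lbrakk>p' \<in> ext v2 m; potential k f p' \<le> potential k f p2\<rbrakk> \<Longrightarrow>
      potential k f p' - potential k f pb \<le> wcost p' Q2 / (1 - real h * \<epsilon>)"
  proof -
    have "ok e" if "e \<in> set Q2" for e using that sc_more.prems(3) Q by simp
    moreover have "tree_height T \<le> h" if "T \<in> set Ts" for T using that sc_more.prems(5) by simp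
    ultimately show ?thesis
      using sc_more.IH(2)[OF part(2) Q(3) _ cost(2) _ sc_more.prems(6,7)] that by blast
  qed
  have m: "m \<noteq> t" using part_ofD(4)[OF sc_more.prems(1) part(3)] .
  \<comment> \<open>The greedy choice at \<open>m\<close> ranges over exactly the extensions to
    which the hypothesis for the remaining children applies.\<close>
  have ext_m: "ext G m = ext v2 m"
    using part(4) part_ofD(1)[OF part(2)] unfolding extensions_def by blast
  then have "lab m \<noteq> None" using lab_None[OF m] p2(1) by blast
  then obtain pm where pm: "lab m = Some pm" by blast
  \<comment> \<open>\<open>pm\<close> need not be \<open>p2\<close>, but it is no worse, which is
    all that the bound for the remaining children asks for.\<close>
  have pm': "pm \<in> ext v2 m" "potential k f pm \<le> potential k f p2"
    using lab_Some[OF m pm] p2 ext_m by auto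
  obtain p where p: "p \<in> ext v1 a"
    "potential k f p - potential k f pm \<le> wcost pm Q1 / (1 - real h * \<epsilon>)"
  proof -
    have "ok e" if "e \<in> set Q1" for e using that sc_more.prems(3) Q by simp
    moreover have "tree_height T \<le> h" using sc_more.prems(5) by simp
    ultimately show ?thesis
      using sc_more.IH(1)[OF part(1) Q(2) _ cost(1) _ sc_more.prems(6) pm] that by blast
  qed
  have "potential k f p' - potential k f pb \<le> wcost p' Q / (1 - real h * \<epsilon>)"
    if p': "p' \<in> ext v a" "potential k f p' \<le> potential k f p" for p'
  proof -
    \<comment> \<open>\<open>p'\<close> runs through \<open>m\<close> and ends with
      \<open>pm\<close>, so its factors dominate those by which the costs of \<open>Q1\<close> and
      of \<open>Q2\<close> are weighted.\<close>
    have "p' \<in> ext v1 a" using p'(1) part(5) unfolding extensions_def by blast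
    then have mono: "factor_prod f i pm \<le> factor_prod f i p'" if "i \<in> {1..k}" for i
      using factor_prod_mono[OF sp1 part(1) _ pm that] by simp
    have "wcost pm Q1 + wcost pm Q2 = wcost pm Q"
      by (simp add: Q sum.distrib distrib_left)
    also have "\<dots> \<le> wcost p' Q"
      using sub Q nonneg by (intro sum_mono mult_right_mono mono path_cost_nonneg) auto
    finally have "wcost pm Q1 / (1 - real h * \<epsilon>) + wcost pm Q2 / (1 - real h * \<epsilon>)
        \<le> wcost p' Q / (1 - real h * \<epsilon>)"
      using sc_more.prems(6) by (simp add: divide_right_mono add_divide_distrib[symmetric])
    then show ?thesis using p' p(2) p2(2)[OF pm'] by linarith
  qed
  then have "\<forall>p'\<in>ext v a. potential k f p' \<le> potential k f p \<longrightarrow>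
      potential k f p' - potential k f pb \<le> wcost p' Q / (1 - real h * \<epsilon>)"
    by (intro ballI impI)
  moreover have "p \<in> ext v a" using p(1) D(2) by (auto simp: extensions_def)
  ultimately show ?case by (rule bexI)
next
  case (pc_one T v a b)
  have "tree_height T \<le> h" using pc_one.prems(5) by simp
  from pc_one.IH[OF pc_one.prems(1-4) this pc_one.prems(6,7)] show ?case .
next
  case (pc_more T v1 a b Ts v2 v)
  note sp1 = decomposition_tree_series_parallel[OF pc_more.hyps(1)]
  note sp2 = parallel_children_series_parallel[OF pc_more.hyps(2)]
  note D = glued_atD[OF pc_more.hyps(3)]
  have part: "part_of G t v1 a b" "part_of G t v2 a b"
    using part_of_parallel[OF sp1 sp2 pc_more.hyps(3) pc_more.prems(1)]
      part_of_parallel[OF sp2 sp1 glued_at_commute[OF pc_more.hyps(3)] pc_more.prems(1)] by auto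
  have sub: "ext v1 a \<subseteq> ext v a" "ext v2 a \<subseteq> ext v a" using D by (auto simp: extensions_def)
  show ?case
    using walk_parallel_split[OF sp1 sp2 pc_more.hyps(3) pc_more.prems(2)]
  proof
    assume w: "walk v1 a Q b"
    have "tree_height T \<le> h" using pc_more.prems(5) by simp
    from pc_more.IH(1)[OF part(1) w pc_more.prems(3,4) this pc_more.prems(6,7)]
    show ?thesis using sub by blast
  next
    assume w: "walk v2 a Q b"
    have "tree_height T \<le> h" if "T \<in> set Ts" for T using that pc_more.prems(5) by simp
    from pc_more.IH(2)[OF part(2) w pc_more.prems(3,4) this pc_more.prems(6,7)]
    show ?thesis using sub by blast
  qed
qed

end

section \<open>Greedy labels and thresholds\<close>

definition better :: "nat \<Rightarrow> (nat \<Rightarrow> 'e \<Rightarrow> real) \<Rightarrow> 'e list option \<Rightarrow> 'e list \<Rightarrow> 'e list option" where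
  "better k f cur q = (case cur of None \<Rightarrow> Some q
     | Some p \<Rightarrow> if potential k f q < potential k f p then Some q else Some p)"

definition relax_arc ::
    "('v, 'e) pre_digraph \<Rightarrow> nat \<Rightarrow> (nat \<Rightarrow> 'e \<Rightarrow> real) \<Rightarrow> ('e \<Rightarrow> bool) \<Rightarrow> ('v \<Rightarrow> 'e list option) \<Rightarrow>
      'v \<Rightarrow> 'e \<Rightarrow> 'e list option \<Rightarrow> 'e list option" where
  "relax_arc G k f ok lab a e cur =
     (if tail G e = a then
        (case lab (head G e) of None \<Rightarrow> cur | Some q \<Rightarrow> if ok e then better k f cur (e # q) else cur)
      else cur)"

definition relax ::
    "('v, 'e) pre_digraph \<Rightarrow> nat \<Rightarrow> (nat \<Rightarrow> 'e \<Rightarrow> real) \<Rightarrow> ('e \<Rightarrow> bool) \<Rightarrow> ('v \<Rightarrow> 'e list option) \<Rightarrow>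
      'e list \<Rightarrow> 'v \<Rightarrow> 'e list option" where
  "relax G k f ok lab es a = fold (relax_arc G k f ok lab a) es None"

text \<open>The fold maintains the minimum over the arcs scanned so far; the induction is from the
  right because the last arc is processed last.\<close>

lemma relax_correct:
  "case relax G k f ok lab es a of
     None \<Rightarrow> extensions G ok lab (set es) a = {}
   | Some p \<Rightarrow> p \<in> extensions G ok lab (set es) a \<and>
       (\<forall>q\<in>extensions G ok lab (set es) a. potential k f p \<le> potential k f q)"
proof (induction es rule: rev_induct)
  case Nil
  then show ?case by (simp add: relax_def extensions_def)
next
  case (snoc e es)
  have E: "extensions G ok lab (set (es @ [e])) a = extensions G ok lab (set es) a \<union>
    (if tail G e = a \<and> ok e then (case lab (head G e) of None \<Rightarrow> {} | Some q \<Rightarrow> {e # q}) else {})"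
    by (auto simp: extensions_def split: option.splits if_splits)
  have R: "relax G k f ok lab (es @ [e]) a = relax_arc G k f ok lab a e (relax G k f ok lab es a)"
    by (simp add: relax_def)
  show ?case
    using snoc.IH unfolding E R
    by (auto simp: relax_arc_def better_def split: option.splits if_splits)
qed

lemma relax_cong:
  assumes "\<And>e. \<lbrakk>e \<in> set es; tail G e = a\<rbrakk> \<Longrightarrow> lab (head G e) = lab' (head G e)"
  shows "relax G k f ok lab es a = relax G k f ok lab' es a"
  unfolding relax_def
  by (intro fold_cong refl) (auto simp: relax_arc_def fun_eq_iff assms)

text \<open>All new labels are computed from the old ones, so no topological order of the vertices
  has to be found.\<close>

definition relax_round ::
    "('v, 'e) pre_digraph \<Rightarrow> 'v \<Rightarrow> nat \<Rightarrow> (nat \<Rightarrow> 'e \<Rightarrow> real) \<Rightarrow> ('e \<Rightarrow> bool) \<Rightarrow> 'e list \<Rightarrow>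
      ('v \<Rightarrow> 'e list option) \<Rightarrow> 'v \<Rightarrow> 'e list option" where
  "relax_round G t k f ok es lab a =
     (if a = t then Some [] else if a \<in> verts G then relax G k f ok lab es a else None)"

definition labels ::
    "('v, 'e) pre_digraph \<Rightarrow> 'v \<Rightarrow> nat \<Rightarrow> (nat \<Rightarrow> 'e \<Rightarrow> real) \<Rightarrow> ('e \<Rightarrow> bool) \<Rightarrow> 'e list \<Rightarrow>
      nat \<Rightarrow> 'v \<Rightarrow> 'e list option" where
  "labels G t k f ok es n = (relax_round G t k f ok es ^^ n) [t \<mapsto> []]"

text \<open>The label of a vertex depends only on labels of vertices of smaller rank, so it is
  settled after as many rounds as its rank.\<close>

lemma labels_stable:
  assumes "\<And>e. e \<in> set es \<Longrightarrow> r (head G e) < r (tail G e)" "r a \<le> n"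
    "t \<in> verts G" "set es = arcs G"
  shows "labels G t k f ok es (Suc n) a = labels G t k f ok es n a"
  using assms(2)
proof (induction n arbitrary: a)
  case 0
  \<comment> \<open>An arc leaving a vertex of rank 0 would have a head of negative rank.\<close>
  have "relax G k f ok [t \<mapsto> []] es a = None" 
  proof -
    have "extensions G ok [t \<mapsto> []] (set es) a = {}"
      using assms(1) 0 by (fastforce simp: extensions_def)
    then show ?thesis using relax_correct[where G = G and k = k and f = f and ok = ok and lab = "[t \<mapsto> []]" and es = es and a = a] by (auto split: option.splits)
  qed
  then show ?case by (auto simp: labels_def relax_round_def)
next
  case (Suc n)
  have "relax G k f ok (labels G t k f ok es (Suc n)) es a = relax G k f ok (labels G t k f ok es n) es a"
  proof (rule relax_cong)
    fix e assume "e \<in> set es" "tail G e = a"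
    then have "r (head G e) < r a" using assms(1) by blast
    then show "labels G t k f ok es (Suc n) (head G e) = labels G t k f ok es n (head G e)"
      using Suc by auto
  qed
  then have "relax_round G t k f ok es (labels G t k f ok es (Suc n)) a =
      relax_round G t k f ok es (labels G t k f ok es n) a"
    by (simp add: relax_round_def)
  then show ?case by (simp add: labels_def)
qed

text \<open>Every rank is at most the number of arcs, so one more round changes nothing, and a
  fixpoint of \<open>relax_round\<close> is locally optimal by \<open>relax_correct\<close>.\<close>

lemma labels_greedy:
  assumes sp: "series_parallel G s t" and es: "set es = arcs G" "distinct es"
    and nonneg: "\<And>i e. \<lbrakk>i \<in> {1..k}; e \<in> arcs G\<rbrakk> \<Longrightarrow> 0 \<le> f i e"
  shows "greedy_labels G s t k f ok (labels G t k f ok es (length es))"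
proof -
  define lab where "lab = labels G t k f ok es (length es)"
  note S = series_parallel_simps[OF sp]
  obtain r :: "'a \<Rightarrow> nat" where r: "\<forall>e\<in>arcs G. r (head G e) < r (tail G e)"
    "\<forall>v\<in>verts G. r v \<le> r s" "r s \<le> card (arcs G)"
    using series_parallel_rank[OF sp] by blast
  have m: "card (arcs G) = length es" using es distinct_card by fastforce
  have "labels G t k f ok es (Suc (length es)) a = lab a" if "a \<in> verts G" for a
    unfolding lab_def using r that m es(1) S(6) by (intro labels_stable[where r = r]) fastforce+
  then have fix1: "lab a = relax_round G t k f ok es lab a" if "a \<in> verts G" for a
    using that by (simp add: lab_def labels_def)
  have out: "lab a = None" if "a \<notin> verts G" for a
    using that S(6) by (cases es) (auto simp: lab_def labels_def relax_round_def)
  have fix2: "lab a = relax G k f ok lab es a" if "a \<noteq> t" "a \<in> verts G" for a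
    using fix1[OF that(2)] that by (simp add: relax_round_def)
  show ?thesis
    unfolding lab_def[symmetric]
  proof
    show "lab t = Some []" using fix1[OF S(6)] by (simp add: relax_round_def)
    fix a assume a: "a \<noteq> t"
    show "extensions G ok lab (arcs G) a = {}" if "lab a = None"
    proof (cases "a \<in> verts G")
      case True
      then show ?thesis using relax_correct[where G = G and k = k and f = f and ok = ok and lab = lab and es = es and a = a] fix2[OF a True] that es by simp
    next
      case False
      then show ?thesis using S(11) by (auto simp: extensions_def)
    qed
    fix p assume p: "lab a = Some p"
    then have "a \<in> verts G" using out by fastforce
    from fix2[OF a this] p have "relax G k f ok lab es a = Some p" by simp
    then show "p \<in> extensions G ok lab (arcs G) a \<and>
      (\<forall>q\<in>extensions G ok lab (arcs G) a. potential k f p \<le> potential k f q)"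
      using relax_correct[where G = G and k = k and f = f and ok = ok and lab = lab and es = es and a = a] es by simp
  qed (use sp nonneg in auto)
qed

text \<open>Ranks decrease along the walk. The bound on the ranks of all visited vertices carries
  the induction: the start exceeds everything that follows and so is not revisited.\<close>

lemma ranked_walk_apath:
  fixes r :: "'v \<Rightarrow> nat"
  assumes "wf_digraph G" "\<forall>e\<in>arcs G. r (head G e) < r (tail G e)" "u \<in> verts G" "walk G u p v"
  shows "pre_digraph.apath G u p v \<and> (\<forall>y\<in>set (pre_digraph.awalk_verts G u p). r y \<le> r u) \<and> length p \<le> r u"
  using assms(3,4)
proof (induction p arbitrary: u)
  case Nil
  then show ?case
    by (simp add: pre_digraph.apath_def pre_digraph.awalk_def pre_digraph.awalk_verts.simps)
next
  case (Cons e p)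
  then have e: "e \<in> arcs G" "tail G e = u" "walk G (head G e) p v" "head G e \<in> verts G"
    using assms(1) by (auto simp: pre_digraph.cas.simps wf_digraph_def)
  then have "r (head G e) < r u" using assms(2) by auto
  then show ?case
    using Cons.IH[OF e(4,3)] e Cons.prems
    by (fastforce simp: pre_digraph.apath_def pre_digraph.awalk_def pre_digraph.awalk_verts.simps
        pre_digraph.cas.simps)
qed

context greedy_labels
begin

lemma lab_walk:
  assumes "lab x = Some p"
  shows "walk G x p t"
  using assms
proof (induction p arbitrary: x)
  case Nil
  then have "x = t" using lab_Some[OF _ Nil] by (auto simp: extensions_def)
  then show ?case by (simp add: pre_digraph.cas.simps)
next
  case (Cons e p)
  then have "x \<noteq> t" using lab_t by auto
  then have e: "e \<in> arcs G" "tail G e = x" "lab (head G e) = Some p"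
    using lab_Some[OF _ Cons.prems] by (auto simp: extensions_def)
  then show ?case using Cons.IH[OF e(3)] by (auto simp: pre_digraph.cas.simps)
qed

lemma lab_ok:
  assumes "lab x = Some p" "e \<in> set p"
  shows "ok e"
  using assms
proof (induction p arbitrary: x)
  case (Cons e' p)
  then have "x \<noteq> t" using lab_t by auto
  then have e: "ok e'" "lab (head G e') = Some p"
    using lab_Some[OF _ Cons.prems(1)] by (auto simp: extensions_def)
  then show ?case using Cons.IH[OF e(2)] Cons.prems by auto
qed simp

lemma lab_defined:
  assumes "walk G x p t" "\<And>e. e \<in> set p \<Longrightarrow> ok e"
  shows "lab x \<noteq> None"
  using assms
proof (induction p arbitrary: x)
  case Nil
  then show ?case using lab_t by (simp add: pre_digraph.cas.simps)
next
  case (Cons e p)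
  then have e: "e \<in> arcs G" "tail G e = x" "ok e" "lab (head G e) \<noteq> None"
    by (auto simp: pre_digraph.cas.simps)
  then obtain q where "lab (head G e) = Some q" by blast
  then have "e # q \<in> extensions G ok lab (arcs G) x" using e by (auto simp: extensions_def)
  then show ?case using lab_None[of x] lab_t by (cases "x = t") auto
qed

lemma lab_length:
  assumes "lab s = Some p"
  shows "pre_digraph.apath G s p t" "length p \<le> card (arcs G)"
proof -
  note S = series_parallel_simps[OF sp]
  obtain r :: "'v \<Rightarrow> nat" where r: "\<forall>e\<in>arcs G. r (head G e) < r (tail G e)" "r s \<le> card (arcs G)"
    using series_parallel_rank[OF sp] by blast
  then show "pre_digraph.apath G s p t" "length p \<le> card (arcs G)"
    using ranked_walk_apath[OF S(2) r(1) S(5) lab_walk[OF assms]] by auto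
qed

text \<open>This is \<open>greedy_gain\<close> for the whole graph. The label of the sink is empty,
  so all weights are 1 and \<open>wcost [] Q\<close> is the sum of the scaled costs.\<close>

lemma potential_opt:
  assumes T: "decomposition_tree T G s t" and Q: "walk G s Q t" "\<And>e. e \<in> set Q \<Longrightarrow> ok e"
    and cost: "\<And>i. i \<in> {1..k} \<Longrightarrow> path_cost (f i) Q \<le> 1 / (real (tree_height T) + 2)"
  shows "\<exists>p. lab s = Some p \<and> potential k f p \<le> 2 * real k"
proof -
  note S = series_parallel_simps[OF sp]
  \<comment> \<open>With this choice the last denominator is \<open>2 * \<epsilon>\<close>, so the
    increase is at most \<open>k * \<epsilon> / (2 * \<epsilon>) = k / 2\<close>, on top of the
    potential \<open>k\<close> of the empty path.\<close>
  define \<epsilon> where "\<epsilon> = 1 / (real (tree_height T) + 2)"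
  have \<epsilon>: "0 < \<epsilon>" "1 - real (tree_height T) * \<epsilon> = 2 * \<epsilon>"
    by (auto simp: \<epsilon>_def field_simps)
  have "part_of G t G s t" using S(9) by (auto simp: part_of_def)
  moreover have "real (tree_height T) * \<epsilon> < 1" using \<epsilon> by linarith
  ultimately obtain p where p: "p \<in> ext G s"
    "potential k f p - potential k f [] \<le> wcost [] Q / (1 - real (tree_height T) * \<epsilon>)"
    using greedy_gain(1)[OF _ T _ Q(1) Q(2) cost[folded \<epsilon>_def] order_refl _ lab_t] \<epsilon> by fastforce
  have "wcost [] Q \<le> (\<Sum>i=1..k. \<epsilon>)"
    by (intro sum_mono) (use cost in \<open>auto simp: \<epsilon>_def\<close>)
  then have "wcost [] Q \<le> real k / 2 * (2 * \<epsilon>)" by simp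
  then have "wcost [] Q / (1 - real (tree_height T) * \<epsilon>) \<le> real k / 2"
    unfolding \<epsilon>(2) by (subst pos_divide_le_eq) (use \<epsilon>(1) in auto)
  moreover have "potential k f [] = real k" by (simp add: potential_def)
  ultimately have "potential k f p \<le> 2 * real k" using p(2) by linarith
  moreover have "lab s \<noteq> None" using lab_defined[OF Q] .
  then obtain p' where p': "lab s = Some p'" by blast
  then have "potential k f p' \<le> potential k f p" using lab_Some[OF S(7) p'] p(1) by auto
  ultimately show ?thesis using p' by auto
qed

end

section \<open>Scaled costs and thresholds\<close>

definition scaled :: "(nat \<Rightarrow> 'e \<Rightarrow> real) \<Rightarrow> real \<Rightarrow> nat \<Rightarrow> 'e \<Rightarrow> real" where
  "scaled c D i e = c i e / D"

definition cheap :: "nat \<Rightarrow> (nat \<Rightarrow> 'e \<Rightarrow> real) \<Rightarrow> real \<Rightarrow> 'e \<Rightarrow> bool" where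
  "cheap k c D e \<longleftrightarrow> (\<forall>i\<in>{1..k}. c i e \<le> D)"

text \<open>
  The threshold \<open>D = 0\<close> needs no special treatment: all scaled costs are \<open>0\<close>, because \<open>x / 0 = 0\<close>, and
  only arcs without cost are cheap.
\<close>

definition attempt ::
    "('v, 'e) pre_digraph \<Rightarrow> 'v \<Rightarrow> 'v \<Rightarrow> nat \<Rightarrow> (nat \<Rightarrow> 'e \<Rightarrow> real) \<Rightarrow> 'e list \<Rightarrow> real \<Rightarrow> 'e list option" where
  "attempt G s t k c es D =
     (case labels G t k (scaled c D) (cheap k c D) es (length es) s of
        None \<Rightarrow> None
      | Some p \<Rightarrow> if potential k (scaled c D) p \<le> 2 * real k then Some p else None)"

lemma path_cost_scaled: "path_cost (scaled c D i) p = path_cost (c i) p / D"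
  by (induction p) (auto simp: scaled_def add_divide_distrib)

text \<open>The inequality \<open>exp (x / 2) \<le> 1 + x\<close> is used for
  \<open>0 \<le> x \<le> 1\<close>, which is why arcs above the threshold are discarded. It turns a
  bound on the potential into one on the cost.\<close>

lemma exp_le_factor_prod:
  assumes "\<And>e. e \<in> set p \<Longrightarrow> 0 \<le> f i e \<and> f i e \<le> 1"
  shows "exp (path_cost (f i) p / 2) \<le> factor_prod f i p"
  using assms
proof (induction p)
  case (Cons e p)
  have fe: "0 \<le> f i e" "f i e \<le> 1" using Cons.prems by auto
  have "exp (f i e / 2) \<le> 1 + f i e / 2 + (f i e / 2)\<^sup>2" using fe by (intro exp_bound) auto
  also have "(f i e / 2)\<^sup>2 \<le> f i e / 2"
    using fe mult_left_le[of "f i e" "f i e"] by (simp add: power2_eq_square)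
  finally have "exp (f i e / 2) \<le> 1 + f i e" by simp
  then have "exp (f i e / 2) * exp (path_cost (f i) p / 2) \<le> (1 + f i e) * factor_prod f i p"
    using Cons fe by (intro mult_mono) auto
  then show ?case by (simp add: exp_add[symmetric] add_divide_distrib)
qed simp

lemma factor_prod_le_exp:
  assumes "\<And>e. e \<in> set p \<Longrightarrow> 0 \<le> f i e \<and> f i e \<le> x"
  shows "factor_prod f i p \<le> exp (real (length p) * x)"
  using assms
proof (induction p)
  case (Cons e p)
  have "1 + f i e \<le> exp x" using exp_ge_add_one_self[of x] Cons.prems[of e] by (simp del: exp_ge_add_one_self)
  then have "(1 + f i e) * factor_prod f i p \<le> exp x * exp (real (length p) * x)"
    using Cons factor_prod_ge_1[of p f i] by (intro mult_mono) fastforce+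
  then show ?case by (simp add: exp_add[symmetric] algebra_simps)
qed simp

locale robust_instance =
  fixes G :: "('v, 'e) pre_digraph" and s t :: 'v and k :: nat and c :: "nat \<Rightarrow> 'e \<Rightarrow> real"
    and es :: "'e list"
  assumes inst: "sp_instance G s t k c" and es: "set es = arcs G" "distinct es"
begin

lemma sp: "series_parallel G s t" and k: "1 \<le> k"
  and c_nonneg: "\<lbrakk>i \<in> {1..k}; e \<in> arcs G\<rbrakk> \<Longrightarrow> 0 \<le> c i e"
  using inst by (auto simp: sp_instance_def)

lemma greedy:
  assumes "0 \<le> D"
  shows "greedy_labels G s t k (scaled c D) (cheap k c D)
    (labels G t k (scaled c D) (cheap k c D) es (length es))"
  using assms c_nonneg by (intro labels_greedy sp es) (auto simp: scaled_def)

lemma card_arcs: "card (arcs G) = length es"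
  using es distinct_card by fastforce

lemma attempt_apath: "\<lbrakk>0 \<le> D; attempt G s t k c es D = Some p\<rbrakk> \<Longrightarrow> pre_digraph.apath G s p t"
  using greedy_labels.lab_length(1)[OF greedy]
  by (auto simp: attempt_def split: option.splits if_splits)

text \<open>Each of the other \<open>k - 1\<close> factors is at least 1, so a potential of at most
  \<open>2 * k\<close> leaves at most \<open>k + 1\<close> for agent \<open>i\<close>; then take
  logarithms.\<close>

lemma attempt_cost:
  assumes D: "0 \<le> D" and att: "attempt G s t k c es D = Some p" and i: "i \<in> {1..k}"
  shows "path_cost (c i) p \<le> 2 * D * ln (real k + 1)"
proof -
  interpret greedy_labels G s t k "scaled c D" "cheap k c D"
    "labels G t k (scaled c D) (cheap k c D) es (length es)" using greedy[OF D] .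
  have p: "labels G t k (scaled c D) (cheap k c D) es (length es) s = Some p"
    "potential k (scaled c D) p \<le> 2 * real k"
    using att by (auto simp: attempt_def split: option.splits if_splits)
  have e: "0 \<le> c i e" "c i e \<le> D" if "e \<in> set p" for e
    using that lab_ok[OF p(1) that] i c_nonneg lab_subset[OF p(1)] by (auto simp: cheap_def)
  have ge1: "1 \<le> factor_prod (scaled c D) j p" if "j \<in> {1..k}" for j
    using factor_prod_lab_ge_1[OF p(1) that] .
  have "potential k (scaled c D) p =
      factor_prod (scaled c D) i p + (\<Sum>j\<in>{1..k} - {i}. factor_prod (scaled c D) j p)"
    unfolding potential_def using i by (subst sum.remove[of _ i]) auto
  moreover have "(\<Sum>j\<in>{1..k} - {i}. 1) \<le> (\<Sum>j\<in>{1..k} - {i}. factor_prod (scaled c D) j p)"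
    using ge1 by (intro sum_mono) auto
  moreover have "(\<Sum>j\<in>{1..k} - {i}. 1 :: real) = real k - 1" using i by (simp add: of_nat_diff)
  ultimately have le: "factor_prod (scaled c D) i p \<le> real k + 1" using p(2) by linarith
  show ?thesis
  \<comment> \<open>For \<open>D = 0\<close> the factors say nothing about the cost, but then the
    cheap arcs cost nothing.\<close>
  proof (cases "D = 0")
    case True
    then have "c i e = 0" if "e \<in> set p" for e using e[OF that] by simp
    then have "path_cost (c i) p = 0" by (induction p) auto
    then show ?thesis using True by simp
  next
    case False
    have "exp (path_cost (c i) p / D / 2) \<le> real k + 1"
      using exp_le_factor_prod[of p "scaled c D" i] e D False le
      by (simp add: path_cost_scaled scaled_def)
    then have "path_cost (c i) p / D / 2 \<le> ln (real k + 1)" by (simp add: ln_ge_iff)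
    then show ?thesis using D False by (simp add: field_simps)
  qed
qed

text \<open>All arcs are cheap and a label has at most \<open>length es\<close> of them, so each
  factor is at most \<open>exp (1 / 2) \<le> 2\<close>. This gives success for some threshold
  without reference to a decomposition tree.\<close>

lemma attempt_large:
  assumes D: "0 \<le> D"
    and large: "\<And>i e. \<lbrakk>i \<in> {1..k}; e \<in> arcs G\<rbrakk> \<Longrightarrow> 2 * real (length es) * c i e \<le> D"
  shows "attempt G s t k c es D \<noteq> None"
proof -
  interpret greedy_labels G s t k "scaled c D" "cheap k c D"
    "labels G t k (scaled c D) (cheap k c D) es (length es)" using greedy[OF D] .
  have m: "1 \<le> length es" using es series_parallel_simps(8)[OF sp] by (cases es) auto
  have "c i e \<le> 2 * real (length es) * c i e" if "i \<in> {1..k}" "e \<in> arcs G" for i e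
    using c_nonneg[OF that] m mult_right_mono[of 1 "2 * real (length es)" "c i e"] by simp
  then have "cheap k c D e" if "e \<in> arcs G" for e
    using large that by (fastforce simp: cheap_def)
  then obtain p where p: "labels G t k (scaled c D) (cheap k c D) es (length es) s = Some p"
    using series_parallel_walk[OF sp] lab_defined by blast
  have "factor_prod (scaled c D) i p \<le> 2" if i: "i \<in> {1..k}" for i
  proof -
    have "scaled c D i e \<le> 1 / (2 * real (length es))" if "e \<in> arcs G" for e
    proof (cases "D = 0")
      case False
      then have "c i e \<le> 1 / (2 * real (length es)) * D"
        using large[OF i that] m by (subst times_divide_eq_left, subst pos_le_divide_eq) (auto simp: mult_ac)
      then show ?thesis using D False by (simp add: scaled_def pos_divide_le_eq)
    qed (simp add: scaled_def)
    then have "factor_prod (scaled c D) i p \<le> exp (real (length p) * (1 / (2 * real (length es))))"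
      using lab_subset[OF p] nonneg[OF i] by (intro factor_prod_le_exp) auto
    also have "real (length p) * (1 / (2 * real (length es))) \<le> 1 / 2"
      using lab_length(2)[OF p] m by (auto simp: card_arcs divide_le_eq)
    also have "exp (1 / 2 :: real) \<le> 2"
      using exp_bound[of "1 / 2 :: real"] by (simp add: power2_eq_square)
    finally show ?thesis by simp
  qed
  then have "potential k (scaled c D) p \<le> (\<Sum>i=1..k. 2)"
    unfolding potential_def by (intro sum_mono) auto
  then show ?thesis using p by (simp add: attempt_def)
qed

lemma attempt_opt:
  assumes D: "0 \<le> D" and T: "decomposition_tree T G s t" and Q: "walk G s Q t"
    and cost: "\<And>i. i \<in> {1..k} \<Longrightarrow> (real (tree_height T) + 2) * path_cost (c i) Q \<le> D"
  shows "attempt G s t k c es D \<noteq> None"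
proof -
  interpret greedy_labels G s t k "scaled c D" "cheap k c D"
    "labels G t k (scaled c D) (cheap k c D) es (length es)" using greedy[OF D] .
  have nn: "0 \<le> c i e" if "i \<in> {1..k}" "e \<in> set Q" for i e
    using that Q c_nonneg by auto
  have "cheap k c D e" if e: "e \<in> set Q" for e
    unfolding cheap_def
  proof
    fix i assume i: "i \<in> {1..k}"
    have "c i e \<le> path_cost (c i) Q"
      unfolding path_cost_def using e nn[OF i] by (intro member_le_sum_list) auto
    also have "\<dots> \<le> (real (tree_height T) + 2) * path_cost (c i) Q"
      using path_cost_nonneg[of Q "c i"] nn[OF i]
        mult_right_mono[of 1 "real (tree_height T) + 2" "path_cost (c i) Q"] by simp
    finally show "c i e \<le> D" using cost[OF i] by simp
  qed
  moreover have "path_cost (scaled c D i) Q \<le> 1 / (real (tree_height T) + 2)" if "i \<in> {1..k}" for i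
    using cost[OF that] D by (cases "D = 0") (auto simp: path_cost_scaled field_simps)
  ultimately show ?thesis
    using potential_opt[OF T Q] by (auto simp: attempt_def)
qed

text \<open>The \<open>Min\<close> in \<open>OPT\<close> is attained because there are finitely many
  simple paths and, by \<open>series_parallel_walk\<close>, at least one.\<close>

lemma OPT_attained:
  obtains Q where "pre_digraph.apath G s Q t" "robust_cost k c Q = OPT G s t k c"
proof -
  interpret fin_digraph G using series_parallel_simps(1)[OF sp] .
  obtain r :: "'v \<Rightarrow> nat" where r: "\<forall>e\<in>arcs G. r (head G e) < r (tail G e)"
    using series_parallel_rank[OF sp] by blast
  obtain p where "walk G s p t" using series_parallel_walk[OF sp] by blast
  then have "apath s p t"
    using ranked_walk_apath[OF _ r series_parallel_simps(5)[OF sp]] wf_digraph by blast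
  moreover have "finite {p. apath s p t}" by (rule apaths_finite)
  ultimately have "OPT G s t k c \<in> robust_cost k c ` {p. apath s p t}"
    unfolding OPT_def by (intro Min_in) auto
  then show ?thesis using that by auto
qed

text \<open>If \<open>M\<close> is the largest cost on an optimal path and \<open>m\<close> the
  number of arcs, \<open>OPT\<close> lies between \<open>M\<close> and \<open>m * M\<close>, so
  \<open>m\<close> quadruplings of \<open>M\<close> reach \<open>(H + 2) * OPT\<close>. As the
  optimal path is unknown, every arc cost is tried as \<open>M\<close>. The exponent starts at 1
  because the program quadruples before each trial.\<close>

definition candidates :: "real set" where
  "candidates = {4 ^ j * c i e | j i e. j \<in> {1..length es} \<and> i \<in> {1..k} \<and> e \<in> arcs G}"

lemma candidates_nonneg: "D \<in> candidates \<Longrightarrow> 0 \<le> D"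
  using c_nonneg by (auto simp: candidates_def)

lemma length_es: "1 \<le> length es"
  using es series_parallel_simps(8)[OF sp] by (cases es) auto

lemma candidate_succeeds: "\<exists>D\<in>candidates. attempt G s t k c es D \<noteq> None"
proof -
  define M where "M = Max ((\<lambda>(i, e). c i e) ` ({1..k} \<times> arcs G))"
  have fin: "finite ({1..k} \<times> arcs G)" using series_parallel_simps(3)[OF sp] by simp
  have ne: "{1..k} \<times> arcs G \<noteq> {}" using k series_parallel_simps(8)[OF sp] by auto
  have "M \<in> (\<lambda>(i, e). c i e) ` ({1..k} \<times> arcs G)"
    unfolding M_def using fin ne by (intro Max_in) auto
  then obtain i e where ie: "i \<in> {1..k}" "e \<in> arcs G" "M = c i e" by auto
  have M: "c i e \<le> M" if "i \<in> {1..k}" "e \<in> arcs G" for i e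
    unfolding M_def using fin that by (intro Max_ge) auto
  \<comment> \<open>The largest exponent thus meets the requirement of
    \<open>attempt_large\<close>.\<close>
  have "2 * m \<le> 4 ^ m" for m :: nat
  proof (induction m)
    case (Suc m)
    have "2 * Suc m \<le> 4 * x" if "2 * m \<le> x" "1 \<le> x" for x :: nat using that by simp
    from this[OF Suc.IH] show ?case by simp
  qed simp
  then have "real (2 * length es) \<le> real (4 ^ length es)" by (rule of_nat_mono)
  then have pw: "2 * real (length es) \<le> 4 ^ length es" by simp
  have "2 * real (length es) * c i' e' \<le> 4 ^ length es * M" if "i' \<in> {1..k}" "e' \<in> arcs G" for i' e'
    using pw M[OF that] c_nonneg[OF that] by (intro mult_mono) auto
  moreover have "0 \<le> M" using c_nonneg[OF ie(1,2)] ie(3) by simp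
  ultimately have "attempt G s t k c es (4 ^ length es * M) \<noteq> None"
    by (intro attempt_large) auto
  moreover have "4 ^ length es * M \<in> candidates"
    unfolding candidates_def using ie length_es by fastforce
  ultimately show ?thesis by blast
qed

lemma good_candidate:
  assumes T: "decomposition_tree T G s t"
  shows "\<exists>D\<in>candidates. attempt G s t k c es D \<noteq> None \<and>
    D \<le> 4 * (real (tree_height T) + 2) * OPT G s t k c"
proof -
  obtain Q where Q: "pre_digraph.apath G s Q t" "robust_cost k c Q = OPT G s t k c"
    by (rule OPT_attained)
  have walk: "walk G s Q t" and vdist: "distinct (pre_digraph.awalk_verts G s Q)"
    using Q(1) by (auto simp: pre_digraph.apath_def pre_digraph.awalk_def)
  \<comment> \<open>The tails of the arcs of a simple path are distinct vertices, so no arc repeats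
    and \<open>Q\<close> has at most \<open>length es\<close> arcs.\<close>
  have dist: "distinct Q"
    using vdist unfolding pre_digraph.awalk_verts_conv by (auto simp: distinct_map split: if_splits)
  have ne: "Q \<noteq> []" using walk series_parallel_simps(7)[OF sp] by (auto simp: pre_digraph.cas.simps)
  have cost: "path_cost (c i) Q \<le> OPT G s t k c" if "i \<in> {1..k}" for i
    unfolding Q(2)[symmetric] robust_cost_def using that by (intro Max_ge) auto
  define X where "X = (real (tree_height T) + 2) * OPT G s t k c"
  define M where "M = Max ((\<lambda>(i, e). c i e) ` ({1..k} \<times> set Q))"
  have "M \<in> (\<lambda>(i, e). c i e) ` ({1..k} \<times> set Q)"
    unfolding M_def using k ne by (intro Max_in) auto
  then obtain i e where ie: "i \<in> {1..k}" "e \<in> set Q" "M = c i e" by auto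
  have nn: "0 \<le> c i e" if "i \<in> {1..k}" "e \<in> set Q" for i e
    using that walk c_nonneg by auto
  have M: "c i e \<le> M" if "i \<in> {1..k}" "e \<in> set Q" for i e
    unfolding M_def using that by (intro Max_ge) auto
  have "M \<le> path_cost (c i) Q"
    unfolding ie(3) path_cost_def using ie nn by (intro member_le_sum_list) auto
  then have MO: "M \<le> OPT G s t k c" using cost[OF ie(1)] by simp
  have M0: "0 \<le> M" using nn ie by simp
  have "length Q \<le> length es"
    using walk es card_mono[of "arcs G" "set Q"] distinct_card[OF dist] card_arcs
      series_parallel_simps(3)[OF sp] by simp
  have "path_cost (c i) Q \<le> real (length es) * M" if i: "i \<in> {1..k}" for i
  proof -
    have "path_cost (c i) Q \<le> real (length Q) * M"
      unfolding path_cost_def using M[OF i] sum_list_mono[of Q "c i" "\<lambda>_. M"]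
      by (simp add: sum_list_triv)
    also have "\<dots> \<le> real (length es) * M"
      using \<open>length Q \<le> length es\<close> M0 by (intro mult_right_mono) auto
    finally show ?thesis .
  qed
  then have OM: "OPT G s t k c \<le> real (length es) * M"
    unfolding Q(2)[symmetric] robust_cost_def using k by (subst Max_le_iff) auto
  \<comment> \<open>One factor comes from \<open>H + 2 \<le> m + 1\<close>, the other from
    \<open>OPT \<le> m * M\<close>; so \<open>X\<close> is at most the largest multiple of
    \<open>M\<close> that is tried.\<close>
  have "(m + 1) * m \<le> 4 ^ m" for m :: nat
  proof (induction m)
    case (Suc m)
    show ?case
    proof (cases m)
      case (Suc n)
      have "(Suc m + 1) * Suc m = (m + 1) * m + 2 * (m + 1)" by simp
      also have "\<dots> \<le> (m + 1) * m + 2 * ((m + 1) * m)" using Suc by simp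
      also have "\<dots> \<le> 4 * 4 ^ m" using Suc.IH by linarith
      finally show ?thesis by simp
    qed simp
  qed simp
  then have "real ((length es + 1) * length es) \<le> real (4 ^ length es)" by (rule of_nat_mono)
  then have pw: "(real (length es) + 1) * real (length es) \<le> 4 ^ length es"
    by (simp add: algebra_simps)
  have "real (tree_height T) + 2 \<le> real (length es) + 1"
    using Suc_tree_height_le_card(1)[OF T] card_arcs by simp
  then have "X \<le> (real (length es) + 1) * (real (length es) * M)"
    unfolding X_def using OM MO M0 by (intro mult_mono) auto
  also have "\<dots> \<le> 4 ^ length es * M" using mult_right_mono[OF pw M0] by (simp add: mult.assoc)
  finally have last: "1 \<le> length es \<and> X \<le> 4 ^ length es * M" using length_es by simp
  \<comment> \<open>The least exponent that reaches \<open>X\<close> overshoots by a factor of at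
    most 4: either the previous power is too small, or \<open>j = 1\<close> and
    \<open>M \<le> X\<close>.\<close>
  define j where "j = (LEAST j. 1 \<le> j \<and> X \<le> 4 ^ j * M)"
  have j: "1 \<le> j" "X \<le> 4 ^ j * M" and jle: "j \<le> length es"
    using LeastI[of "\<lambda>j. 1 \<le> j \<and> X \<le> 4 ^ j * M", OF last]
      Least_le[of "\<lambda>j. 1 \<le> j \<and> X \<le> 4 ^ j * M", OF last] by (auto simp: j_def)
  have "4 ^ j * M \<le> 4 * X"
  proof (cases "j = 1")
    case True
    have "1 * M \<le> (real (tree_height T) + 2) * OPT G s t k c"
      using MO M0 by (intro mult_mono) auto
    then show ?thesis using True by (simp add: X_def)
  next
    case False
    then have "1 \<le> j - 1" using j by simp
    moreover have "\<not> (1 \<le> j - 1 \<and> X \<le> 4 ^ (j - 1) * M)"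
      using j unfolding j_def by (intro not_less_Least) simp
    ultimately have "4 * (4 ^ (j - 1) * M) \<le> 4 * X" by simp
    then show ?thesis using j by (cases j) auto
  qed
  moreover have "4 ^ j * M \<in> candidates"
    unfolding candidates_def ie(3) using j(1) jle ie(1,2) walk by fastforce
  moreover have "attempt G s t k c es (4 ^ j * M) \<noteq> None"
  proof (rule attempt_opt[OF _ T walk])
    fix i assume "i \<in> {1..k}"
    then have "(real (tree_height T) + 2) * path_cost (c i) Q \<le> X"
      unfolding X_def using cost by (intro mult_left_mono) auto
    then show "(real (tree_height T) + 2) * path_cost (c i) Q \<le> 4 ^ j * M" using j by simp
  qed (use M0 in auto)
  moreover have "4 * X = 4 * (real (tree_height T) + 2) * OPT G s t k c" by (simp add: X_def)
  ultimately show ?thesis by (intro bexI[of _ "4 ^ j * M"]) auto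
qed

text \<open>The constant is \<open>12 * 2 * 2\<close>: from \<open>4 * (H + 2) \<le> 12 * H\<close>,
  from \<open>attempt_cost\<close>, and from \<open>ln (k + 1) \<le> 2 * ln k\<close>, which is
  where \<open>k \<ge> 2\<close> enters.\<close>

lemma attempt_ratio:
  assumes T: "decomposition_tree T G s t" "1 \<le> tree_height T" and k2: "2 \<le> k"
    and D: "0 \<le> D" "attempt G s t k c es D = Some p"
    and least: "\<And>D'. \<lbrakk>D' \<in> candidates; attempt G s t k c es D' \<noteq> None\<rbrakk> \<Longrightarrow> D \<le> D'"
  shows "robust_cost k c p \<le> 48 * (real (tree_height T) * ln (real k)) * OPT G s t k c"
proof -
  obtain D' where D': "D' \<in> candidates" "attempt G s t k c es D' \<noteq> None"
    "D' \<le> 4 * (real (tree_height T) + 2) * OPT G s t k c"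
    using good_candidate[OF T(1)] by blast
  have "0 \<le> 4 * (real (tree_height T) + 2) * OPT G s t k c"
    using D'(3) candidates_nonneg[OF D'(1)] by linarith
  then have O: "0 \<le> OPT G s t k c" by (simp add: zero_le_mult_iff)
  have "D \<le> 4 * (real (tree_height T) + 2) * OPT G s t k c" using least[OF D'(1,2)] D'(3) by simp
  also have "\<dots> \<le> 4 * (3 * real (tree_height T)) * OPT G s t k c"
    using T(2) O by (intro mult_right_mono) auto
  finally have DO: "D \<le> 12 * real (tree_height T) * OPT G s t k c" by simp
  have "real k + 1 \<le> real k * 2" using k2 by simp
  also have "\<dots> \<le> real k * real k" using k2 by (intro mult_left_mono) auto
  finally have "ln (real k + 1) \<le> ln (real k * real k)" using k2 by simp
  then have lnk: "ln (real k + 1) \<le> 2 * ln (real k)" using k2 by (simp add: ln_mult)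
  have "path_cost (c i) p \<le> 48 * (real (tree_height T) * ln (real k)) * OPT G s t k c"
    if i: "i \<in> {1..k}" for i
  proof -
    have "path_cost (c i) p \<le> 2 * D * ln (real k + 1)" using attempt_cost[OF D i] .
    also have "\<dots> \<le> 2 * (12 * real (tree_height T) * OPT G s t k c) * (2 * ln (real k))"
      using DO D(1) lnk by (intro mult_mono) auto
    finally show ?thesis by (simp add: algebra_simps)
  qed
  then show ?thesis unfolding robust_cost_def using k by (subst Max_le_iff) auto
qed

end

section \<open>A program logic for deterministic programs\<close>

primrec toss_free :: "com \<Rightarrow> bool" where
  "toss_free SKIP = True"
| "toss_free (Assign x a) = True"
| "toss_free (Toss x) = False"
| "toss_free (Seq c1 c2) = (toss_free c1 \<and> toss_free c2)"
| "toss_free (If b c1 c2) = (toss_free c1 \<and> toss_free c2)"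
| "toss_free (While b c) = toss_free c"

primrec det_step_com :: "com \<Rightarrow> store \<Rightarrow> config" where
  "det_step_com SKIP \<sigma> = (SKIP, \<sigma>)"
| "det_step_com (Assign x a) \<sigma> = (SKIP, \<sigma>(x := eval_oper a \<sigma>))"
| "det_step_com (Toss x) \<sigma> = (SKIP, \<sigma>)"
| "det_step_com (Seq c1 c2) \<sigma> =
     (if c1 = SKIP then (c2, \<sigma>)
      else (Seq (fst (det_step_com c1 \<sigma>)) c2, snd (det_step_com c1 \<sigma>)))"
| "det_step_com (If b c1 c2) \<sigma> = (if eval_test b \<sigma> then c1 else c2, \<sigma>)"
| "det_step_com (While b c) \<sigma> = (if eval_test b \<sigma> then Seq c (While b c) else SKIP, \<sigma>)"

definition det_step :: "config \<Rightarrow> config" where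
  "det_step cfg = det_step_com (fst cfg) (snd cfg)"

lemma toss_free_step_com:
  "toss_free c \<Longrightarrow> step_com c \<sigma> = return_pmf (det_step_com c \<sigma>) \<and> toss_free (fst (det_step_com c \<sigma>))"
  by (induction c) (auto simp: case_prod_beta)

definition init_store :: "val \<Rightarrow> store" where
  "init_store x = (\<lambda>_. Null)(0 := x)"

lemma run_toss_free:
  assumes "toss_free P"
  shows "run P x n = return_pmf ((det_step ^^ n) (P, init_store x)) \<and>
    toss_free (fst ((det_step ^^ n) (P, init_store x)))"
  using assms
  by (induction n) (auto simp: init_store_def step_def det_step_def bind_return_pmf toss_free_step_com)

definition stored_in :: "real set \<Rightarrow> store \<Rightarrow> bool" where
  "stored_in K \<sigma> \<longleftrightarrow> (\<forall>y. atoms_of (\<sigma> y) \<subseteq> K)"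

text \<open>\<open>n\<close> is the exact first halting time, which determines
  \<open>running_time\<close>. The last conjunct watches the store at every moment, as the
  bit-length condition speaks about the whole run.\<close>

definition runs :: "real set \<Rightarrow> com \<Rightarrow> store \<Rightarrow> nat \<Rightarrow> store \<Rightarrow> bool" where
  "runs K c \<sigma> n \<sigma>' \<longleftrightarrow> (det_step ^^ n) (c, \<sigma>) = (SKIP, \<sigma>') \<and>
     (\<forall>j<n. fst ((det_step ^^ j) (c, \<sigma>)) \<noteq> SKIP) \<and>
     (\<forall>j\<le>n. stored_in K (snd ((det_step ^^ j) (c, \<sigma>))))"

lemma runs_0: "runs K c \<sigma> 0 \<sigma>' \<longleftrightarrow> c = SKIP \<and> \<sigma>' = \<sigma> \<and> stored_in K \<sigma>"
  by (auto simp: runs_def)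

lemma runs_Suc:
  "runs K c \<sigma> (Suc n) \<sigma>' \<longleftrightarrow> c \<noteq> SKIP \<and> stored_in K \<sigma> \<and>
     runs K (fst (det_step_com c \<sigma>)) (snd (det_step_com c \<sigma>)) n \<sigma>'"
  by (auto simp: runs_def All_less_Suc2 funpow_Suc_right less_Suc_eq_le[symmetric]
      det_step_def simp del: funpow.simps)

text \<open>The additional step discards the \<open>SKIP\<close> left by \<open>c1\<close>.\<close>

lemma runs_Seq:
  assumes "runs K c1 \<sigma> n1 \<sigma>1" "runs K c2 \<sigma>1 n2 \<sigma>2"
  shows "runs K (Seq c1 c2) \<sigma> (n1 + 1 + n2) \<sigma>2"
  using assms(1)
proof (induction n1 arbitrary: c1 \<sigma>)
  case 0
  then show ?case using assms(2) by (simp add: runs_0 runs_Suc)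
next
  case (Suc n)
  then have c1: "c1 \<noteq> SKIP" "stored_in K \<sigma>"
    "runs K (fst (det_step_com c1 \<sigma>)) (snd (det_step_com c1 \<sigma>)) n \<sigma>1"
    by (simp_all add: runs_Suc)
  show ?case
    unfolding add_Suc runs_Suc using Suc.IH[OF c1(3)] c1(1,2) by simp
qed

lemma runs_stored: "runs K c \<sigma> n \<sigma>' \<Longrightarrow> stored_in K \<sigma>'"
  by (auto simp: runs_def)

lemma runs_final: "runs K c \<sigma> n \<sigma>' \<Longrightarrow> (det_step ^^ n) (c, \<sigma>) = (SKIP, \<sigma>')"
  by (simp add: runs_def)

lemma runs_stored_at:
  "runs K c \<sigma> n \<sigma>' \<Longrightarrow> j \<le> n \<Longrightarrow> stored_in K (snd ((det_step ^^ j) (c, \<sigma>)))"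
  by (simp add: runs_def)

text \<open>
  \<open>K\<close> is \<open>UNIV\<close> when only the running time matters, and the set of numbers of polynomial bit length in
  the case of a rational input.
\<close>

definition terminates :: "real set \<Rightarrow> com \<Rightarrow> store \<Rightarrow> nat \<Rightarrow> (store \<Rightarrow> bool) \<Rightarrow> bool" where
  "terminates K c \<sigma> N Q \<longleftrightarrow> (stored_in K \<sigma> \<longrightarrow> (\<exists>n\<le>N. \<exists>\<sigma>'. runs K c \<sigma> n \<sigma>' \<and> Q \<sigma>'))"

section \<open>Rules for termination within a time bound\<close>

lemma terminates_mono:
  assumes "terminates K c \<sigma> N Q" "N \<le> N'" "\<And>\<sigma>'. Q \<sigma>' \<Longrightarrow> Q' \<sigma>'"
  shows "terminates K c \<sigma> N' Q'"
  using assms unfolding terminates_def by (meson order_trans)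

lemma terminates_SKIP: "Q \<sigma> \<Longrightarrow> terminates K SKIP \<sigma> N Q"
  by (auto simp: terminates_def runs_0 intro: exI[of _ 0])

text \<open>Only operations that create a number carry an obligation; the others rearrange what is
  stored.\<close>

fun oper_in :: "real set \<Rightarrow> oper \<Rightarrow> store \<Rightarrow> bool" where
  "oper_in K Zero \<sigma> = (0 \<in> K)"
| "oper_in K One \<sigma> = (1 \<in> K)"
| "oper_in K (Add x y) \<sigma> = (num_of (\<sigma> x) + num_of (\<sigma> y) \<in> K)"
| "oper_in K (Sub x y) \<sigma> = (num_of (\<sigma> x) - num_of (\<sigma> y) \<in> K)"
| "oper_in K (Mult x y) \<sigma> = (num_of (\<sigma> x) * num_of (\<sigma> y) \<in> K)"
| "oper_in K (Divide x y) \<sigma> = (num_of (\<sigma> x) / num_of (\<sigma> y) \<in> K)"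
| "oper_in K _ \<sigma> = True"

lemma stored_in_update: "stored_in K \<sigma> \<Longrightarrow> atoms_of v \<subseteq> K \<Longrightarrow> stored_in K (\<sigma>(x := v))"
  by (auto simp: stored_in_def)

lemma atoms_of_fst_of: "atoms_of (fst_of v) \<subseteq> atoms_of v"
  and atoms_of_snd_of: "atoms_of (snd_of v) \<subseteq> atoms_of v"
  by (cases v; auto)+

lemma atoms_of_eval_oper:
  assumes "oper_in K a \<sigma>" "stored_in K \<sigma>"
  shows "atoms_of (eval_oper a \<sigma>) \<subseteq> K"
proof -
  have "atoms_of (\<sigma> x) \<subseteq> K" for x using assms(2) by (simp add: stored_in_def)
  then have "atoms_of (fst_of (\<sigma> x)) \<subseteq> K" "atoms_of (snd_of (\<sigma> x)) \<subseteq> K" "atoms_of (\<sigma> x) \<subseteq> K" for x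
    using atoms_of_fst_of atoms_of_snd_of order_trans by metis+
  then show ?thesis using assms(1) by (cases a) auto
qed

lemma terminates_Assign:
  assumes "oper_in K a \<sigma>" "Q (\<sigma>(x := eval_oper a \<sigma>))" "1 \<le> N"
  shows "terminates K (Assign x a) \<sigma> N Q"
  unfolding terminates_def
proof (intro impI exI conjI)
  assume "stored_in K \<sigma>"
  then show "runs K (Assign x a) \<sigma> (Suc 0) (\<sigma>(x := eval_oper a \<sigma>))"
    using atoms_of_eval_oper[OF assms(1)] by (simp add: runs_0 runs_Suc stored_in_update)
qed (use assms in auto)

text \<open>The postcondition of \<open>c1\<close> is the termination of \<open>c2\<close>, so a
  program can be executed symbolically without intermediate assertions.\<close>

lemma terminates_Seq:
  assumes "terminates K c1 \<sigma> N1 (\<lambda>\<sigma>'. terminates K c2 \<sigma>' N2 Q)" "N1 + 1 + N2 \<le> N"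
  shows "terminates K (Seq c1 c2) \<sigma> N Q"
  unfolding terminates_def
proof
  assume "stored_in K \<sigma>"
  then obtain n1 \<sigma>1 where 1: "n1 \<le> N1" "runs K c1 \<sigma> n1 \<sigma>1" "terminates K c2 \<sigma>1 N2 Q"
    using assms(1) unfolding terminates_def by blast
  then obtain n2 \<sigma>2 where 2: "n2 \<le> N2" "runs K c2 \<sigma>1 n2 \<sigma>2" "Q \<sigma>2"
    using runs_stored unfolding terminates_def by blast
  then show "\<exists>n\<le>N. \<exists>\<sigma>'. runs K (Seq c1 c2) \<sigma> n \<sigma>' \<and> Q \<sigma>'"
    using runs_Seq[OF 1(2) 2(2)] 1 assms(2) by (intro exI[of _ "n1 + 1 + n2"]) auto
qed

lemma terminates_If:
  assumes "terminates K (if eval_test b \<sigma> then c1 else c2) \<sigma> N' Q" "N' + 1 \<le> N"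
  shows "terminates K (If b c1 c2) \<sigma> N Q"
  unfolding terminates_def
proof
  assume s: "stored_in K \<sigma>"
  then obtain n \<sigma>' where 1: "n \<le> N'" "runs K (if eval_test b \<sigma> then c1 else c2) \<sigma> n \<sigma>'" "Q \<sigma>'"
    using assms(1) unfolding terminates_def by blast
  then have "runs K (If b c1 c2) \<sigma> (Suc n) \<sigma>'" using s by (simp add: runs_Suc)
  then show "\<exists>n\<le>N. \<exists>\<sigma>'. runs K (If b c1 c2) \<sigma> n \<sigma>' \<and> Q \<sigma>'"
    using 1 assms(2) by (intro exI[of _ "Suc n"]) auto
qed

lemma terminates_While:
  assumes "eval_test b \<sigma> \<Longrightarrow> terminates K (Seq c (While b c)) \<sigma> N' Q" "\<not> eval_test b \<sigma> \<Longrightarrow> Q \<sigma>" "N' + 1 \<le> N"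
  shows "terminates K (While b c) \<sigma> N Q"
  unfolding terminates_def
proof
  assume s: "stored_in K \<sigma>"
  show "\<exists>n\<le>N. \<exists>\<sigma>'. runs K (While b c) \<sigma> n \<sigma>' \<and> Q \<sigma>'"
  proof (cases "eval_test b \<sigma>")
    case True
    then obtain n \<sigma>' where 1: "n \<le> N'" "runs K (Seq c (While b c)) \<sigma> n \<sigma>'" "Q \<sigma>'"
      using assms(1) s unfolding terminates_def by blast
    then have "runs K (While b c) \<sigma> (Suc n) \<sigma>'" using s True by (simp add: runs_Suc)
    then show ?thesis using 1 assms(3) by (intro exI[of _ "Suc n"]) auto
  next
    case False
    then have "runs K (While b c) \<sigma> (Suc 0) \<sigma>" using s by (simp add: runs_0 runs_Suc)
    then show ?thesis using False assms(2,3) by (intro exI[of _ "Suc 0"]) auto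
  qed
qed

section \<open>Straight-line code, loops over lists and comparisons\<close>

primrec block :: "(var \<times> oper) list \<Rightarrow> com" where
  "block [] = SKIP"
| "block (xa # xas) = Seq (Assign (fst xa) (snd xa)) (block xas)"

primrec exec_block :: "(var \<times> oper) list \<Rightarrow> store \<Rightarrow> store" where
  "exec_block [] \<sigma> = \<sigma>"
| "exec_block (xa # xas) \<sigma> = exec_block xas (\<sigma>(fst xa := eval_oper (snd xa) \<sigma>))"

primrec block_in :: "real set \<Rightarrow> (var \<times> oper) list \<Rightarrow> store \<Rightarrow> bool" where
  "block_in K [] \<sigma> = True"
| "block_in K (xa # xas) \<sigma> =
     (oper_in K (snd xa) \<sigma> \<and> block_in K xas (\<sigma>(fst xa := eval_oper (snd xa) \<sigma>)))"

text \<open>Two steps per assignment: its execution and the removal of the \<open>SKIP\<close> it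
  leaves.\<close>

lemma terminates_block:
  assumes "block_in K xas \<sigma>" "Q (exec_block xas \<sigma>)" "2 * length xas \<le> N"
  shows "terminates K (block xas) \<sigma> N Q"
  using assms
proof (induction xas arbitrary: \<sigma> N)
  case (Cons xa xas)
  define \<sigma>' where "\<sigma>' = \<sigma>(fst xa := eval_oper (snd xa) \<sigma>)"
  have "block_in K xas \<sigma>'" "Q (exec_block xas \<sigma>')" "2 * length xas \<le> N - 2" "oper_in K (snd xa) \<sigma>"
    using Cons.prems by (simp_all add: \<sigma>'_def)
  note step = Cons.IH[OF this(1-3)] this(4)
  show ?case
    unfolding block.simps
  proof (rule terminates_Seq)
    show "terminates K (Assign (fst xa) (snd xa)) \<sigma> 1 (\<lambda>\<sigma>'. terminates K (block xas) \<sigma>' (N - 2) Q)"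
      by (rule terminates_Assign) (simp_all only: step(2) step(1)[unfolded \<sigma>'_def] order_refl)
  qed (use Cons.prems in auto)
qed (auto intro: terminates_SKIP)

lemma terminates_If_cases:
  assumes "eval_test b \<sigma> \<Longrightarrow> terminates K c1 \<sigma> (N - 1) Q" "\<not> eval_test b \<sigma> \<Longrightarrow> terminates K c2 \<sigma> (N - 1) Q"
    "1 \<le> N"
  shows "terminates K (If b c1 c2) \<sigma> N Q"
  using assms by (intro terminates_If[where N' = "N - 1"]) auto

lemma terminates_block_Seq:
  assumes "block_in K xas \<sigma>" "terminates K c (exec_block xas \<sigma>) (N - (2 * length xas + 1)) Q"
    "2 * length xas + 1 \<le> N"
  shows "terminates K (Seq (block xas) c) \<sigma> N Q"
  by (rule terminates_Seq, rule terminates_block, rule assms(1), rule assms(2), rule order_refl)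
    (use assms(3) in simp)

definition For :: "var \<Rightarrow> var \<Rightarrow> com \<Rightarrow> com" where
  "For h l c = While (IsPair l) (Seq (block [(h, First l), (l, Second l)]) c)"

text \<open>The invariant is indexed by the part of the list already consumed. Of the 7 extra steps
  per element, 1 is the test, 4 unpack the list and 2 remove a \<open>SKIP\<close>; the final 1 is
  the failing test.\<close>

lemma terminates_For:
  assumes l: "\<sigma> l = enc_list (map g xs)" "h \<noteq> l" and I: "I [] \<sigma>"
    and step: "\<And>ys z zs \<tau>. \<lbrakk>xs = ys @ z # zs; I ys \<tau>; \<tau> l = enc_list (map g (z # zs))\<rbrakk> \<Longrightarrow>
      terminates K c (\<tau>(h := g z, l := enc_list (map g zs))) B
        (\<lambda>\<tau>'. \<tau>' l = enc_list (map g zs) \<and> I (ys @ [z]) \<tau>')"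
    and N: "length xs * (B + 7) + 1 \<le> N"
    and Q: "\<And>\<tau>. I xs \<tau> \<Longrightarrow> Q \<tau>"
  shows "terminates K (For h l c) \<sigma> N Q"
proof -
  have "terminates K (For h l c) \<tau> (length zs * (B + 7) + 1) (I xs)"
    if "xs = ys @ zs" "I ys \<tau>" "\<tau> l = enc_list (map g zs)" for ys zs \<tau>
    using that
  proof (induction zs arbitrary: ys \<tau>)
    case Nil
    then show ?case
      unfolding For_def by (intro terminates_While[where N' = 0]) auto
  next
    case (Cons z zs)
    show ?case
      unfolding For_def
    proof (rule terminates_While, rule terminates_Seq, rule terminates_Seq, rule terminates_block)
      let ?\<tau> = "\<tau>(h := g z, l := enc_list (map g zs))"
      have "exec_block [(h, First l), (l, Second l)] \<tau> = ?\<tau>"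
        using Cons.prems l(2) by simp
      moreover have "terminates K c ?\<tau> B (\<lambda>\<sigma>'. terminates K
          (While (IsPair l) (Seq (block [(h, First l), (l, Second l)]) c)) \<sigma>' (length zs * (B + 7) + 1) (I xs))"
      proof (rule terminates_mono[OF step[OF Cons.prems] order_refl])
        fix \<tau>' assume "\<tau>' l = enc_list (map g zs) \<and> I (ys @ [z]) \<tau>'"
        then show "terminates K (While (IsPair l) (Seq (block [(h, First l), (l, Second l)]) c)) \<tau>'
            (length zs * (B + 7) + 1) (I xs)"
          using Cons.IH[of "ys @ [z]" \<tau>'] Cons.prems(1) by (simp add: For_def)
      qed
      ultimately show "terminates K c (exec_block [(h, First l), (l, Second l)] \<tau>) B (\<lambda>\<sigma>'. terminates K
          (While (IsPair l) (Seq (block [(h, First l), (l, Second l)]) c)) \<sigma>' (length zs * (B + 7) + 1) (I xs))"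
        by simp
    qed (use Cons.prems in auto)
  qed
  from this[OF _ I l(1)] have "terminates K (For h l c) \<sigma> (length xs * (B + 7) + 1) (I xs)" by simp
  then show ?thesis using N Q by (rule terminates_mono)
qed

text \<open>The language compares numbers by \<open>Less\<close> only, so equality is the failure of
  both strict comparisons.\<close>

definition If_eq :: "var \<Rightarrow> var \<Rightarrow> com \<Rightarrow> com" where
  "If_eq x y c = If (Less x y) SKIP (If (Less y x) SKIP c)"

lemma terminates_If_eq:
  assumes "num_of (\<sigma> x) = num_of (\<sigma> y) \<Longrightarrow> terminates K c \<sigma> N' Q"
    "num_of (\<sigma> x) \<noteq> num_of (\<sigma> y) \<Longrightarrow> Q \<sigma>" "N' + 2 \<le> N"
  shows "terminates K (If_eq x y c) \<sigma> N Q"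
  unfolding If_eq_def
proof (rule terminates_If)
  show "terminates K (if eval_test (Less x y) \<sigma> then SKIP else If (Less y x) SKIP c) \<sigma> (N' + 1) Q"
    using assms by (auto intro!: terminates_SKIP terminates_If[where N' = N'])
qed (use assms in auto)

definition frame :: "nat \<Rightarrow> var set \<Rightarrow> store \<Rightarrow> store \<Rightarrow> bool" where
  "frame n X \<sigma> \<sigma>' \<longleftrightarrow> (\<forall>y<n. y \<notin> X \<longrightarrow> \<sigma>' y = \<sigma> y)"

lemma frameD: "frame n X \<sigma> \<sigma>' \<Longrightarrow> y < n \<Longrightarrow> y \<notin> X \<Longrightarrow> \<sigma>' y = \<sigma> y"
  by (simp add: frame_def)

text \<open>Two derivations are asked for: one with \<open>UNIV\<close> for the time, and one with a
  set \<open>K\<close> that depends on the input for the bit lengths. Halted configurations do not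
  change, so the second bound holds for all later \<open>n\<close> as well.\<close>

lemma terminates_polynomial_time:
  assumes P: "toss_free P"
    and terminates: "\<And>x. x \<in> X \<Longrightarrow> terminates UNIV P (init_store x) (poly q (cells x)) (\<lambda>_. True)"
    and bits: "\<And>x. \<lbrakk>x \<in> X; atoms_of x \<subseteq> \<rat>\<rbrakk> \<Longrightarrow>
      \<exists>K. atoms_of x \<subseteq> K \<and> terminates K P (init_store x) (poly q (cells x)) (\<lambda>_. True) \<and>
        (\<forall>r\<in>K. num_bits r \<le> poly q' (bit_size x))"
  shows "polynomial_time P X"
proof -
  have halt: "(det_step ^^ j) (c, \<sigma>) = (SKIP, \<sigma>')"
    if "(det_step ^^ n) (c, \<sigma>) = (SKIP, \<sigma>')" "n \<le> j" for c \<sigma> n \<sigma>' j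
  proof -
    have "(det_step ^^ i) (SKIP, \<sigma>') = (SKIP, \<sigma>')" for i
      by (induction i) (auto simp: det_step_def)
    moreover have "(det_step ^^ j) (c, \<sigma>) = (det_step ^^ (j - n)) ((det_step ^^ n) (c, \<sigma>))"
      using funpow_add[of "j - n" n det_step] that(2) by simp
    ultimately show ?thesis using that(1) by simp
  qed
  have stored: "stored_in K (init_store x)" if "atoms_of x \<subseteq> K" for K x
    using that by (auto simp: stored_in_def init_store_def)
  have nn: "poly q n \<le> poly (q + q') n" "poly q' n \<le> poly (q + q') n" for n :: nat by simp_all
  show ?thesis
    unfolding polynomial_time_def
  proof (intro exI[of _ "q + q'"] ballI conjI impI allI)
    fix x assume x: "x \<in> X"
    obtain n \<sigma>' where n: "n \<le> poly q (cells x)" "runs UNIV P (init_store x) n \<sigma>'"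
      using terminates[OF x] stored[of x UNIV] unfolding terminates_def by blast
    have "(det_step ^^ poly (q + q') (cells x)) (P, init_store x) = (SKIP, \<sigma>')"
      by (rule halt[OF runs_final[OF n(2)] order_trans[OF n(1) nn(1)]])
    then show "halts_within P x (poly (q + q') (cells x))"
      using run_toss_free[OF P] by (simp add: halts_within_def halted_def)
  next
    fix x n assume x: "x \<in> X" "atoms_of x \<subseteq> \<rat>"
    obtain K where K: "atoms_of x \<subseteq> K" "terminates K P (init_store x) (poly q (cells x)) (\<lambda>_. True)"
      "\<forall>r\<in>K. num_bits r \<le> poly q' (bit_size x)" using bits[OF x] by blast
    obtain m \<sigma>' where m: "runs K P (init_store x) m \<sigma>'"
      using K(2) stored[OF K(1)] unfolding terminates_def by blast
    have "stored_in K (snd ((det_step ^^ n) (P, init_store x)))"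
    proof (cases "n \<le> m")
      case True
      then show ?thesis by (rule runs_stored_at[OF m])
    next
      case False
      then show ?thesis using halt[OF runs_final[OF m], of n] runs_stored[OF m] by simp
    qed
    then have "atoms_of (snd ((det_step ^^ n) (P, init_store x)) y) \<subseteq> K" for y
      by (simp add: stored_in_def)
    then have "num_bits r \<le> poly (q + q') (bit_size x)"
      if "r \<in> atoms_of (snd ((det_step ^^ n) (P, init_store x)) y)" for y r
    proof -
      have "r \<in> K" using \<open>\<And>y. atoms_of (snd ((det_step ^^ n) (P, init_store x)) y) \<subseteq> K\<close> that by blast
      then have "num_bits r \<le> poly q' (bit_size x)" using K(3) by simp
      then show ?thesis using nn(2)[of "bit_size x"] by linarith
    qed
    then show "case cfg of (c, \<sigma>) \<Rightarrow> \<forall>y. \<forall>r\<in>atoms_of (\<sigma> y). num_bits r \<le> poly (q + q') (bit_size x)"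
      if "cfg \<in> set_pmf (run P x n)" for cfg
      using that run_toss_free[OF P, of x n] by (auto simp: case_prod_beta)
  qed
qed

text \<open>\<open>runs\<close> excludes earlier halting, so \<open>running_time\<close> is exactly
  its step count, and the output distribution is a point mass.\<close>

lemma output_dist_terminates:
  assumes P: "toss_free P" and halts: "terminates UNIV P (init_store x) N Q"
  shows "\<exists>\<sigma>'. Q \<sigma>' \<and> output_dist P x = return_pmf (\<sigma>' 0)"
proof -
  have "stored_in UNIV (init_store x)" by (simp add: stored_in_def)
  then obtain n \<sigma>' where n: "runs UNIV P (init_store x) n \<sigma>'" "Q \<sigma>'"
    using halts unfolding terminates_def by blast
  have "halts_within P x m \<longleftrightarrow> fst ((det_step ^^ m) (P, init_store x)) = SKIP" for m
    using run_toss_free[OF P] by (simp add: halts_within_def halted_def)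
  then have "running_time P x = n"
    unfolding running_time_def using n(1) by (intro Least_equality) (auto simp: runs_def not_less[symmetric])
  then have "output_dist P x = return_pmf (\<sigma>' 0)"
    using runs_final[OF n(1)] run_toss_free[OF P, of x n] by (simp add: output_dist_def)
  then show ?thesis using n(2) by blast
qed

section \<open>The program for one threshold\<close>

lemma frame_refl [simp]: "frame n X \<sigma> \<sigma>"
  by (simp add: frame_def)

lemma frame_update [simp]: "frame n X \<sigma> \<tau> \<Longrightarrow> n \<le> y \<or> y \<in> X \<Longrightarrow> frame n X \<sigma> (\<tau>(y := v))"
  by (auto simp: frame_def)

lemma frame_trans:
  "frame n X \<sigma> \<tau> \<Longrightarrow> frame n' X' \<tau> \<tau>' \<Longrightarrow> n \<le> n' \<Longrightarrow> (\<And>y. y \<in> X' \<Longrightarrow> n \<le> y \<or> y \<in> X) \<Longrightarrow>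
    frame n X \<sigma> \<tau>'"
  unfolding frame_def by (metis leD order_less_le_trans)

definition enc_option :: "('a \<Rightarrow> val) \<Rightarrow> 'a option \<Rightarrow> val" where
  "enc_option g r = (case r of None \<Rightarrow> Null | Some a \<Rightarrow> g a)"

lemma enc_option_simps [simp]: "enc_option g None = Null" "enc_option g (Some a) = g a"
  by (simp_all add: enc_option_def)

abbreviation (input) "vS \<equiv> 1 :: var"
abbreviation (input) "vT \<equiv> 2 :: var"
abbreviation (input) "vVerts \<equiv> 3 :: var"
abbreviation (input) "vArcs \<equiv> 4 :: var"
abbreviation (input) "vOne \<equiv> 5 :: var"
abbreviation (input) "vZero \<equiv> 6 :: var"
abbreviation (input) "vBest \<equiv> 7 :: var"
abbreviation (input) "vInit \<equiv> 14 :: var"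
abbreviation (input) "vD \<equiv> 17 :: var"
abbreviation (input) "vLab \<equiv> 20 :: var"
abbreviation (input) "vNew \<equiv> 23 :: var"
abbreviation (input) "vVert \<equiv> 25 :: var"
abbreviation (input) "vCur \<equiv> 26 :: var"
abbreviation (input) "vArc \<equiv> 28 :: var"
abbreviation (input) "vTail \<equiv> 29 :: var"
abbreviation (input) "vKey \<equiv> 30 :: var"
abbreviation (input) "vCosts \<equiv> 31 :: var"
abbreviation (input) "vFound \<equiv> 33 :: var"

text \<open>
  Inner commands use larger variables, so that a command leaves all variables below some bound
  unchanged, except for its results.
\<close>

definition Lookup :: com where
  "Lookup = Seq (block [(vFound, MkNull), (34, Copy vLab)])
     (For 35 34 (Seq (block [(36, First 35)]) (If_eq 36 vKey (Assign vFound (Second 35)))))"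

text \<open>
  In \<open>Extend\<close>, 38 runs through the factors of the label and 39 collects, in reverse order, those of the
  extended path; 40 remains an atom as long as the arc is cheap.  Then 46 and 47 become the factors in the
  right order and their potential minus \<open>2 k\<close>.
\<close>

definition Multiply :: com where
  "Multiply = Seq (block [(43, First 38), (38, Second 38), (42, Divide 41 vD), (42, Mult 43 42),
     (42, Add 42 43), (39, MkPair 42 39)]) (If (Less vD 41) (Assign 40 MkNull) SKIP)"

definition Collect :: com where
  "Collect = block [(46, MkPair 45 46), (47, Add 47 45), (47, Sub 47 vOne), (47, Sub 47 vOne)]"

definition Replace :: com where
  "Replace = Seq (block [(49, First vArc), (48, MkPair 49 48), (49, MkPair 46 48), (49, MkPair 47 49)])
    (If (IsAtom 40)
      (If (IsPair vCur) (Seq (block [(48, First vCur)]) (If (Less 47 48) (Assign vCur (Copy 49)) SKIP))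
        (Assign vCur (Copy 49))) SKIP)"

definition Extend :: com where
  "Extend = Seq (block [(49, Second vFound), (38, First 49), (48, Second 49), (39, MkNull),
       (40, Copy vOne), (37, Copy vCosts)])
    (Seq (For 41 37 Multiply)
    (Seq (block [(44, Copy 39), (46, MkNull), (47, Zero)])
    (Seq (For 45 44 Collect) Replace)))"

definition Relax :: com where
  "Relax = Seq (block [(vCur, MkNull), (27, Copy vArcs)])
    (For vArc 27 (Seq (block [(32, Second vArc), (vTail, First 32), (32, Second 32), (vKey, First 32),
        (32, Second 32), (vCosts, First 32)])
      (If_eq vTail vVert (Seq Lookup (If (IsPair vFound) Extend SKIP)))))"

definition Round :: com where
  "Round = Seq (block [(32, MkNull), (vNew, MkPair vT vInit), (vNew, MkPair vNew 32), (24, Copy vVerts)])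
    (Seq (For vVert 24 (Seq Relax
      (If (IsPair vCur) (block [(32, MkPair vVert vCur), (vNew, MkPair 32 vNew)]) SKIP)))
    (Assign vLab (Copy vNew)))"

definition Record :: com where
  "Record = If (IsPair vFound)
    (Seq (block [(32, First vFound)])
      (If (Less vZero 32) SKIP
        (Seq (block [(32, Second vFound), (32, Second 32), (32, MkPair vD 32)])
          (If (IsPair vBest)
            (Seq (block [(33, First vBest)]) (If (Less vD 33) (Assign vBest (Copy 32)) SKIP))
            (Assign vBest (Copy 32)))))) SKIP"

definition Attempt :: com where
  "Attempt = Seq (block [(32, MkNull), (vLab, MkPair vT vInit), (vLab, MkPair vLab 32), (21, Copy vArcs)])
    (Seq (For 22 21 Round) (Seq (block [(vKey, Copy vS)]) (Seq Lookup Record)))"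

text \<open>\<open>numbers\<close> and \<open>sums\<close> list the values formed by
  \<open>Multiply\<close> and \<open>Collect\<close>; they are trivial for \<open>UNIV\<close> and
  follow from size bounds for rational inputs. \<open>length vs < N\<close> leaves room for the
  entry of \<open>t\<close> that every table contains besides those added by the vertex
  loop.\<close>

locale attempt_run = robust_instance G s t k c es
  for G :: "(nat, nat) pre_digraph" and s t k c es +
  fixes vs :: "nat list" and K :: "real set" and D :: real and N :: nat
  assumes vs: "distinct vs" "set vs = verts G"
    and sizes: "length es \<le> N" "length vs < N" "k \<le> N"
    and zero_in: "0 \<in> K"
    and numbers: "\<And>p e i. \<lbrakk>set p \<subseteq> set es; length p \<le> length es; e \<in> set es; i \<in> {1..k}\<rbrakk> \<Longrightarrow>
        scaled c D i e \<in> K \<and> factor_prod (scaled c D) i p * scaled c D i e \<in> K \<and>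
        factor_prod (scaled c D) i (e # p) \<in> K"
    and sums: "\<And>p ys z zs x. \<lbrakk>set p \<subseteq> set es; length p \<le> Suc (length es); rev [1..<Suc k] = ys @ z # zs;
        x \<in> {0, 1, 2}\<rbrakk> \<Longrightarrow>
        (\<Sum>j\<leftarrow>ys. factor_prod (scaled c D) j p - 2) + factor_prod (scaled c D) z p - x \<in> K"
begin

abbreviation "M i p \<equiv> factor_prod (scaled c D) i p"

text \<open>Subtracting 2 for each agent turns the test against \<open>2 * k\<close> into a sign
  test and does not affect comparisons. The order of summation is that of \<open>Collect\<close>, so
  its partial sums are those in \<open>sums\<close>.\<close>

definition excess :: "nat list \<Rightarrow> real" where
  "excess p = (\<Sum>i\<leftarrow>rev [1..<Suc k]. M i p - 2)"

lemma excess_eq: "excess p = potential k (scaled c D) p - 2 * real k"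
proof -
  have "excess p = (\<Sum>i\<leftarrow>[1..<Suc k]. M i p - 2)"
    unfolding excess_def by (simp only: rev_map[symmetric] sum_list_rev)
  also have "\<dots> = (\<Sum>i=1..k. M i p - 2)"
    by (simp only: sum_list_distinct_conv_sum_set[OF distinct_upt] set_upt atLeastLessThanSuc_atLeastAtMost)
  finally show ?thesis by (simp add: potential_def sum_subtractf)
qed

text \<open>Potential and factors are stored with the path, so extending a label takes passes over
  the agents but none over the path.\<close>

definition enc_label :: "nat list \<Rightarrow> val" where
  "enc_label p = Pair (Atom (excess p)) (Pair (enc_list (map (\<lambda>i. Atom (M i p)) [1..<Suc k])) (enc_path p))"

definition enc_entry :: "nat \<times> nat list \<Rightarrow> val" where
  "enc_entry bp = Pair (enc_nat (fst bp)) (enc_label (snd bp))"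

text \<open>\<open>Lookup\<close> scans the whole table and overwrites its result at each match, so
  the last entry wins; hence \<open>map_of (rev L)\<close>.\<close>

lemma Lookup_terminates:
  assumes "\<sigma> vLab = enc_list (map enc_entry L)" "\<sigma> vKey = enc_nat v" "length L \<le> N"
  shows "terminates K Lookup \<sigma> (14 * N + 6)
    (\<lambda>\<sigma>'. \<sigma>' vFound = enc_option enc_label (map_of (rev L) v) \<and> frame 33 {} \<sigma> \<sigma>')"
  unfolding Lookup_def
proof (rule terminates_Seq[where ?N1.0 = 4 and ?N2.0 = "14 * N + 1"], rule terminates_block)
  let ?\<sigma> = "exec_block [(vFound, MkNull), (34, Copy vLab)] \<sigma>"
  show "terminates K (For 35 34 (Seq (block [(36, First 35)]) (If_eq 36 vKey (Assign vFound (Second 35)))))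
    ?\<sigma> (14 * N + 1) (\<lambda>\<sigma>'. \<sigma>' vFound = enc_option enc_label (map_of (rev L) v) \<and> frame 33 {} \<sigma> \<sigma>')"
  proof (rule terminates_For[where g = enc_entry and xs = L and B = 7 and
        I = "\<lambda>ys \<tau>. \<tau> vFound = enc_option enc_label (map_of (rev ys) v) \<and> frame 33 {} \<sigma> \<tau>"])
    fix ys z zs \<tau>
    assume I: "\<tau> vFound = enc_option enc_label (map_of (rev ys) v) \<and> frame 33 {} \<sigma> \<tau>"
    have key: "\<tau> vKey = enc_nat v" using frameD[of 33 "{}" \<sigma> \<tau> 30] I assms(2) by simp
    show "terminates K (Seq (block [(36, First 35)]) (If_eq 36 vKey (Assign vFound (Second 35))))
      (\<tau>(35 := enc_entry z, 34 := enc_list (map enc_entry zs))) 7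
      (\<lambda>\<tau>'. \<tau>' 34 = enc_list (map enc_entry zs) \<and>
        \<tau>' vFound = enc_option enc_label (map_of (rev (ys @ [z])) v) \<and> frame 33 {} \<sigma> \<tau>')"
    proof (rule terminates_Seq[where ?N1.0 = 2 and ?N2.0 = 3], rule terminates_block)
    qed (use I key in \<open>auto intro!: terminates_If_eq[where N' = 1] terminates_Assign
        simp: enc_entry_def enc_nat_def prod_eq_iff split: prod.splits\<close>)
  qed (use assms sizes in auto)
qed auto

lemma Replace_terminates:
  assumes \<sigma>: "fst_of (\<sigma> vArc) = enc_nat e" "\<sigma> vCur = enc_option enc_label cur" "\<sigma> 48 = enc_path p"
      "\<sigma> 40 = (if cheap k c D e then Atom 1 else Null)" "\<sigma> 47 = Atom (excess (e # p))"
      "\<sigma> 46 = enc_list (map (\<lambda>i. Atom (M i (e # p))) [1..<Suc k])"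
    and fr: "frame 37 {vCur} \<sigma>0 \<sigma>"
  shows "terminates K Replace \<sigma> 17 (\<lambda>\<sigma>'. frame 37 {vCur} \<sigma>0 \<sigma>' \<and>
    \<sigma>' vCur = enc_option enc_label
      (if cheap k c D e then better k (scaled c D) cur (e # p) else cur))"
proof -
  let ?asgs = "[(49, First vArc), (48, MkPair 49 48), (49, MkPair 46 48), (49, MkPair 47 49)]"
  define \<rho> where "\<rho> = exec_block ?asgs \<sigma>"
  have "Pair (enc_nat e) (\<sigma> 48) = enc_path (e # p)" using \<sigma>(3) by (simp add: enc_path_def)
  then have "Pair (\<sigma> 47) (Pair (\<sigma> 46) (Pair (enc_nat e) (\<sigma> 48))) = enc_label (e # p)"
    by (simp only: \<sigma>(5,6) enc_label_def)
  then have \<rho>: "\<rho> 49 = enc_label (e # p)" "\<rho> 47 = Atom (excess (e # p))"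
    "\<rho> 40 = (if cheap k c D e then Atom 1 else Null)" "\<rho> vCur = enc_option enc_label cur"
    "frame 37 {vCur} \<sigma>0 \<rho>"
    using \<sigma>(1,2,4,5) fr by (simp_all add: \<rho>_def)
  show ?thesis
    unfolding Replace_def
  proof (rule terminates_block_Seq)
    show "terminates K (If (IsAtom 40)
        (If (IsPair vCur) (Seq (block [(48, First vCur)]) (If (Less 47 48) (Assign vCur (Copy 49)) SKIP))
          (Assign vCur (Copy 49))) SKIP) (exec_block ?asgs \<sigma>) (17 - (2 * length ?asgs + 1))
      (\<lambda>\<sigma>'. frame 37 {vCur} \<sigma>0 \<sigma>' \<and> \<sigma>' vCur = enc_option enc_label
        (if cheap k c D e then better k (scaled c D) cur (e # p) else cur))"
      unfolding \<rho>_def[symmetric] using \<rho>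
      by (cases cur)
        (auto intro!: terminates_If_cases terminates_block_Seq terminates_Assign terminates_SKIP
          simp: better_def excess_eq enc_label_def simp del: block.simps upt_Suc split: if_splits)
  qed simp_all
qed

lemma Extend_terminates:
  assumes \<sigma>: "\<sigma> vFound = enc_label p" "\<sigma> vCosts = enc_list (map (\<lambda>i. Atom (c i e)) [1..<Suc k])"
      "fst_of (\<sigma> vArc) = enc_nat e" "\<sigma> vD = Atom D" "\<sigma> vOne = Atom 1"
      "\<sigma> vCur = enc_option enc_label cur"
    and p: "set p \<subseteq> set es" "length p \<le> length es" "e \<in> set es"
  shows "terminates K Extend \<sigma> (37 * N + 41) (\<lambda>\<sigma>'. frame 37 {vCur} \<sigma> \<sigma>' \<and>
    \<sigma>' vCur = enc_option enc_label
      (if cheap k c D e then better k (scaled c D) cur (e # p) else cur))"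
  unfolding Extend_def
proof (rule terminates_block_Seq)
  define xs where "xs = [1..<Suc k]"
  define C where "C = (\<lambda>i. Atom (c i e))"
  define A where "A = (\<lambda>i. Atom (M i p))"
  define B where "B = (\<lambda>i. Atom (M i (e # p)))"
  have \<sigma>_costs: "\<sigma> vCosts = enc_list (map C xs)" by (simp only: \<sigma>(2) C_def xs_def)
  have \<sigma>_found: "\<sigma> vFound = Pair (Atom (excess p)) (Pair (enc_list (map A xs)) (enc_path p))"
    by (simp only: \<sigma>(1) enc_label_def A_def xs_def)
  let ?asgs = "[(49, Second vFound), (38, First 49), (48, Second 49), (39, MkNull),
      (40, Copy vOne), (37, Copy vCosts)]"
  let ?\<sigma> = "exec_block ?asgs \<sigma>"
  let ?rest = "Seq (block [(44, Copy 39), (46, MkNull), (47, Zero)]) (Seq (For 45 44 Collect) Replace)"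
  let ?Q = "\<lambda>\<sigma>'. frame 37 {vCur} \<sigma> \<sigma>' \<and> \<sigma>' vCur = enc_option enc_label
      (if cheap k c D e then better k (scaled c D) cur (e # p) else cur)"
  let ?ok = "\<lambda>ys. if \<forall>i\<in>set ys. c i e \<le> D then Atom 1 else Null"
  let ?I = "\<lambda>ys \<tau>. \<tau> 38 = enc_list (map A (drop (length ys) xs)) \<and> \<tau> 39 = enc_list (map B (rev ys)) \<and>
      \<tau> 40 = ?ok ys \<and> \<tau> 48 = enc_path p \<and> frame 37 {vCur} \<sigma> \<tau> \<and> \<tau> vCur = \<sigma> vCur"
  have len: "length xs \<le> N" using sizes by (simp add: xs_def)
  \<comment> \<open>\<open>Multiply\<close> evaluates the right-hand side, so the product
    \<open>M i p * scaled c D i e\<close> occurs as an intermediate number.\<close>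
  have MB: "M i (e # p) = M i p * scaled c D i e + M i p" for i by (simp add: algebra_simps)
  show "terminates K (Seq (For 41 37 Multiply) ?rest) ?\<sigma> (37 * N + 41 - (2 * length ?asgs + 1)) ?Q"
  proof (rule terminates_Seq[where ?N1.0 = "22 * N + 1" and ?N2.0 = "15 * N + 26"])
    show "terminates K (For 41 37 Multiply) ?\<sigma> (22 * N + 1) (\<lambda>\<tau>. terminates K ?rest \<tau> (15 * N + 26) ?Q)"
    proof (rule terminates_For[where g = C and xs = xs and I = ?I and B = 15])
      show "?\<sigma> 37 = enc_list (map C xs)" using \<sigma>_costs by simp
      show "?I [] ?\<sigma>" using \<sigma>_found \<sigma>(5) by simp
      show "length xs * (15 + 7) + 1 \<le> 22 * N + 1" using len by simp
    next
      fix ys z zs \<tau> assume xs: "xs = ys @ z # zs" and I: "?I ys \<tau>"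
      have "z \<in> set xs" by (simp add: xs)
      then have z: "z \<in> {1..k}" unfolding xs_def set_upt by auto
      have fr: "\<tau> vD = Atom D" using frameD[of 37 "{vCur}" \<sigma> \<tau> vD] I \<sigma> by simp
      have num: "scaled c D z e \<in> K" "M z p * scaled c D z e \<in> K" "M z (e # p) \<in> K"
        using numbers[OF p z] by auto
      let ?\<tau> = "\<tau>(41 := C z, 37 := enc_list (map C zs))"
      show "terminates K Multiply ?\<tau> 15 (\<lambda>\<tau>'. \<tau>' 37 = enc_list (map C zs) \<and> ?I (ys @ [z]) \<tau>')"
        unfolding Multiply_def
      proof (rule terminates_block_Seq)
        let ?mult = "[(43, First 38), (38, Second 38), (42, Divide 41 vD), (42, Mult 43 42),
            (42, Add 42 43), (39, MkPair 42 39)]"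
        show "block_in K ?mult ?\<tau>"
          using I fr num xs by (simp add: C_def A_def scaled_def[symmetric] MB[symmetric])
        show "terminates K (If (Less vD 41) (Assign 40 MkNull) SKIP) (exec_block ?mult ?\<tau>)
            (15 - (2 * length ?mult + 1)) (\<lambda>\<tau>'. \<tau>' 37 = enc_list (map C zs) \<and> ?I (ys @ [z]) \<tau>')"
          using I fr xs
          by (auto intro!: terminates_If_cases terminates_Assign terminates_SKIP
              simp: C_def A_def B_def scaled_def[symmetric] MB simp del: factor_prod_simps(2))
      qed simp
    next
      fix \<tau> assume I: "?I xs \<tau>"
      let ?J = "\<lambda>ys \<tau>'. \<tau>' 46 = enc_list (map B (rev ys)) \<and> \<tau>' 47 = Atom (\<Sum>i\<leftarrow>ys. M i (e # p) - 2) \<and>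
        \<tau>' 40 = ?ok xs \<and> \<tau>' 48 = enc_path p \<and> frame 37 {vCur} \<sigma> \<tau>' \<and> \<tau>' vCur = \<sigma> vCur"
      let ?start = "[(44, Copy 39), (46, MkNull), (47, Zero)]"
      show "terminates K ?rest \<tau> (15 * N + 26) ?Q"
      proof (rule terminates_block_Seq)
        show "terminates K (Seq (For 45 44 Collect) Replace) (exec_block ?start \<tau>)
          (15 * N + 26 - (2 * length ?start + 1)) ?Q"
        proof (rule terminates_Seq[where ?N1.0 = "15 * N + 1" and ?N2.0 = 17])
          show "terminates K (For 45 44 Collect) (exec_block ?start \<tau>) (15 * N + 1)
            (\<lambda>\<tau>'. terminates K Replace \<tau>' 17 ?Q)"
          proof (rule terminates_For[where g = B and xs = "rev xs" and I = ?J and B = 8])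
            show "exec_block ?start \<tau> 44 = enc_list (map B (rev xs))" using I by simp
            show "?J [] (exec_block ?start \<tau>)" using I by simp
            show "length (rev xs) * (8 + 7) + 1 \<le> 15 * N + 1" using len by simp
          next
            fix ys z zs \<tau>' assume xs: "rev xs = ys @ z # zs" and J: "?J ys \<tau>'"
            have one: "\<tau>' vOne = Atom 1" using frameD[of 37 "{vCur}" \<sigma> \<tau>' vOne] J \<sigma> by simp
            have "set (e # p) \<subseteq> set es" "length (e # p) \<le> Suc (length es)" using p by auto
            \<comment> \<open>For \<open>x = 0, 1, 2\<close> these are the running sums after the
              addition and after each of the two subtractions of 1.\<close>
            note sm = sums[OF this xs[unfolded xs_def]]
            show "terminates K Collect (\<tau>'(45 := B z, 44 := enc_list (map B zs))) 8
              (\<lambda>\<tau>''. \<tau>'' 44 = enc_list (map B zs) \<and> ?J (ys @ [z]) \<tau>'')"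
              unfolding Collect_def
              using J one sm[of 0] sm[of 1] sm[of 2] by (intro terminates_block) (simp_all add: B_def)
          next
            fix \<tau>' assume J: "?J (rev xs) \<tau>'"
            have "(\<forall>i\<in>set xs. c i e \<le> D) \<longleftrightarrow> cheap k c D e" by (auto simp: xs_def cheap_def)
            then show "terminates K Replace \<tau>' 17 ?Q"
              using J \<sigma>(3,6) frameD[of 37 "{vCur}" \<sigma> \<tau>' vArc]
              by (intro Replace_terminates) (simp_all add: excess_def xs_def B_def del: upt_Suc)
          qed simp
        qed simp
      qed (use zero_in in simp_all)
    qed simp
  qed simp
qed simp_all

end

text \<open>Needed in every round and not only at the fixpoint: it limits the factors that
  intermediate labels can have, so that they are covered by \<open>numbers\<close> and
  \<open>sums\<close>.\<close>

lemma labels_bound: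
  "labels G t k f ok es n a = Some p \<Longrightarrow> set p \<subseteq> set es \<and> length p \<le> n"
proof (induction n arbitrary: a p)
  case 0
  then show ?case by (auto simp: labels_def split: if_splits)
next
  case (Suc n)
  have eq: "labels G t k f ok es (Suc n) a = relax_round G t k f ok es (labels G t k f ok es n) a"
    by (simp add: labels_def)
  show ?case
  proof (cases "a = t")
    case True
    then show ?thesis using Suc.prems eq by (simp add: relax_round_def)
  next
    case False
    then have "relax G k f ok (labels G t k f ok es n) es a = Some p"
      using Suc.prems eq by (simp add: relax_round_def split: if_splits)
    then have "p \<in> extensions G ok (labels G t k f ok es n) (set es) a"
      using relax_correct[where G = G and k = k and f = f and ok = ok and
          lab = "labels G t k f ok es n" and es = es and a = a] by simp
    then obtain e q where "p = e # q" "e \<in> set es" "labels G t k f ok es n (head G e) = Some q"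
      by (auto simp: extensions_def)
    then show ?thesis using Suc.IH[of "head G e" q] by simp
  qed
qed

section \<open>Relaxation rounds and attempts as programs\<close>

definition keep_best ::
    "real \<Rightarrow> nat list option \<Rightarrow> (real \<times> nat list) option \<Rightarrow> (real \<times> nat list) option" where
  "keep_best D r best = (case r of None \<Rightarrow> best | Some p \<Rightarrow>
     (case best of None \<Rightarrow> Some (D, p) | Some b \<Rightarrow> if D < fst b then Some (D, p) else Some b))"

definition enc_best :: "real \<times> nat list \<Rightarrow> val" where
  "enc_best b = Pair (Atom (fst b)) (enc_path (snd b))"

definition relax_time :: "nat \<Rightarrow> nat" where "relax_time N = N * (51 * N + 71) + 6"
definition round_time :: "nat \<Rightarrow> nat" where "round_time N = N * (relax_time N + 13) + 12"
definition attempt_time :: "nat \<Rightarrow> nat" where "attempt_time N = N * (round_time N + 7) + 14 * N + 40"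

context attempt_run
begin

abbreviation "time_relax \<equiv> relax_time N"
abbreviation "time_round \<equiv> round_time N"
abbreviation "time_attempt \<equiv> attempt_time N"

abbreviation "rlx lab b \<equiv> relax G k (scaled c D) (cheap k c D) lab es b"
abbreviation "rnd lab \<equiv> relax_round G t k (scaled c D) (cheap k c D) es lab"
abbreviation "lbls n \<equiv> labels G t k (scaled c D) (cheap k c D) es n"

text \<open>\<open>valid\<close> limits the stored paths, so that the numbers formed by
  \<open>Extend\<close> are among those promised by the locale.\<close>

lemma Relax_terminates:
  assumes \<sigma>: "\<sigma> vLab = enc_list (map enc_entry L)" "\<sigma> vArcs = enc_list (map (enc_arc G k c) es)"
      "\<sigma> vVert = enc_nat b" "\<sigma> vD = Atom D" "\<sigma> vOne = Atom 1"
    and L: "length L \<le> N"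
    and valid: "\<And>v p. map_of (rev L) v = Some p \<Longrightarrow> set p \<subseteq> set es \<and> length p \<le> length es"
  shows "terminates K Relax \<sigma> time_relax
    (\<lambda>\<sigma>'. \<sigma>' vCur = enc_option enc_label (rlx (map_of (rev L)) b) \<and> frame 26 {} \<sigma> \<sigma>')"
  unfolding Relax_def
proof (rule terminates_Seq[where ?N1.0 = 4 and ?N2.0 = "N * (51 * N + 71) + 1"], rule terminates_block)
  let ?lab = "map_of (rev L)"
  let ?acc = "\<lambda>ys. fold (relax_arc G k (scaled c D) (cheap k c D) ?lab b) ys None"
  let ?I = "\<lambda>ys \<tau>. \<tau> vCur = enc_option enc_label (?acc ys) \<and> frame 26 {} \<sigma> \<tau>"
  let ?\<sigma> = "exec_block [(vCur, MkNull), (27, Copy vArcs)] \<sigma>"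
  let ?decode = "[(32, Second vArc), (vTail, First 32), (32, Second 32), (vKey, First 32),
        (32, Second 32), (vCosts, First 32)]"
  let ?body = "Seq (block ?decode) (If_eq vTail vVert (Seq Lookup (If (IsPair vFound) Extend SKIP)))"
  show "terminates K (For vArc 27 ?body) ?\<sigma> (N * (51 * N + 71) + 1)
    (\<lambda>\<sigma>'. \<sigma>' vCur = enc_option enc_label (rlx ?lab b) \<and> frame 26 {} \<sigma> \<sigma>')"
  proof (rule terminates_For[where g = "enc_arc G k c" and xs = es and I = ?I and B = "51 * N + 64"])
    show "?\<sigma> 27 = enc_list (map (enc_arc G k c) es)" using \<sigma> by simp
    show "?I [] ?\<sigma>" by simp
    show "length es * (51 * N + 64 + 7) + 1 \<le> N * (51 * N + 71) + 1"
      by (rule add_mono[OF mult_mono]) (use sizes in auto)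
    show "\<tau> vCur = enc_option enc_label (rlx ?lab b) \<and> frame 26 {} \<sigma> \<tau>" if "?I es \<tau>" for \<tau>
      using that by (simp add: relax_def)
  next
    fix ys e zs \<tau> assume xs: "es = ys @ e # zs" and I: "?I ys \<tau>"
    define \<rho> where "\<rho> = exec_block ?decode (\<tau>(vArc := enc_arc G k c e, 27 := enc_list (map (enc_arc G k c) zs)))"
    have fr: "frame 26 {} \<sigma> \<rho>" using I by (simp add: \<rho>_def)
    note frs = frameD[OF fr]
    have \<rho>: "\<rho> vTail = enc_nat (tail G e)" "\<rho> vKey = enc_nat (head G e)" "fst_of (\<rho> vArc) = enc_nat e"
      "\<rho> vCosts = enc_list (map (\<lambda>i. Atom (c i e)) [1..<Suc k])"
      "\<rho> 27 = enc_list (map (enc_arc G k c) zs)" "\<rho> vCur = enc_option enc_label (?acc ys)"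
      using I by (simp_all add: \<rho>_def enc_arc_def)
    have \<rho>': "\<rho> vLab = enc_list (map enc_entry L)" "\<rho> vVert = enc_nat b" "\<rho> vD = Atom D" "\<rho> vOne = Atom 1"
      using frs[of vLab] frs[of vVert] frs[of vD] frs[of vOne] \<sigma> by simp_all
    let ?Q = "\<lambda>\<tau>'. \<tau>' 27 = enc_list (map (enc_arc G k c) zs) \<and> ?I (ys @ [e]) \<tau>'"
    show "terminates K ?body (\<tau>(vArc := enc_arc G k c e, 27 := enc_list (map (enc_arc G k c) zs)))
      (51 * N + 64) ?Q"
    proof (rule terminates_Seq[where ?N1.0 = 12 and ?N2.0 = "51 * N + 51"], rule terminates_block)
      show "terminates K (If_eq vTail vVert (Seq Lookup (If (IsPair vFound) Extend SKIP)))
        (exec_block ?decode (\<tau>(vArc := enc_arc G k c e, 27 := enc_list (map (enc_arc G k c) zs))))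
        (51 * N + 51) ?Q"
        unfolding \<rho>_def[symmetric]
      proof (rule terminates_If_eq[where N' = "51 * N + 49"])
        assume "num_of (\<rho> vTail) \<noteq> num_of (\<rho> vVert)"
        then show "?Q \<rho>" using \<rho> \<rho>' fr by (simp add: relax_arc_def enc_nat_def)
      next
        assume "num_of (\<rho> vTail) = num_of (\<rho> vVert)"
        then have tail: "tail G e = b" using \<rho> \<rho>' by (simp add: enc_nat_def)
        show "terminates K (Seq Lookup (If (IsPair vFound) Extend SKIP)) \<rho> (51 * N + 49) ?Q"
        proof (rule terminates_Seq[where ?N1.0 = "14 * N + 6" and ?N2.0 = "37 * N + 42"])
          show "terminates K Lookup \<rho> (14 * N + 6) (\<lambda>\<rho>1. terminates K
            (If (IsPair vFound) Extend SKIP) \<rho>1 (37 * N + 42) ?Q)"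
          proof (rule terminates_mono[OF Lookup_terminates[OF \<rho>'(1) \<rho>(2) L] order_refl])
            fix \<rho>1 assume "\<rho>1 vFound = enc_option enc_label (?lab (head G e)) \<and> frame 33 {} \<rho> \<rho>1"
            then have found: "\<rho>1 vFound = enc_option enc_label (?lab (head G e))"
              and fr1: "frame 33 {} \<rho> \<rho>1" by auto
            note frs1 = frameD[OF fr1]
            have fr\<sigma>: "frame 26 {} \<sigma> \<rho>1" using frame_trans[OF fr fr1] by simp
            show "terminates K (If (IsPair vFound) Extend SKIP) \<rho>1 (37 * N + 42) ?Q"
            proof (rule terminates_If[where N' = "37 * N + 41"])
              show "terminates K (if eval_test (IsPair vFound) \<rho>1 then Extend else SKIP) \<rho>1 (37 * N + 41) ?Q"
              proof (cases "?lab (head G e)")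
                case None
                then have "\<not> eval_test (IsPair vFound) \<rho>1" using found by simp
                moreover have "?Q \<rho>1"
                  using None tail \<rho> frs1[of 27] frs1[of vCur] fr\<sigma> by (simp add: relax_arc_def)
                ultimately show ?thesis by (simp add: terminates_SKIP)
              next
                case (Some p)
                then have "eval_test (IsPair vFound) \<rho>1" using found by (simp add: enc_label_def)
                moreover have "terminates K Extend \<rho>1 (37 * N + 41) ?Q"
                proof (rule terminates_mono[OF Extend_terminates order_refl])
                  show "\<rho>1 vFound = enc_label p" using found Some by simp
                  show "\<rho>1 vCosts = enc_list (map (\<lambda>i. Atom (c i e)) [1..<Suc k])"
                    using frs1[of vCosts] \<rho>(4) by simp
                  show "fst_of (\<rho>1 vArc) = enc_nat e" using frs1[of vArc] \<rho>(3) by simp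
                  show "\<rho>1 vD = Atom D" using frs1[of vD] \<rho>' by simp
                  show "\<rho>1 vOne = Atom 1" using frs1[of vOne] \<rho>' by simp
                  show "\<rho>1 vCur = enc_option enc_label (?acc ys)" using frs1[of vCur] \<rho>(6) by simp
                  show "set p \<subseteq> set es" "length p \<le> length es" using valid[OF Some] by auto
                  show "e \<in> set es" using xs by simp
                next
                  fix \<rho>2 assume A: "frame 37 {vCur} \<rho>1 \<rho>2 \<and> \<rho>2 vCur = enc_option enc_label
                    (if cheap k c D e then better k (scaled c D) (?acc ys) (e # p) else ?acc ys)"
                  then have fr2: "frame 37 {vCur} \<rho>1 \<rho>2" by simp
                  have "\<rho>2 27 = \<rho> 27" using frameD[OF fr2, of 27] frs1[of 27] by simp
                  moreover have "frame 26 {} \<sigma> \<rho>2" using frame_trans[OF fr\<sigma> fr2] by simp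
                  ultimately show "?Q \<rho>2" using A tail Some \<rho>(5) by (simp add: relax_arc_def)
                qed
                ultimately show ?thesis by simp
              qed
            qed simp
          qed
        qed simp
      qed simp
    qed simp_all
  qed simp
qed (simp_all add: relax_time_def)

text \<open>Nothing leaves the sink, so the vertex loop adds no second entry for
  \<open>t\<close>.\<close>

lemma relax_sink: "rlx lab t = None"
proof -
  have "extensions G (cheap k c D) lab (set es) t = {}"
    using series_parallel_simps(9)[OF sp] es by (auto simp: extensions_def)
  then show ?thesis
    using relax_correct[where G = G and k = k and f = "scaled c D" and ok = "cheap k c D" and
        lab = lab and es = es and a = t] by (cases "rlx lab t") auto
qed

lemma Round_terminates:
  assumes \<sigma>: "\<sigma> vLab = enc_list (map enc_entry L)" "\<sigma> vArcs = enc_list (map (enc_arc G k c) es)"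
      "\<sigma> vD = Atom D" "\<sigma> vOne = Atom 1" "\<sigma> vT = enc_nat t" "\<sigma> vInit = enc_label []"
      "\<sigma> vVerts = enc_list (map enc_nat vs)"
    and L: "length L \<le> N"
    and valid: "\<And>v p. map_of (rev L) v = Some p \<Longrightarrow> set p \<subseteq> set es \<and> length p \<le> length es"
  shows "terminates K Round \<sigma> time_round
    (\<lambda>\<sigma>'. (\<exists>L'. \<sigma>' vLab = enc_list (map enc_entry L') \<and> map_of (rev L') = rnd (map_of (rev L)) \<and>
      length L' \<le> N) \<and> frame 23 {vLab} \<sigma> \<sigma>')"
  unfolding Round_def
proof (rule terminates_Seq[where ?N1.0 = 8 and ?N2.0 = "N * (time_relax + 13) + 3"], rule terminates_block)
  let ?lab = "map_of (rev L)"
  let ?I = "\<lambda>ys \<tau>. (\<exists>L'. \<tau> vNew = enc_list (map enc_entry L') \<and>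
      map_of (rev L') = (\<lambda>a. if a = t then Some [] else if a \<in> set ys then rlx ?lab a else None) \<and>
      length L' \<le> Suc (length ys)) \<and> frame 23 {} \<sigma> \<tau>"
  let ?\<sigma> = "exec_block [(32, MkNull), (vNew, MkPair vT vInit), (vNew, MkPair vNew 32), (24, Copy vVerts)] \<sigma>"
  let ?body = "Seq Relax (If (IsPair vCur) (block [(32, MkPair vVert vCur), (vNew, MkPair 32 vNew)]) SKIP)"
  let ?Q = "\<lambda>\<sigma>'. (\<exists>L'. \<sigma>' vLab = enc_list (map enc_entry L') \<and> map_of (rev L') = rnd ?lab \<and>
      length L' \<le> N) \<and> frame 23 {vLab} \<sigma> \<sigma>'"
  show "terminates K (Seq (For vVert 24 ?body) (Assign vLab (Copy vNew))) ?\<sigma> (N * (time_relax + 13) + 3) ?Q"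
  proof (rule terminates_Seq[where ?N1.0 = "N * (time_relax + 13) + 1" and ?N2.0 = 1])
    show "terminates K (For vVert 24 ?body) ?\<sigma> (N * (time_relax + 13) + 1)
      (\<lambda>\<tau>. terminates K (Assign vLab (Copy vNew)) \<tau> 1 ?Q)"
    proof (rule terminates_For[where g = enc_nat and xs = vs and I = ?I and B = "time_relax + 6"])
      show "?\<sigma> 24 = enc_list (map enc_nat vs)" using \<sigma> by simp
      show "?I [] ?\<sigma>" using \<sigma> by (auto intro!: exI[of _ "[(t, [])]"] simp: enc_entry_def)
      show "length vs * (time_relax + 6 + 7) + 1 \<le> N * (time_relax + 13) + 1"
        by (rule add_mono[OF mult_mono]) (use sizes in auto)
    next
      fix ys b zs \<tau> assume xs: "vs = ys @ b # zs" and I: "?I ys \<tau>"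
      then obtain L' where L': "\<tau> vNew = enc_list (map enc_entry L')"
        "map_of (rev L') = (\<lambda>a. if a = t then Some [] else if a \<in> set ys then rlx ?lab a else None)"
        "length L' \<le> Suc (length ys)" and fr: "frame 23 {} \<sigma> \<tau>" by blast
      define \<rho> where "\<rho> = \<tau>(vVert := enc_nat b, 24 := enc_list (map enc_nat zs))"
      have fr\<rho>: "frame 23 {} \<sigma> \<rho>" using fr by (simp add: \<rho>_def)
      note frs = frameD[OF fr\<rho>]
      have \<rho>: "\<rho> vVert = enc_nat b" "\<rho> 24 = enc_list (map enc_nat zs)" "\<rho> vNew = enc_list (map enc_entry L')"
        using L' by (simp_all add: \<rho>_def)
      have \<rho>': "\<rho> vLab = enc_list (map enc_entry L)" "\<rho> vArcs = enc_list (map (enc_arc G k c) es)"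
        "\<rho> vD = Atom D" "\<rho> vOne = Atom 1"
        using frs[of vLab] frs[of vArcs] frs[of vD] frs[of vOne] \<sigma> by simp_all
      have b: "b \<notin> set ys" "b \<in> verts G" using vs xs by auto
      let ?R = "\<lambda>\<tau>'. \<tau>' 24 = enc_list (map enc_nat zs) \<and> ?I (ys @ [b]) \<tau>'"
      show "terminates K ?body (\<tau>(vVert := enc_nat b, 24 := enc_list (map enc_nat zs))) (time_relax + 6) ?R"
        unfolding \<rho>_def[symmetric]
      proof (rule terminates_Seq[where ?N1.0 = time_relax and ?N2.0 = 5])
        show "terminates K Relax \<rho> time_relax (\<lambda>\<rho>1. terminates K
          (If (IsPair vCur) (block [(32, MkPair vVert vCur), (vNew, MkPair 32 vNew)]) SKIP) \<rho>1 5 ?R)"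
        proof (rule terminates_mono[OF Relax_terminates[OF \<rho>'(1,2) \<rho>(1) \<rho>'(3,4) L valid] order_refl])
          fix \<rho>1 assume "\<rho>1 vCur = enc_option enc_label (rlx ?lab b) \<and> frame 26 {} \<rho> \<rho>1"
          then have cur: "\<rho>1 vCur = enc_option enc_label (rlx ?lab b)" and fr1: "frame 26 {} \<rho> \<rho>1" by auto
          note frs1 = frameD[OF fr1]
          have \<rho>1: "\<rho>1 24 = enc_list (map enc_nat zs)" "\<rho>1 vNew = enc_list (map enc_entry L')"
            "\<rho>1 vVert = enc_nat b"
            using frs1[of 24] frs1[of vNew] frs1[of vVert] \<rho> by simp_all
          have fr\<sigma>: "frame 23 {} \<sigma> \<rho>1" using frame_trans[OF fr\<rho> fr1] by simp
          show "terminates K (If (IsPair vCur) (block [(32, MkPair vVert vCur), (vNew, MkPair 32 vNew)]) SKIP) \<rho>1 5 ?R"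
          proof (rule terminates_If[where N' = 4])
            show "terminates K (if eval_test (IsPair vCur) \<rho>1 then
              block [(32, MkPair vVert vCur), (vNew, MkPair 32 vNew)] else SKIP) \<rho>1 4 ?R"
            proof (cases "rlx ?lab b")
              case None
              then have "\<not> eval_test (IsPair vCur) \<rho>1" using cur by simp
              moreover have "map_of (rev L') = (\<lambda>a. if a = t then Some [] else
                  if a \<in> set (ys @ [b]) then rlx ?lab a else None)"
                using L'(2) None by (auto simp: fun_eq_iff)
              then have "?R \<rho>1" using \<rho>1 L'(3) fr\<sigma> by (auto intro!: exI[of _ L'])
              ultimately show ?thesis by (simp add: terminates_SKIP)
            next
              case (Some p)
              then have "b \<noteq> t" using relax_sink by auto
              have pair: "eval_test (IsPair vCur) \<rho>1" using cur Some by (simp add: enc_label_def)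
              \<comment> \<open>An entry put in front has the lowest priority in the reversed
                reading. This is harmless, as \<open>b\<close> is neither \<open>t\<close> nor an
                earlier vertex and so has no entry yet.\<close>
              have new: "map_of (rev ((b, p) # L')) = (\<lambda>a. if a = t then Some [] else
                  if a \<in> set (ys @ [b]) then rlx ?lab a else None)"
                using L'(2) Some \<open>b \<noteq> t\<close> b(1) by (auto simp: fun_eq_iff map_add_def split: option.splits)
              have "terminates K (block [(32, MkPair vVert vCur), (vNew, MkPair 32 vNew)]) \<rho>1 4 ?R"
              proof (rule terminates_block)
                let ?\<rho> = "exec_block [(32, MkPair vVert vCur), (vNew, MkPair 32 vNew)] \<rho>1"
                have "?\<rho> vNew = enc_list (map enc_entry ((b, p) # L'))"
                  using \<rho>1 cur Some by (simp add: enc_entry_def)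
                moreover have "length ((b, p) # L') \<le> Suc (length (ys @ [b]))" using L'(3) by simp
                moreover have "?\<rho> 24 = enc_list (map enc_nat zs)" "frame 23 {} \<sigma> ?\<rho>"
                  using \<rho>1 fr\<sigma> by simp_all
                ultimately show "?R ?\<rho>" using new by blast
              qed simp_all
              then show ?thesis using pair by simp
            qed
          qed simp
        qed
      qed simp
    next
      fix \<tau> assume "?I vs \<tau>"
      then obtain L' where L': "\<tau> vNew = enc_list (map enc_entry L')"
        "map_of (rev L') = (\<lambda>a. if a = t then Some [] else if a \<in> set vs then rlx ?lab a else None)"
        "length L' \<le> Suc (length vs)" and fr: "frame 23 {} \<sigma> \<tau>" by blast
      have "map_of (rev L') = rnd ?lab" using L'(2) vs by (simp add: fun_eq_iff relax_round_def)
      moreover have "length L' \<le> N" using L'(3) sizes by simp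
      moreover have "frame 23 {vLab} \<sigma> (\<tau>(vLab := v))" for v using fr by (auto simp: frame_def)
      ultimately show "terminates K (Assign vLab (Copy vNew)) \<tau> 1 ?Q"
        using L'(1) by (intro terminates_Assign conjI exI[of _ L']) simp_all
    qed simp
  qed simp
qed (simp_all add: round_time_def)

lemma Record_terminates:
  assumes "\<sigma> vFound = enc_option enc_label (lbls (length es) s)"
      "\<sigma> vD = Atom D" "\<sigma> vZero = Atom 0" "\<sigma> vBest = enc_option enc_best best"
    and "frame 20 {vBest} \<sigma>0 \<sigma>"
  shows "terminates K Record \<sigma> 19
    (\<lambda>\<sigma>'. \<sigma>' vBest = enc_option enc_best (keep_best D (attempt G s t k c es D) best) \<and>
      frame 20 {vBest} \<sigma>0 \<sigma>')"
  using assms unfolding Record_def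
  by (cases "lbls (length es) s"; cases best)
    (auto intro!: terminates_If_cases terminates_block_Seq terminates_Assign terminates_SKIP
      simp: keep_best_def attempt_def excess_eq enc_label_def enc_best_def
      simp del: block.simps upt_Suc split: if_splits)

text \<open>The arc list serves as a counter: one round for each arc, which is enough by
  \<open>labels_greedy\<close>.\<close>

lemma Attempt_terminates:
  assumes \<sigma>: "\<sigma> vArcs = enc_list (map (enc_arc G k c) es)"
      "\<sigma> vD = Atom D" "\<sigma> vOne = Atom 1" "\<sigma> vZero = Atom 0" "\<sigma> vS = enc_nat s" "\<sigma> vT = enc_nat t"
      "\<sigma> vInit = enc_label []" "\<sigma> vVerts = enc_list (map enc_nat vs)"
      "\<sigma> vBest = enc_option enc_best best"
  shows "terminates K Attempt \<sigma> time_attempt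
    (\<lambda>\<sigma>'. \<sigma>' vBest = enc_option enc_best (keep_best D (attempt G s t k c es D) best) \<and>
      frame 20 {vBest} \<sigma> \<sigma>')"
  unfolding Attempt_def
proof (rule terminates_block_Seq)
  let ?I = "\<lambda>ys \<tau>. (\<exists>L. \<tau> vLab = enc_list (map enc_entry L) \<and> map_of (rev L) = lbls (length ys) \<and>
      length L \<le> N) \<and> frame 20 {} \<sigma> \<tau>"
  let ?asgs = "[(32, MkNull), (vLab, MkPair vT vInit), (vLab, MkPair vLab 32), (21, Copy vArcs)]"
  let ?\<sigma> = "exec_block ?asgs \<sigma>"
  let ?rest = "Seq (block [(vKey, Copy vS)]) (Seq Lookup Record)"
  let ?Q = "\<lambda>\<sigma>'. \<sigma>' vBest = enc_option enc_best (keep_best D (attempt G s t k c es D) best) \<and>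
      frame 20 {vBest} \<sigma> \<sigma>'"
  show "terminates K (Seq (For 22 21 Round) ?rest) ?\<sigma> (time_attempt - (2 * length ?asgs + 1)) ?Q"
  proof (rule terminates_Seq[where ?N1.0 = "N * (time_round + 7) + 1" and ?N2.0 = "14 * N + 29"])
    show "terminates K (For 22 21 Round) ?\<sigma> (N * (time_round + 7) + 1)
      (\<lambda>\<tau>. terminates K ?rest \<tau> (14 * N + 29) ?Q)"
    proof (rule terminates_For[where g = "enc_arc G k c" and xs = es and I = ?I and B = time_round])
      show "?\<sigma> 21 = enc_list (map (enc_arc G k c) es)" using \<sigma> by simp
      show "?I [] ?\<sigma>"
        using \<sigma> sizes by (auto intro!: exI[of _ "[(t, [])]"] simp: enc_entry_def labels_def)
      show "length es * (time_round + 7) + 1 \<le> N * (time_round + 7) + 1" using sizes by simp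
    next
      fix ys e zs \<tau> assume xs: "es = ys @ e # zs" and I: "?I ys \<tau>"
      then obtain L where L: "\<tau> vLab = enc_list (map enc_entry L)" "map_of (rev L) = lbls (length ys)"
        "length L \<le> N" and fr: "frame 20 {} \<sigma> \<tau>" by blast
      define \<rho> where "\<rho> = \<tau>(22 := enc_arc G k c e, 21 := enc_list (map (enc_arc G k c) zs))"
      have fr\<rho>: "frame 20 {} \<sigma> \<rho>" using fr by (simp add: \<rho>_def)
      note frs = frameD[OF fr\<rho>]
      have \<rho>: "\<rho> vLab = enc_list (map enc_entry L)" "\<rho> vArcs = enc_list (map (enc_arc G k c) es)"
        "\<rho> vD = Atom D" "\<rho> vOne = Atom 1" "\<rho> vT = enc_nat t" "\<rho> vInit = enc_label []"
        "\<rho> vVerts = enc_list (map enc_nat vs)"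
        using frs[of vArcs] frs[of vD] frs[of vOne] frs[of vT] frs[of vInit] frs[of vVerts] \<sigma> L(1)
        by (simp_all add: \<rho>_def)
      have valid: "set p \<subseteq> set es \<and> length p \<le> length es" if "map_of (rev L) v = Some p" for v p
        using labels_bound that xs unfolding L(2) by fastforce
      show "terminates K Round (\<tau>(22 := enc_arc G k c e, 21 := enc_list (map (enc_arc G k c) zs)))
        time_round (\<lambda>\<tau>'. \<tau>' 21 = enc_list (map (enc_arc G k c) zs) \<and> ?I (ys @ [e]) \<tau>')"
        unfolding \<rho>_def[symmetric]
      proof (rule terminates_mono[OF Round_terminates[OF \<rho> L(3) valid] order_refl])
        fix \<tau>' assume A: "(\<exists>L'. \<tau>' vLab = enc_list (map enc_entry L') \<and> map_of (rev L') = rnd (map_of (rev L)) \<and>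
          length L' \<le> N) \<and> frame 23 {vLab} \<rho> \<tau>'"
        then have "\<tau>' 21 = \<rho> 21" using frameD[of 23 "{vLab}" \<rho> \<tau>' 21] by simp
        moreover have "frame 20 {} \<sigma> \<tau>'" using frame_trans[OF fr\<rho> A[THEN conjunct2]] by simp
        moreover have "rnd (map_of (rev L)) = lbls (length (ys @ [e]))"
          unfolding L(2) by (simp add: labels_def)
        ultimately show "\<tau>' 21 = enc_list (map (enc_arc G k c) zs) \<and> ?I (ys @ [e]) \<tau>'"
          using A by (simp add: \<rho>_def)
      qed
    next
      fix \<tau> assume "?I es \<tau>"
      then obtain L where L: "\<tau> vLab = enc_list (map enc_entry L)" "map_of (rev L) = lbls (length es)"
        "length L \<le> N" and fr: "frame 20 {} \<sigma> \<tau>" by blast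
      define \<rho> where "\<rho> = exec_block [(vKey, Copy vS)] \<tau>"
      have fr\<rho>: "frame 20 {} \<sigma> \<rho>" using fr by (simp add: \<rho>_def)
      have \<rho>: "\<rho> vLab = enc_list (map enc_entry L)" "\<rho> vKey = enc_nat s"
        using L frameD[OF fr, of vS] \<sigma> by (simp_all add: \<rho>_def)
      show "terminates K ?rest \<tau> (14 * N + 29) ?Q"
      proof (rule terminates_block_Seq)
        show "terminates K (Seq Lookup Record) (exec_block [(vKey, Copy vS)] \<tau>)
          (14 * N + 29 - (2 * length [(vKey, Copy vS)] + 1)) ?Q"
          unfolding \<rho>_def[symmetric]
        proof (rule terminates_Seq[where ?N1.0 = "14 * N + 6" and ?N2.0 = 19])
        show "terminates K Lookup \<rho> (14 * N + 6) (\<lambda>\<tau>. terminates K Record \<tau> 19 ?Q)"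
        proof (rule terminates_mono[OF Lookup_terminates[OF \<rho> L(3)] order_refl])
          fix \<tau>1 assume "\<tau>1 vFound = enc_option enc_label (map_of (rev L) s) \<and> frame 33 {} \<rho> \<tau>1"
          then have found: "\<tau>1 vFound = enc_option enc_label (lbls (length es) s)"
            and fr\<rho>1: "frame 33 {} \<rho> \<tau>1" using L(2) by simp_all
          have fr1: "frame 20 {} \<sigma> \<tau>1" using frame_trans[OF fr\<rho> fr\<rho>1] by simp
          note frs1 = frameD[OF fr1]
          have "\<tau>1 vD = Atom D" "\<tau>1 vZero = Atom 0" "\<tau>1 vBest = enc_option enc_best best"
            using frs1[of vD] frs1[of vZero] frs1[of vBest] \<sigma> by simp_all
          moreover have "frame 20 {vBest} \<sigma> \<tau>1" using fr1 by (auto simp: frame_def)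
          ultimately show "terminates K Record \<tau>1 19 ?Q" 
            by (rule Record_terminates[where \<sigma> = \<tau>1 and best = best, OF found])
        qed
        qed simp
      qed simp_all
    qed simp
  qed (simp add: attempt_time_def)
qed (simp_all add: attempt_time_def)

end

section \<open>The complete program\<close>

definition Try_powers :: com where
  "Try_powers = Seq (block [(vD, Copy 13), (18, Copy vArcs)])
     (For 19 18 (Seq (block [(vD, Add vD vD), (vD, Add vD vD)]) Attempt))"

text \<open>The input does not contain \<open>k\<close> as a number. The unit factors of the empty
  path and its excess \<open>- k\<close> are obtained by running through the cost list of the
  arc.\<close>

definition Try_arc :: com where
  "Try_arc = Seq (block [(10, Second 9), (10, Second 10), (10, Second 10), (11, First 10),
       (15, MkNull), (16, Zero), (12, Copy 11)])
    (Seq (For 13 12 (block [(15, MkPair vOne 15), (16, Sub 16 vOne)]))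
    (Seq (block [(10, MkNull), (vInit, MkPair 15 10), (vInit, MkPair 16 vInit), (12, Copy 11)])
    (For 13 12 Try_powers)))"

definition Robust_path :: com where
  "Robust_path = Seq (block [(vS, First 0), (8, Second 0), (vT, First 8), (8, Second 8), (vVerts, First 8),
       (8, Second 8), (vArcs, First 8), (vOne, One), (vZero, Zero), (vBest, MkNull), (8, Copy vArcs)])
    (Seq (For 9 8 Try_arc) (Assign 0 (Second vBest)))"

definition powers_time :: "nat \<Rightarrow> nat" where "powers_time N = N * (attempt_time N + 12) + 6"
definition arc_time :: "nat \<Rightarrow> nat" where "arc_time N = N * (powers_time N + 18) + 27"
definition path_time :: "nat \<Rightarrow> nat" where "path_time N = N * (arc_time N + 7) + 26"

text \<open>One set \<open>K\<close> has to serve for all thresholds. \<open>powers\<close> covers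
  odd exponents too, because the program quadruples by doubling twice.\<close>

locale full_run = robust_instance G s t k c es
  for G :: "(nat, nat) pre_digraph" and s t k c es +
  fixes vs :: "nat list" and K :: "real set" and N :: nat
  assumes attempts: "\<And>D. D \<in> candidates \<Longrightarrow> attempt_run G s t k c es vs K D N"
    and units: "0 \<in> K" "1 \<in> K" and negs: "\<And>j. j \<le> k \<Longrightarrow> - real j \<in> K"
    and powers: "\<And>i e j. \<lbrakk>i \<in> {1..k}; e \<in> set es; j \<le> 2 * length es\<rbrakk> \<Longrightarrow> 2 ^ j * c i e \<in> K"
    and lengths: "length es \<le> N" "k \<le> N"
begin

text \<open>Invariant of the nested loops over arcs, agents and powers: \<open>S\<close> is the set
  of thresholds tried so far and finally becomes \<open>candidates\<close>.\<close>

definition best_of :: "real set \<Rightarrow> (real \<times> nat list) option \<Rightarrow> bool" where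
  "best_of S b \<longleftrightarrow> (case b of
     None \<Rightarrow> \<forall>D\<in>S. attempt G s t k c es D = None
   | Some (D, p) \<Rightarrow> D \<in> S \<and> attempt G s t k c es D = Some p \<and>
       (\<forall>D'\<in>S. attempt G s t k c es D' \<noteq> None \<longrightarrow> D \<le> D'))"

lemma best_of_keep_best:
  "best_of S b \<Longrightarrow> best_of (insert D S) (keep_best D (attempt G s t k c es D) b)"
  by (auto simp: best_of_def keep_best_def split: option.splits if_splits)

definition init_label :: val where
  "init_label = Pair (Atom (- real k)) (Pair (enc_list (map (\<lambda>i. Atom 1) [1..<Suc k])) Null)"

text \<open>The label of the empty path does not depend on the threshold and can be prepared before
  \<open>vD\<close> is set.\<close>

lemma enc_label_Nil:
  assumes "D \<in> candidates"
  shows "attempt_run.enc_label k c D [] = init_label"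
proof -
  interpret attempt_run G s t k c es vs K D N using attempts[OF assms] .
  show ?thesis
    by (simp add: enc_label_def init_label_def excess_eq potential_def enc_path_def)
qed

abbreviation "time_powers \<equiv> powers_time N"
abbreviation "time_arc \<equiv> arc_time N"
abbreviation "time_path \<equiv> path_time N"

definition prepared :: "store \<Rightarrow> bool" where
  "prepared \<sigma> \<longleftrightarrow> \<sigma> vArcs = enc_list (map (enc_arc G k c) es) \<and> \<sigma> vOne = Atom 1 \<and> \<sigma> vZero = Atom 0 \<and>
     \<sigma> vS = enc_nat s \<and> \<sigma> vT = enc_nat t \<and> \<sigma> vVerts = enc_list (map enc_nat vs)"

lemma prepared_frame: "prepared \<sigma> \<Longrightarrow> frame n {vBest} \<sigma> \<tau> \<Longrightarrow> 8 \<le> n \<Longrightarrow> prepared \<tau>"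
  by (simp add: prepared_def frame_def)

lemma prepared_update: "prepared \<sigma> \<Longrightarrow> 7 \<le> y \<Longrightarrow> prepared (\<sigma>(y := v))"
  by (simp add: prepared_def)

lemma Try_powers_terminates:
  assumes \<sigma>: "prepared \<sigma>" "\<sigma> vInit = init_label" "\<sigma> 13 = Atom (c i e)"
      "\<sigma> vBest = enc_option enc_best b" "best_of S b"
    and ie: "i \<in> {1..k}" "e \<in> set es"
  shows "terminates K Try_powers \<sigma> time_powers (\<lambda>\<sigma>'. frame 17 {vBest} \<sigma> \<sigma>' \<and>
    (\<exists>b'. \<sigma>' vBest = enc_option enc_best b' \<and> best_of (S \<union> (\<lambda>j. 4 ^ j * c i e) ` {1..length es}) b'))"
  unfolding Try_powers_def
proof (rule terminates_Seq[where ?N1.0 = 4 and ?N2.0 = "N * (attempt_time N + 12) + 1"], rule terminates_block)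
  let ?T = "attempt_time N"
  let ?P = "\<lambda>n. (\<lambda>j. 4 ^ j * c i e) ` {1..n}"
  let ?\<sigma> = "exec_block [(vD, Copy 13), (18, Copy vArcs)] \<sigma>"
  let ?I = "\<lambda>ys \<tau>. frame 17 {vBest} \<sigma> \<tau> \<and> \<tau> vD = Atom (4 ^ length ys * c i e) \<and>
    (\<exists>b'. \<tau> vBest = enc_option enc_best b' \<and> best_of (S \<union> ?P (length ys)) b')"
  let ?body = "Seq (block [(vD, Add vD vD), (vD, Add vD vD)]) Attempt"
  show "terminates K (For 19 18 ?body) ?\<sigma> (N * (?T + 12) + 1) (\<lambda>\<sigma>'. frame 17 {vBest} \<sigma> \<sigma>' \<and>
    (\<exists>b'. \<sigma>' vBest = enc_option enc_best b' \<and> best_of (S \<union> ?P (length es)) b'))"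
  proof (rule terminates_For[where g = "enc_arc G k c" and xs = es and I = ?I and B = "?T + 5"])
    show "?\<sigma> 18 = enc_list (map (enc_arc G k c) es)" using \<sigma> by (simp add: prepared_def)
    show "?I [] ?\<sigma>" using \<sigma> by auto
    show "length es * (?T + 5 + 7) + 1 \<le> N * (?T + 12) + 1"
      by (rule add_mono[OF mult_mono]) (use lengths in auto)
  next
    fix ys e' zs \<tau> assume xs: "es = ys @ e' # zs" and I: "?I ys \<tau>"
    then obtain b' where b': "\<tau> vBest = enc_option enc_best b'" "best_of (S \<union> ?P (length ys)) b'"
      by blast
    define D where "D = 4 ^ Suc (length ys) * c i e"
    have D: "D \<in> candidates"
      unfolding D_def candidates_def using ie es xs
      by (intro CollectI exI[of _ "Suc (length ys)"] exI[of _ i] exI[of _ e]) auto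
    interpret run: attempt_run G s t k c es vs K D N using attempts[OF D] .
    let ?\<tau> = "\<tau>(19 := enc_arc G k c e', 18 := enc_list (map (enc_arc G k c) zs))"
    define \<rho> where "\<rho> = exec_block [(vD, Add vD vD), (vD, Add vD vD)] ?\<tau>"
    have fr: "frame 17 {vBest} \<sigma> \<rho>" using I by (simp add: \<rho>_def)
    have prep: "prepared \<rho>" using prepared_frame[OF \<sigma>(1) fr] by simp
    have \<rho>: "\<rho> vD = Atom D" "\<rho> vBest = enc_option enc_best b'" "\<rho> vInit = run.enc_label []"
      "\<rho> 18 = enc_list (map (enc_arc G k c) zs)"
      using I b'(1) frameD[OF fr, of vInit] \<sigma>(2) enc_label_Nil[OF D] by (simp_all add: \<rho>_def D_def)
    define a where "a = 4 ^ length ys * c i e"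
    \<comment> \<open>The two doublings pass through these exponents; both are at most
      \<open>2 * length es\<close> because \<open>ys\<close> is a proper prefix of
      \<open>es\<close>.\<close>
    have double: "2 ^ (2 * length ys + 1) * c i e = a + a"
        "2 ^ (2 * length ys + 2) * c i e = (a + a) + (a + a)"
      by (simp_all add: a_def power_add power_mult)
    have pow: "a + a \<in> K"
      unfolding double(1)[symmetric] using xs by (intro powers ie) simp
    have pow': "(a + a) + (a + a) \<in> K"
      unfolding double(2)[symmetric] using xs by (intro powers ie) simp
    show "terminates K ?body ?\<tau> (?T + 5)
      (\<lambda>\<tau>'. \<tau>' 18 = enc_list (map (enc_arc G k c) zs) \<and> ?I (ys @ [e']) \<tau>')"
    proof (rule terminates_Seq[where ?N1.0 = 4 and ?N2.0 = ?T], rule terminates_block)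
      show "block_in K [(vD, Add vD vD), (vD, Add vD vD)] ?\<tau>"
        using I pow pow' by (simp add: a_def)
      show "terminates K Attempt (exec_block [(vD, Add vD vD), (vD, Add vD vD)] ?\<tau>) ?T
        (\<lambda>\<tau>'. \<tau>' 18 = enc_list (map (enc_arc G k c) zs) \<and> ?I (ys @ [e']) \<tau>')"
        unfolding \<rho>_def[symmetric]
      proof (rule terminates_mono[OF run.Attempt_terminates order_refl])
        fix \<tau>' assume A: "\<tau>' vBest = enc_option enc_best (keep_best D (attempt G s t k c es D) b') \<and>
          frame 20 {vBest} \<rho> \<tau>'"
        then have fr': "frame 20 {vBest} \<rho> \<tau>'" by simp
        have "S \<union> ?P (length (ys @ [e'])) = insert D (S \<union> ?P (length ys))"
          by (simp add: D_def atLeastAtMostSuc_conv)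
        then have "best_of (S \<union> ?P (length (ys @ [e']))) (keep_best D (attempt G s t k c es D) b')"
          using best_of_keep_best[OF b'(2)] by simp
        moreover have "frame 17 {vBest} \<sigma> \<tau>'" using frame_trans[OF fr fr'] by simp
        ultimately show "\<tau>' 18 = enc_list (map (enc_arc G k c) zs) \<and> ?I (ys @ [e']) \<tau>'"
          using A frameD[OF fr', of 18] frameD[OF fr', of vD] \<rho> by (auto simp: D_def)
      qed (use prep \<rho> in \<open>simp_all add: prepared_def\<close>)
    qed simp_all
  qed simp_all
qed (simp_all add: powers_time_def)

lemma Try_arc_terminates:
  assumes \<sigma>: "prepared \<sigma>" "\<sigma> 9 = enc_arc G k c e"
      "\<sigma> vBest = enc_option enc_best b" "best_of S b"
    and e: "e \<in> set es"
  shows "terminates K Try_arc \<sigma> time_arc (\<lambda>\<sigma>'. frame 10 {vBest} \<sigma> \<sigma>' \<and>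
    (\<exists>b'. \<sigma>' vBest = enc_option enc_best b' \<and>
      best_of (S \<union> {4 ^ j * c i e | j i. j \<in> {1..length es} \<and> i \<in> {1..k}}) b'))"
  unfolding Try_arc_def
proof (rule terminates_Seq[where ?N1.0 = 14 and ?N2.0 = "N * (time_powers + 18) + 12"], rule terminates_block)
  define xs where "xs = [1..<Suc k]"
  have len: "length xs \<le> N" "set xs = {1..k}" using lengths by (auto simp: xs_def)
  let ?C = "\<lambda>i. Atom (c i e)"
  let ?Q = "\<lambda>\<sigma>'. frame 10 {vBest} \<sigma> \<sigma>' \<and> (\<exists>b'. \<sigma>' vBest = enc_option enc_best b' \<and>
      best_of (S \<union> {4 ^ j * c i e | j i. j \<in> {1..length es} \<and> i \<in> {1..k}}) b')"
  let ?pre = "[(10, Second 9), (10, Second 10), (10, Second 10), (11, First 10),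
       (15, MkNull), (16, Zero), (12, Copy 11)]"
  let ?mid = "[(10, MkNull), (vInit, MkPair 15 10), (vInit, MkPair 16 vInit), (12, Copy 11)]"
  let ?I = "\<lambda>ys \<tau>. \<tau> 15 = enc_list (map (\<lambda>i. Atom 1) ys) \<and> \<tau> 16 = Atom (- real (length ys)) \<and>
    \<tau> 11 = enc_list (map ?C xs) \<and> frame 10 {} \<sigma> \<tau>"
  define \<sigma>0 where "\<sigma>0 = exec_block ?pre \<sigma>"
  have \<sigma>0: "\<sigma>0 12 = enc_list (map ?C xs)" "\<sigma>0 11 = enc_list (map ?C xs)" "\<sigma>0 15 = Null" "\<sigma>0 16 = Atom 0"
    "frame 10 {} \<sigma> \<sigma>0"
    using \<sigma>(2) by (simp_all add: \<sigma>0_def enc_arc_def xs_def del: upt_Suc)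
  show "terminates K (Seq (For 13 12 (block [(15, MkPair vOne 15), (16, Sub 16 vOne)]))
    (Seq (block ?mid) (For 13 12 Try_powers))) (exec_block ?pre \<sigma>) (N * (time_powers + 18) + 12) ?Q"
    unfolding \<sigma>0_def[symmetric]
  proof (rule terminates_Seq[where ?N1.0 = "N * 11 + 1" and ?N2.0 = "N * (time_powers + 7) + 9 + 1"])
    show "terminates K (For 13 12 (block [(15, MkPair vOne 15), (16, Sub 16 vOne)])) \<sigma>0 (N * 11 + 1)
      (\<lambda>\<tau>. terminates K (Seq (block ?mid) (For 13 12 Try_powers)) \<tau> (N * (time_powers + 7) + 9 + 1) ?Q)"
    proof (rule terminates_For[where g = ?C and xs = xs and I = ?I and B = 4])
      show "\<sigma>0 12 = enc_list (map ?C xs)" by (rule \<sigma>0(1))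
      show "?I [] \<sigma>0" using \<sigma>0 by simp
      show "length xs * (4 + 7) + 1 \<le> N * 11 + 1" using len by simp
    next
      fix ys i zs \<tau> assume xs: "xs = ys @ i # zs" and I: "?I ys \<tau>"
      have "length ys < k" using arg_cong[OF xs, of length] by (simp add: xs_def del: upt_Suc)
      have "- real (length ys) - 1 = - real (Suc (length ys))" by simp
      also have "\<dots> \<in> K" by (rule negs) (use \<open>length ys < k\<close> in simp)
      finally have neg: "- real (length ys) - 1 \<in> K" .
      have one: "\<tau> vOne = Atom 1" using frameD[of 10 "{}" \<sigma> \<tau> vOne] I \<sigma>(1) by (simp add: prepared_def)
      \<comment> \<open>The program puts cells in front whereas the invariant appends; for equal
        atoms both give the same list.\<close>
      have rep: "enc_list (map (\<lambda>i. Atom 1) (ys @ [i])) = Pair (Atom 1) (enc_list (map (\<lambda>i. Atom 1) ys))"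
        by (simp add: map_replicate_const replicate_append_same)
      show "terminates K (block [(15, MkPair vOne 15), (16, Sub 16 vOne)])
        (\<tau>(13 := ?C i, 12 := enc_list (map ?C zs))) 4
        (\<lambda>\<tau>'. \<tau>' 12 = enc_list (map ?C zs) \<and> ?I (ys @ [i]) \<tau>')"
      proof (rule terminates_block)
        show "block_in K [(15, MkPair vOne 15), (16, Sub 16 vOne)] (\<tau>(13 := ?C i, 12 := enc_list (map ?C zs)))"
          using I one neg by simp
      qed (use I one in \<open>simp_all add: rep del: map_append\<close>)
    next
      fix \<tau> assume I: "?I xs \<tau>"
      define \<rho> where "\<rho> = exec_block ?mid \<tau>"
      have \<rho>: "\<rho> vInit = init_label" "\<rho> 12 = enc_list (map ?C xs)" "frame 10 {} \<sigma> \<rho>"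
        using I by (simp_all add: \<rho>_def init_label_def xs_def del: upt_Suc)
      let ?S = "\<lambda>A. S \<union> {4 ^ j * c i e | j i. j \<in> {1..length es} \<and> i \<in> A}"
      let ?J = "\<lambda>ys \<tau>'. frame 10 {vBest} \<sigma> \<tau>' \<and> \<tau>' vInit = init_label \<and>
        (\<exists>b'. \<tau>' vBest = enc_option enc_best b' \<and> best_of (?S (set ys)) b')"
      show "terminates K (Seq (block ?mid) (For 13 12 Try_powers)) \<tau> (N * (time_powers + 7) + 9 + 1) ?Q"
      proof (rule terminates_Seq[where ?N1.0 = 8 and ?N2.0 = "N * (time_powers + 7) + 1"], rule terminates_block)
        show "terminates K (For 13 12 Try_powers) (exec_block ?mid \<tau>) (N * (time_powers + 7) + 1) ?Q"
          unfolding \<rho>_def[symmetric]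
        proof (rule terminates_For[where g = ?C and xs = xs and I = ?J and B = time_powers])
          show "\<rho> 12 = enc_list (map ?C xs)" by (rule \<rho>)
          have "\<rho> vBest = enc_option enc_best b" using frameD[OF \<rho>(3), of vBest] \<sigma>(3) by simp
          moreover have "frame 10 {vBest} \<sigma> \<rho>" using \<rho>(3) by (simp add: frame_def)
          ultimately show "?J [] \<rho>" using \<rho> \<sigma>(4) by auto
          show "length xs * (time_powers + 7) + 1 \<le> N * (time_powers + 7) + 1" using len by simp
          show "?Q \<tau>'" if "?J xs \<tau>'" for \<tau>' using that len(2) by simp
        next
          fix ys i zs \<tau>1 assume xs: "xs = ys @ i # zs" and J: "?J ys \<tau>1"
          then obtain b' where b': "\<tau>1 vBest = enc_option enc_best b'" "best_of (?S (set ys)) b'" by blast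
          define \<tau>2 where "\<tau>2 = \<tau>1(13 := ?C i, 12 := enc_list (map ?C zs))"
          have fr: "frame 10 {vBest} \<sigma> \<tau>2" using J by (simp add: \<tau>2_def)
          have prep: "prepared \<tau>2" using prepared_frame[OF \<sigma>(1) fr] by simp
          have \<tau>2: "\<tau>2 vInit = init_label" "\<tau>2 13 = Atom (c i e)" "\<tau>2 vBest = enc_option enc_best b'"
            "\<tau>2 12 = enc_list (map ?C zs)"
            using J b' by (simp_all add: \<tau>2_def)
          have "i \<in> set xs" by (simp add: xs)
          then have i: "i \<in> {1..k}" using len by simp
          show "terminates K Try_powers (\<tau>1(13 := ?C i, 12 := enc_list (map ?C zs))) time_powers
            (\<lambda>\<tau>'. \<tau>' 12 = enc_list (map ?C zs) \<and> ?J (ys @ [i]) \<tau>')"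
            unfolding \<tau>2_def[symmetric]
          proof (rule terminates_mono[OF Try_powers_terminates[OF prep \<tau>2(1-3) b'(2) i e] order_refl])
            fix \<tau>' assume A: "frame 17 {vBest} \<tau>2 \<tau>' \<and> (\<exists>b''. \<tau>' vBest = enc_option enc_best b'' \<and>
              best_of (?S (set ys) \<union> (\<lambda>j. 4 ^ j * c i e) ` {1..length es}) b'')"
            then have fr': "frame 17 {vBest} \<tau>2 \<tau>'" by simp
            have "?S (set ys) \<union> (\<lambda>j. 4 ^ j * c i e) ` {1..length es} = ?S (set (ys @ [i]))"
              by (auto, blast)
            then show "\<tau>' 12 = enc_list (map ?C zs) \<and> ?J (ys @ [i]) \<tau>'"
              using A frame_trans[OF fr fr'] frameD[OF fr', of 12] frameD[OF fr', of vInit] \<tau>2 by simp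
          qed
        qed simp
      qed simp_all
    qed simp
  qed (simp add: algebra_simps)
qed (use units in \<open>simp_all add: arc_time_def\<close>)

lemma Robust_path_terminates:
  assumes x: "x = enc_list [enc_nat s, enc_nat t, enc_list (map enc_nat vs), enc_list (map (enc_arc G k c) es)]"
  shows "terminates K Robust_path (init_store x) time_path
    (\<lambda>\<sigma>'. \<exists>D p. \<sigma>' 0 = enc_path p \<and> best_of candidates (Some (D, p)))"
  unfolding Robust_path_def
proof (rule terminates_Seq[where ?N1.0 = 22 and ?N2.0 = "N * (time_arc + 7) + 3"], rule terminates_block)
  let ?pre = "[(vS, First 0), (8, Second 0), (vT, First 8), (8, Second 8), (vVerts, First 8),
       (8, Second 8), (vArcs, First 8), (vOne, One), (vZero, Zero), (vBest, MkNull), (8, Copy vArcs)]"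
  let ?Q = "\<lambda>\<sigma>'. \<exists>D p. \<sigma>' 0 = enc_path p \<and> best_of candidates (Some (D, p))"
  define \<sigma> where "\<sigma> = exec_block ?pre (init_store x)"
  have \<sigma>: "prepared \<sigma>" "\<sigma> vBest = Null" "\<sigma> 8 = enc_list (map (enc_arc G k c) es)"
    by (simp_all add: \<sigma>_def prepared_def init_store_def x)
  let ?S = "\<lambda>A. {4 ^ j * c i e | j i e. j \<in> {1..length es} \<and> i \<in> {1..k} \<and> e \<in> A}"
  let ?I = "\<lambda>ys \<tau>. prepared \<tau> \<and> (\<exists>b. \<tau> vBest = enc_option enc_best b \<and> best_of (?S (set ys)) b)"
  show "terminates K (Seq (For 9 8 Try_arc) (Assign 0 (Second vBest))) (exec_block ?pre (init_store x))
    (N * (time_arc + 7) + 3) ?Q"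
    unfolding \<sigma>_def[symmetric]
  proof (rule terminates_Seq[where ?N1.0 = "N * (time_arc + 7) + 1" and ?N2.0 = 1])
    show "terminates K (For 9 8 Try_arc) \<sigma> (N * (time_arc + 7) + 1)
      (\<lambda>\<tau>. terminates K (Assign 0 (Second vBest)) \<tau> 1 ?Q)"
    proof (rule terminates_For[where g = "enc_arc G k c" and xs = es and I = ?I and B = time_arc])
      show "?I [] \<sigma>" using \<sigma> by (auto intro!: exI[of _ None] simp: best_of_def)
      show "length es * (time_arc + 7) + 1 \<le> N * (time_arc + 7) + 1" using lengths by simp
    next
      fix ys e zs \<tau> assume xs: "es = ys @ e # zs" and I: "?I ys \<tau>"
      then obtain b where b: "\<tau> vBest = enc_option enc_best b" "best_of (?S (set ys)) b" by blast
      define \<rho> where "\<rho> = \<tau>(9 := enc_arc G k c e, 8 := enc_list (map (enc_arc G k c) zs))"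
      have \<rho>: "prepared \<rho>" "\<rho> 9 = enc_arc G k c e" "\<rho> vBest = enc_option enc_best b"
        "\<rho> 8 = enc_list (map (enc_arc G k c) zs)"
        using I b by (simp_all add: \<rho>_def prepared_update)
      have e: "e \<in> set es" using xs by simp
      show "terminates K Try_arc (\<tau>(9 := enc_arc G k c e, 8 := enc_list (map (enc_arc G k c) zs))) time_arc
        (\<lambda>\<tau>'. \<tau>' 8 = enc_list (map (enc_arc G k c) zs) \<and> ?I (ys @ [e]) \<tau>')"
        unfolding \<rho>_def[symmetric]
      proof (rule terminates_mono[OF Try_arc_terminates[OF \<rho>(1-3) b(2) e] order_refl])
        fix \<tau>' assume A: "frame 10 {vBest} \<rho> \<tau>' \<and> (\<exists>b'. \<tau>' vBest = enc_option enc_best b' \<and>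
          best_of (?S (set ys) \<union> {4 ^ j * c i e | j i. j \<in> {1..length es} \<and> i \<in> {1..k}}) b')"
        then have fr: "frame 10 {vBest} \<rho> \<tau>'" by simp
        have "?S (set ys) \<union> {4 ^ j * c i e | j i. j \<in> {1..length es} \<and> i \<in> {1..k}} = ?S (set (ys @ [e]))"
          by auto
        then show "\<tau>' 8 = enc_list (map (enc_arc G k c) zs) \<and> ?I (ys @ [e]) \<tau>'"
          using A prepared_frame[OF \<rho>(1) fr] frameD[OF fr, of 8] \<rho>(4) by simp
      qed
    next
      fix \<tau> assume "?I es \<tau>"
      moreover have "?S (set es) = candidates" using es by (simp add: candidates_def)
      ultimately obtain b where b: "\<tau> vBest = enc_option enc_best b" "best_of candidates b" by auto
      \<comment> \<open>The success of some candidate rules out an empty result.\<close>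
      have "b \<noteq> None" using b(2) candidate_succeeds by (cases b) (auto simp: best_of_def)
      then obtain D p where Dp: "b = Some (D, p)" by auto
      then have "snd_of (\<tau> vBest) = enc_path p" using b(1) by (simp add: enc_best_def)
      then show "terminates K (Assign 0 (Second vBest)) \<tau> 1 ?Q"
        using b(2) Dp by (intro terminates_Assign) auto
    qed (use \<sigma> in simp_all)
  qed simp
qed (use units in \<open>simp_all add: path_time_def\<close>)

end

section \<open>Bit lengths and the theorem\<close>

text \<open>The fraction need not be reduced, so bounds for sums and products follow without common
  divisors; reduction enters only in \<open>fits_num_bits\<close>.\<close>

definition fits :: "nat \<Rightarrow> real \<Rightarrow> bool" where
  "fits n r \<longleftrightarrow> (\<exists>a b :: int. r = of_int a / of_int b \<and> \<bar>a\<bar> \<le> 2 ^ n \<and> 0 < b \<and> b \<le> 2 ^ n)"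

lemma fitsI: "r = of_int a / of_int b \<Longrightarrow> \<bar>a\<bar> \<le> 2 ^ n \<Longrightarrow> 0 < b \<Longrightarrow> b \<le> 2 ^ n \<Longrightarrow> fits n r"
  unfolding fits_def by blast

lemma fits_mono:
  assumes "fits n r" "n \<le> m"
  shows "fits m r"
proof -
  have "(2 :: int) ^ n \<le> 2 ^ m" using assms(2) by (intro power_increasing) auto
  moreover obtain a b where "r = of_int a / of_int b" "\<bar>a\<bar> \<le> 2 ^ n" "0 < b" "b \<le> 2 ^ n"
    using assms(1) unfolding fits_def by blast
  ultimately show ?thesis by (intro fitsI[of _ a b]) (assumption | linarith)+
qed

lemma fits_mult:
  assumes "fits n r" "fits m q"
  shows "fits (n + m) (r * q)"
proof -
  obtain a b where r: "r = of_int a / of_int b" "\<bar>a\<bar> \<le> 2 ^ n" "0 < b" "b \<le> 2 ^ n"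
    using assms(1) unfolding fits_def by blast
  obtain a' b' where q: "q = of_int a' / of_int b'" "\<bar>a'\<bar> \<le> 2 ^ m" "0 < b'" "b' \<le> 2 ^ m"
    using assms(2) unfolding fits_def by blast
  show ?thesis
  proof (rule fitsI)
    show "r * q = of_int (a * a') / of_int (b * b')" using r q by simp
    show "\<bar>a * a'\<bar> \<le> 2 ^ (n + m)" unfolding abs_mult power_add using r q by (intro mult_mono) auto
    show "b * b' \<le> 2 ^ (n + m)" unfolding power_add using r q by (intro mult_mono) auto
  qed (use r q in simp)
qed

text \<open>Swap numerator and denominator and move the sign; the inverse of 0 is 0, written as
  \<open>0 / 1\<close>.\<close>

lemma fits_inverse:
  assumes "fits n r"
  shows "fits n (inverse r)"
proof -
  obtain a b where r: "r = of_int a / of_int b" "\<bar>a\<bar> \<le> 2 ^ n" "0 < b" "b \<le> 2 ^ n"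
    using assms unfolding fits_def by blast
  consider "a = 0" | "a > 0" | "a < 0" by linarith
  then show ?thesis
  proof cases
    case 1
    then show ?thesis using r by (intro fitsI[of _ 0 1]) auto
  next
    case 2
    then show ?thesis using r by (intro fitsI[of _ b a]) auto
  next
    case 3
    then show ?thesis using r by (intro fitsI[of _ "- b" "- a"]) auto
  qed
qed

lemma fits_divide: "fits n r \<Longrightarrow> fits m q \<Longrightarrow> fits (n + m) (r / q)"
  unfolding divide_inverse by (intro fits_mult fits_inverse)

lemma fits_add:
  assumes "fits n r" "fits m q"
  shows "fits (n + m + 1) (r + q)"
proof -
  obtain a b where r: "r = of_int a / of_int b" "\<bar>a\<bar> \<le> 2 ^ n" "0 < b" "b \<le> 2 ^ n"
    using assms(1) unfolding fits_def by blast
  obtain a' b' where q: "q = of_int a' / of_int b'" "\<bar>a'\<bar> \<le> 2 ^ m" "0 < b'" "b' \<le> 2 ^ m"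
    using assms(2) unfolding fits_def by blast
  have "\<bar>a * b'\<bar> \<le> 2 ^ n * 2 ^ m" "\<bar>a' * b\<bar> \<le> 2 ^ m * 2 ^ n"
    unfolding abs_mult using r q by (intro mult_mono; simp)+
  moreover have "b * b' \<le> 2 ^ n * 2 ^ m" using r q by (intro mult_mono) auto
  ultimately show ?thesis
    using r q by (intro fitsI[of _ "a * b' + a' * b" "b * b'"]) (auto simp: power_add field_simps)
qed

lemma fits_minus: "fits n r \<Longrightarrow> fits n (- r)"
proof -
  assume "fits n r"
  then obtain a b where r: "r = of_int a / of_int b" "\<bar>a\<bar> \<le> 2 ^ n" "0 < b" "b \<le> 2 ^ n"
    unfolding fits_def by blast
  then show ?thesis by (intro fitsI[of _ "- a" b]) auto
qed

lemma fits_diff: "fits n r \<Longrightarrow> fits m q \<Longrightarrow> fits (n + m + 1) (r - q)"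
  using fits_add[OF _ fits_minus] by force

lemma fits_of_nat: "j \<le> 2 ^ n \<Longrightarrow> fits n (real j)"
proof (rule fitsI[of _ "int j" 1])
  assume "j \<le> 2 ^ n"
  then have "int j \<le> int (2 ^ n)" by (rule of_nat_mono)
  then show "\<bar>int j\<bar> \<le> 2 ^ n" by simp
qed auto

text \<open>The reduced denominator divides \<open>b\<close>, so reducing the fraction does not
  enlarge its terms. A number up to \<open>2 ^ n\<close> may need \<open>n + 1\<close> bits, and the
  sign adds one more.\<close>

lemma fits_num_bits:
  assumes "fits n r"
  shows "num_bits r \<le> 2 * n + 3"
proof -
  obtain a b where r: "r = of_int a / of_int b" "\<bar>a\<bar> \<le> 2 ^ n" "0 < b" "b \<le> 2 ^ n"
    using assms unfolding fits_def by blast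
  define q where "q = Fract a b"
  have q: "of_rat q = r" using r by (simp add: q_def of_rat_rat)
  then have THE: "(THE q. of_rat q = r) = q" by (intro the_equality) auto
  obtain a' b' where ab: "quotient_of q = (a', b')" by force
  have b': "b' > 0" "coprime a' b'" using ab quotient_of_denom_pos quotient_of_coprime by auto
  have "Fract a' b' = Fract a b" using quotient_of_eq[of a b a' b'] ab by (simp add: q_def)
  then have eq: "a' * b = a * b'" using b' r by (simp add: eq_rat)
  have "b' dvd a' * b" unfolding eq by simp
  then have "b' dvd b" using b'(2) by (simp add: coprime_dvd_mult_right_iff coprime_commute)
  then have bb: "b' \<le> b" using r by (simp add: zdvd_imp_le)
  have "\<bar>a'\<bar> * b = \<bar>a\<bar> * b'" using arg_cong[OF eq, of abs] b' r by (simp add: abs_mult)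
  also have "\<dots> \<le> \<bar>a\<bar> * b" using bb by (intro mult_left_mono) auto
  finally have aa: "\<bar>a'\<bar> \<le> \<bar>a\<bar>" using r by simp
  have lt: "nat x < 2 ^ (n + 1)" if "x \<le> 2 ^ n" for x :: int
  proof -
    have "int (nat x) \<le> int (2 ^ n)" using that by simp
    then have "nat x \<le> 2 ^ n" by (simp only: of_nat_le_iff)
    also have "\<dots> < 2 ^ (n + 1)" by simp
    finally show ?thesis .
  qed
  have "nat \<bar>a'\<bar> < 2 ^ (n + 1)" "nat b' < 2 ^ (n + 1)"
    by (rule lt, use aa bb r in linarith)+
  then have "floorlog 2 (nat \<bar>a'\<bar>) \<le> n + 1" "floorlog 2 (nat b') \<le> n + 1"
    by (auto intro!: floorlog_leI)
  then show ?thesis unfolding num_bits_def THE ab by simp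
qed

lemma rational_fits:
  assumes "r \<in> \<rat>"
  shows "fits (num_bits r) r"
proof -
  obtain q where q: "r = of_rat q" using assms by (rule Rats_cases)
  then have THE: "(THE q. of_rat q = r) = q" by (intro the_equality) auto
  obtain a b where ab: "quotient_of q = (a, b)" by force
  have b: "b > 0" using quotient_of_denom_pos[OF ab] .
  have "q = of_int a / of_int b" using quotient_of_div[OF ab] .
  then have r: "r = of_int a / of_int b" using q by (simp add: of_rat_divide)
  have nb: "num_bits r = 1 + floorlog 2 (nat \<bar>a\<bar>) + floorlog 2 (nat b)"
    unfolding num_bits_def THE ab by simp
  have le: "x \<le> 2 ^ num_bits r" if "floorlog 2 (nat x) \<le> num_bits r" for x :: int
  proof -
    have "nat x < 2 ^ num_bits r" using floorlog_leD[OF that] by simp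
    then have "int (nat x) < int (2 ^ num_bits r)" by (rule of_nat_less_iff[THEN iffD2])
    then have "int (nat x) < 2 ^ num_bits r" by simp
    then show ?thesis by linarith
  qed
  show ?thesis by (rule fitsI[OF r le b le]) (unfold nb, simp_all)
qed

text \<open>A cost fits \<open>b\<close>, a threshold \<open>3 * b\<close> and their quotient
  \<open>4 * b\<close>. A product of at most \<open>b + 1\<close> factors then takes
  \<open>(4 * b + 1) * (b + 1)\<close>, and summing at most \<open>b\<close> of these gives the
  outer factor; the slack covers the subtractions.\<close>

definition level :: "nat \<Rightarrow> nat" where
  "level b = (b + 2) * ((4 * b + 1) * (b + 1) + 4)"

lemma fits_factor_prod:
  assumes "\<And>e. e \<in> set p \<Longrightarrow> fits g (f i e)"
  shows "fits ((g + 1) * length p) (factor_prod f i p)"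
  using assms
proof (induction p)
  case Nil
  then show ?case using fits_of_nat[of 1 0] by simp
next
  case (Cons e p)
  have "fits (0 + g + 1) (1 + f i e)" using Cons.prems by (intro fits_add) (use fits_of_nat[of 1 0] in auto)
  then have "fits ((0 + g + 1) + (g + 1) * length p) ((1 + f i e) * factor_prod f i p)"
    using Cons by (intro fits_mult) auto
  then show ?case by (simp add: algebra_simps)
qed

lemma fits_sum_list:
  "(\<And>y. y \<in> set ys \<Longrightarrow> fits g (h y)) \<Longrightarrow> fits ((g + 1) * length ys) (\<Sum>y\<leftarrow>ys. h y)"
proof (induction ys)
  case Nil
  then show ?case using fits_of_nat[of 0 0] by simp
next
  case (Cons y ys)
  then have "fits (g + (g + 1) * length ys + 1) (h y + (\<Sum>y\<leftarrow>ys. h y))" by (intro fits_add) auto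
  then show ?case by (simp add: algebra_simps)
qed

section \<open>Bit lengths of the numbers in a run\<close>

locale nat_instance = robust_instance G s t k c es
  for G :: "(nat, nat) pre_digraph" and s t k c es
begin

lemma attempt_run_UNIV:
  assumes "distinct vs" "set vs = verts G" "length es \<le> N" "length vs < N" "k \<le> N"
  shows "attempt_run G s t k c es vs UNIV D N"
  by unfold_locales (use assms in auto)

lemma full_run_UNIV:
  assumes "distinct vs" "set vs = verts G" "length es \<le> N" "length vs < N" "k \<le> N"
  shows "full_run G s t k c es vs UNIV N"
  by unfold_locales (use assms attempt_run_UNIV[OF assms] in auto)

text \<open>A threshold is a cost times \<open>2 ^ (2 * j)\<close> with
  \<open>j \<le> b\<close>.\<close>

lemma candidate_fits:
  assumes "\<And>i e. \<lbrakk>i \<in> {1..k}; e \<in> set es\<rbrakk> \<Longrightarrow> fits b (c i e)" "length es \<le> b" "D \<in> candidates"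
  shows "fits (3 * b) D"
proof -
  obtain j i e where D: "D = 4 ^ j * c i e" "j \<le> length es" "i \<in> {1..k}" "e \<in> set es"
    using assms(3) es by (auto simp: candidates_def)
  have "(4 :: nat) ^ j = 2 ^ (2 * j)" by (simp add: power_mult)
  then have "fits (2 * j) (real (4 ^ j))" by (intro fits_of_nat) simp
  then have "fits (2 * j) (4 ^ j)" by simp
  then have "fits (2 * j + b) D" unfolding D(1) using assms(1) D by (intro fits_mult) auto
  then show ?thesis using D(2) assms(2) by (elim fits_mono) auto
qed

lemma full_run_fits:
  assumes vs: "distinct vs" "set vs = verts G" "length es \<le> N" "length vs < N" "k \<le> N"
    and b: "\<And>i e. \<lbrakk>i \<in> {1..k}; e \<in> set es\<rbrakk> \<Longrightarrow> fits b (c i e)" "length es \<le> b" "k \<le> b"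
  shows "full_run G s t k c es vs {r. fits (level b) r} N"
proof -
  have level: "fits (level b) r" if "fits n r" "n \<le> (b + 2) * ((4 * b + 1) * (b + 1) + 4)" for n r
    using that by (auto simp: level_def elim: fits_mono)
  \<comment> \<open>Everything except the sums already fits the inner bracket of
    \<open>level\<close>.\<close>
  have small: "fits (level b) r" if "fits n r" "n \<le> (4 * b + 1) * (b + 1) + 4" for n r
  proof (rule level[OF that(1)])
    have "1 * ((4 * b + 1) * (b + 1) + 4) \<le> (b + 2) * ((4 * b + 1) * (b + 1) + 4)" by (intro mult_mono) auto
    then show "n \<le> (b + 2) * ((4 * b + 1) * (b + 1) + 4)" using that(2) by simp
  qed
  have grow: "(4 * b + 1) * m \<le> (4 * b + 1) * (b + 1)" if "m \<le> Suc (length es)" for m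
    using that b(2) by (intro mult_left_mono) auto
  have base: "4 * b \<le> (4 * b + 1) * (b + 1)" by simp
  have attempts: "attempt_run G s t k c es vs {r. fits (level b) r} D N" if D: "D \<in> candidates" for D
  proof unfold_locales
    have g: "fits (4 * b) (scaled c D i e)" if "i \<in> {1..k}" "e \<in> set es" for i e
      using fits_divide[OF b(1)[OF that] candidate_fits[OF b(1,2) D]] by (simp add: scaled_def)
    have M: "fits ((4 * b + 1) * length p) (factor_prod (scaled c D) i p)"
      if "i \<in> {1..k}" "set p \<subseteq> set es" for i p
      using that g by (intro fits_factor_prod) auto
    show "0 \<in> {r. fits (level b) r}" using small[OF fits_of_nat[of 0 0]] by simp
    show "scaled c D i e \<in> {r. fits (level b) r} \<and>
        factor_prod (scaled c D) i p * scaled c D i e \<in> {r. fits (level b) r} \<and>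
        factor_prod (scaled c D) i (e # p) \<in> {r. fits (level b) r}"
      if p: "set p \<subseteq> set es" "length p \<le> length es" "e \<in> set es" "i \<in> {1..k}" for p e i
    proof (intro conjI CollectI)
      show "fits (level b) (scaled c D i e)" using base by (intro small[OF g[OF p(4,3)]]) simp
      have "(4 * b + 1) * length p + 4 * b \<le> (4 * b + 1) * Suc (length p)" by simp
      also have "\<dots> \<le> (4 * b + 1) * (b + 1)" using p by (intro grow) simp
      finally show "fits (level b) (factor_prod (scaled c D) i p * scaled c D i e)"
        by (intro small[OF fits_mult[OF M[OF p(4,1)] g[OF p(4,3)]]]) simp
      have "(4 * b + 1) * length (e # p) \<le> (4 * b + 1) * (b + 1)" using p by (intro grow) simp
      then show "fits (level b) (factor_prod (scaled c D) i (e # p))"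
        using p by (intro small[OF M]) auto
    qed
    show "(\<Sum>j\<leftarrow>ys. factor_prod (scaled c D) j p - 2) + factor_prod (scaled c D) z p - x
        \<in> {r. fits (level b) r}"
      if p: "set p \<subseteq> set es" "length p \<le> Suc (length es)" "rev [1..<Suc k] = ys @ z # zs" "x \<in> {0, 1, 2}"
      for p ys z zs x
    proof -
      have set: "j \<in> {1..k}" if "j \<in> set (ys @ z # zs)" for j
        using that unfolding p(3)[symmetric] by auto
      have len: "length ys < k" using arg_cong[OF p(3), of length] by (simp del: upt_Suc)
      let ?g = "(4 * b + 1) * (b + 1)"
      have M': "fits ?g (factor_prod (scaled c D) j p)" if "j \<in> set (ys @ z # zs)" for j
        using fits_mono[OF M[OF set[OF that] p(1)] grow[OF p(2)]] .
      have two: "fits 1 2" using fits_of_nat[of 2 1] by simp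
      have "fits ((?g + 1 + 1 + 1) * length ys) (\<Sum>j\<leftarrow>ys. factor_prod (scaled c D) j p - 2)"
        by (intro fits_sum_list fits_diff M' two) simp
      then have s: "fits ((?g + 3) * b) (\<Sum>j\<leftarrow>ys. factor_prod (scaled c D) j p - 2)"
        by (rule fits_mono) (rule mult_mono, use len b(3) in simp_all)
      have "x = real 0 \<or> x = real 1 \<or> x = real 2" using p(4) by auto
      then have "fits 1 x" using fits_of_nat[of 0 1] fits_of_nat[of 1 1] fits_of_nat[of 2 1] by auto
      then have "fits (((?g + 3) * b + ?g + 1) + 1 + 1)
          ((\<Sum>j\<leftarrow>ys. factor_prod (scaled c D) j p - 2) + factor_prod (scaled c D) z p - x)"
        by (intro fits_diff fits_add s M') auto
      moreover have "((?g + 3) * b + ?g + 1) + 1 + 1 \<le> (b + 2) * (?g + 4)" by (simp add: algebra_simps)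
      ultimately show ?thesis using level by blast
    qed
  qed (use vs in auto)
  show ?thesis
  proof (rule full_run.intro[OF robust_instance_axioms full_run_axioms.intro])
    fix D assume "D \<in> candidates"
    then show "attempt_run G s t k c es vs {r. fits (level b) r} D N" by (rule attempts)
  next
    show "0 \<in> {r. fits (level b) r}" using small[OF fits_of_nat[of 0 0]] by simp
    show "1 \<in> {r. fits (level b) r}" using small[OF fits_of_nat[of 1 0]] by simp
    show "- real j \<in> {r. fits (level b) r}" if "j \<le> k" for j
    proof -
      have "j \<le> 2 ^ b" using that b(3) less_exp[of b] by linarith
      then show ?thesis using base by (auto intro!: small[OF fits_minus[OF fits_of_nat[of j b]]])
    qed
    show "2 ^ j * c i e \<in> {r. fits (level b) r}" if "i \<in> {1..k}" "e \<in> set es" "j \<le> 2 * length es" for i e j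
    proof -
      have "fits j (real (2 ^ j))" by (intro fits_of_nat) simp
      then have "fits (j + b) (2 ^ j * c i e)" using b(1)[OF that(1,2)] by (intro fits_mult) simp_all
      then show ?thesis using that(3) b(2) base by (auto intro!: small)
    qed
  qed (use vs in auto)
qed

end

section \<open>Input size and polynomial bounds\<close>

lemma length_less_cells: "length ls < cells (enc_list ls)"
  by (induction ls) auto

lemma length_less_bit_size: "length ls < bit_size (enc_list ls)"
  by (induction ls) auto

lemma cells_member: "v \<in> set ls \<Longrightarrow> cells v < cells (enc_list ls)"
  by (induction ls) auto

lemma bit_size_member: "v \<in> set ls \<Longrightarrow> bit_size v < bit_size (enc_list ls)"
  by (induction ls) auto

lemma atoms_of_member: "v \<in> set ls \<Longrightarrow> atoms_of v \<subseteq> atoms_of (enc_list ls)"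
  by (induction ls) auto

text \<open>A predicate on functions, so that time bounds are recognised by unfolding them into sums
  and products.\<close>

definition is_poly :: "(nat \<Rightarrow> nat) \<Rightarrow> bool" where
  "is_poly f \<longleftrightarrow> (\<exists>q. f = poly q)"

lemma is_poly_intros:
  "is_poly (\<lambda>n. a)" "is_poly (\<lambda>n. n)"
  "is_poly f \<Longrightarrow> is_poly g \<Longrightarrow> is_poly (\<lambda>n. f n + g n)"
  "is_poly f \<Longrightarrow> is_poly g \<Longrightarrow> is_poly (\<lambda>n. f n * g n)"
proof -
  show "is_poly (\<lambda>n. a)" unfolding is_poly_def by (intro exI[of _ "[:a:]"]) auto
  show "is_poly (\<lambda>n. n)" unfolding is_poly_def by (intro exI[of _ "[:0, 1:]"]) auto
  assume "is_poly f" "is_poly g"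
  then obtain p q where "f = poly p" "g = poly q" unfolding is_poly_def by blast
  then have "(\<lambda>n. f n + g n) = poly (p + q)" "(\<lambda>n. f n * g n) = poly (p * q)" by auto
  then show "is_poly (\<lambda>n. f n + g n)" "is_poly (\<lambda>n. f n * g n)" unfolding is_poly_def by blast+
qed

lemma is_poly_path_time: "is_poly path_time"
proof -
  have "is_poly (\<lambda>N. path_time N)"
    unfolding path_time_def arc_time_def powers_time_def attempt_time_def round_time_def relax_time_def
    by (intro is_poly_intros)
  then show ?thesis by simp
qed

lemma toss_free_Robust_path: "toss_free Robust_path"
  by (simp add: Robust_path_def Try_arc_def Try_powers_def Attempt_def Record_def Round_def Relax_def Lookup_def
      Extend_def Multiply_def Collect_def Replace_def For_def If_eq_def)

text \<open>The number of agents is bounded by the input size because every arc lists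
  \<open>k\<close> costs and there is at least one arc.\<close>

lemma encodes_instance:
  assumes "sp_instance G s t k c" "encodes x G s t k c"
  obtains vs es where "nat_instance G s t k c es" "distinct vs" "set vs = verts G"
    "x = enc_list [enc_nat s, enc_nat t, enc_list (map enc_nat vs), enc_list (map (enc_arc G k c) es)]"
    "length es \<le> cells x" "length vs < cells x" "k \<le> cells x"
    "length es \<le> bit_size x" "k \<le> bit_size x"
    "\<And>i e. \<lbrakk>i \<in> {1..k}; e \<in> set es\<rbrakk> \<Longrightarrow> num_bits (c i e) \<le> bit_size x \<and> c i e \<in> atoms_of x"
proof -
  obtain vs es where v: "distinct vs" "set vs = verts G" "distinct es" "set es = arcs G"
    and x: "x = enc_list [enc_nat s, enc_nat t, enc_list (map enc_nat vs), enc_list (map (enc_arc G k c) es)]"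
    using assms(2) unfolding encodes_def by blast
  interpret nat_instance G s t k c es
    by unfold_locales (use assms(1) v in auto)
  let ?V = "enc_list (map enc_nat vs)" and ?A = "enc_list (map (enc_arc G k c) es)"
  have V: "?V \<in> set [enc_nat s, enc_nat t, ?V, ?A]" and A: "?A \<in> set [enc_nat s, enc_nat t, ?V, ?A]"
    by simp_all
  note VA = cells_member[OF V, folded x] cells_member[OF A, folded x] bit_size_member[OF A, folded x]
    atoms_of_member[OF A, folded x]
  let ?C = "\<lambda>e. enc_list (map (\<lambda>i. Atom (c i e)) [1..<Suc k])"
  have costs: "cells (?C e) < cells x \<and> bit_size (?C e) < bit_size x \<and> atoms_of (?C e) \<subseteq> atoms_of x"
    if e: "e \<in> set es" for e
  proof -
    have C: "?C e \<in> set [enc_nat e, enc_nat (tail G e), enc_nat (head G e), ?C e]" by simp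
    have E: "enc_arc G k c e \<in> set (map (enc_arc G k c) es)" using e by simp
    show ?thesis
      using cells_member[OF C, folded enc_arc_def] bit_size_member[OF C, folded enc_arc_def]
        atoms_of_member[OF C, folded enc_arc_def] cells_member[OF E] bit_size_member[OF E]
        atoms_of_member[OF E] VA by (meson less_trans order_trans)
  qed
  obtain e where e: "e \<in> set es" using length_es by (cases es) auto
  have kC: "k < cells (?C e)" "k < bit_size (?C e)"
    using length_less_cells[of "map (\<lambda>i. Atom (c i e)) [1..<Suc k]"]
      length_less_bit_size[of "map (\<lambda>i. Atom (c i e)) [1..<Suc k]"] by (simp_all del: upt_Suc)
  have atom: "num_bits (c i e) \<le> bit_size x \<and> c i e \<in> atoms_of x" if ie: "i \<in> {1..k}" "e \<in> set es" for i e
  proof -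
    have "i \<in> set [1..<Suc k]" unfolding set_upt using ie(1) by auto
    then have "Atom (c i e) \<in> set (map (\<lambda>i. Atom (c i e)) [1..<Suc k])"
      by (simp del: upt_Suc set_upt)
    from bit_size_member[OF this] atoms_of_member[OF this] show ?thesis using costs[OF ie(2)] by auto
  qed
  show ?thesis
  proof (rule that[OF nat_instance_axioms v(1,2) x])
    show "length es \<le> cells x" "length es \<le> bit_size x"
      using length_less_cells[of "map (enc_arc G k c) es"] length_less_bit_size[of "map (enc_arc G k c) es"] VA
      by simp_all
    show "length vs < cells x" using length_less_cells[of "map enc_nat vs"] VA by simp
    show "k \<le> cells x" "k \<le> bit_size x" using costs[OF e] kC by auto
  qed (use atom in auto)
qed

lemma polynomial_time_Robust_path:
  "polynomial_time Robust_path {x. \<exists>G s t k c. sp_instance G s t k c \<and> encodes x G s t k c}"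
proof -
  obtain q where q: "path_time = poly q" using is_poly_path_time unfolding is_poly_def by blast
  have "is_poly (\<lambda>b. 2 * level b + 3)" unfolding level_def by (intro is_poly_intros)
  then obtain q' where q': "\<And>b. 2 * level b + 3 = poly q' b"
    unfolding is_poly_def by metis
  show ?thesis
  proof (rule terminates_polynomial_time[OF toss_free_Robust_path])
    fix x assume "x \<in> {x. \<exists>G s t k c. sp_instance G s t k c \<and> encodes x G s t k c}"
    then obtain G s t k c where I: "sp_instance G s t k c" "encodes x G s t k c" by blast
    from encodes_instance[OF I] obtain vs es where
      inst: "nat_instance G s t k c es" and vs: "distinct vs" "set vs = verts G"
      and x: "x = enc_list [enc_nat s, enc_nat t, enc_list (map enc_nat vs), enc_list (map (enc_arc G k c) es)]"
      and sz: "length es \<le> cells x" "length vs < cells x" "k \<le> cells x"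
      and bsz: "length es \<le> bit_size x" "k \<le> bit_size x"
      and at: "\<And>i e. \<lbrakk>i \<in> {1..k}; e \<in> set es\<rbrakk> \<Longrightarrow> num_bits (c i e) \<le> bit_size x \<and> c i e \<in> atoms_of x"
      by metis
    interpret nat_instance G s t k c es by (rule inst)
    show "terminates UNIV Robust_path (init_store x) (poly q (cells x)) (\<lambda>_. True)"
      using full_run.Robust_path_terminates[OF full_run_UNIV[OF vs sz] x] q
      by (auto elim: terminates_mono)
    assume rat: "atoms_of x \<subseteq> \<rat>"
    \<comment> \<open>The single parameter \<open>b\<close> bounds the number of arcs, the number of
      agents and the bit lengths of all costs.\<close>
    let ?b = "bit_size x"
    have "fits ?b (c i e)" if "i \<in> {1..k}" "e \<in> set es" for i e
      using at[OF that] rat by (auto intro: fits_mono[OF rational_fits])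
    note run = full_run_fits[OF vs sz this bsz]
    let ?K = "{r. fits (level ?b) r}"
    \<comment> \<open>All atoms of the input, names of vertices and arcs included, must lie in
      \<open>?K\<close> from the start.\<close>
    have "1 * ?b \<le> ((4 * ?b + 1) * (?b + 1) + 4) * (?b + 2)" by (intro mult_mono) auto
    then have lb: "?b \<le> level ?b" by (simp add: level_def mult.commute)
    have "num_bits r \<le> ?b" if "r \<in> atoms_of v" "bit_size v \<le> ?b" for r v
      using that by (induction v) auto
    then have "atoms_of x \<subseteq> ?K"
      using rat lb by (auto intro!: fits_mono[OF rational_fits] intro: order_trans)
    moreover have "terminates ?K Robust_path (init_store x) (poly q (cells x)) (\<lambda>_. True)"
      using full_run.Robust_path_terminates[OF run x] q by (auto elim: terminates_mono)
    moreover have "\<forall>r\<in>?K. num_bits r \<le> poly q' ?b"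
      using fits_num_bits q' by fastforce
    ultimately show "\<exists>K. atoms_of x \<subseteq> K \<and>
        terminates K Robust_path (init_store x) (poly q (cells x)) (\<lambda>_. True) \<and>
        (\<forall>r\<in>K. num_bits r \<le> poly q' (bit_size x))" by blast
  qed
qed

theorem theorem3p1:
  "\<exists>(P :: com) (C :: real).
     polynomial_time P {x. \<exists>G s t k c. sp_instance G s t k c \<and> encodes x G s t k c} \<and>
     (\<forall>(G :: (nat, nat) pre_digraph) (s :: nat) (t :: nat) (k :: nat) (c :: nat \<Rightarrow> nat \<Rightarrow> real) x.
        sp_instance G s t k c \<longrightarrow> encodes x G s t k c \<longrightarrow>
        (\<forall>v \<in> set_pmf (output_dist P x). \<exists>p. v = enc_path p \<and> pre_digraph.apath G s p t) \<and>
        (\<forall>(T :: nat sp_tree) (H :: nat).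
           decomposition_tree T G s t \<longrightarrow> H = tree_height T \<longrightarrow> H \<ge> 1 \<longrightarrow>
           measure_pmf.prob (output_dist P x)
             {enc_path p | p. pre_digraph.apath G s p t \<and>
                robust_cost k c p \<le> C * (real H * ln (real k)) * OPT G s t k c}
           \<ge> 1 - (1 / real k + 1 / (real k * real H))))"
proof (rule exI[of _ Robust_path], rule exI[of _ 48], intro conjI polynomial_time_Robust_path allI impI)
  fix G :: "(nat, nat) pre_digraph" and s t k c x
  assume I: "sp_instance G s t k c" "encodes x G s t k c"
  from encodes_instance[OF I] obtain vs es where
    inst: "nat_instance G s t k c es" and vs: "distinct vs" "set vs = verts G"
    and x: "x = enc_list [enc_nat s, enc_nat t, enc_list (map enc_nat vs), enc_list (map (enc_arc G k c) es)]"
    and sz: "length es \<le> cells x" "length vs < cells x" "k \<le> cells x"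
    by metis
  interpret nat_instance G s t k c es by (rule inst)
  interpret run: full_run G s t k c es vs UNIV "cells x" by (rule full_run_UNIV[OF vs sz])
  obtain D p where out: "output_dist Robust_path x = return_pmf (enc_path p)"
    and best: "run.best_of candidates (Some (D, p))"
    using output_dist_terminates[OF toss_free_Robust_path run.Robust_path_terminates[OF x]] by auto
  have D: "D \<in> candidates" "attempt G s t k c es D = Some p"
    "\<And>D'. \<lbrakk>D' \<in> candidates; attempt G s t k c es D' \<noteq> None\<rbrakk> \<Longrightarrow> D \<le> D'"
    using best by (auto simp: run.best_of_def)
  have path: "pre_digraph.apath G s p t" using attempt_apath[OF candidates_nonneg[OF D(1)] D(2)] .
  then show "\<forall>v \<in> set_pmf (output_dist Robust_path x). \<exists>p. v = enc_path p \<and> pre_digraph.apath G s p t"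
    using out by auto
  fix T :: "nat sp_tree" and H :: nat
  assume T: "decomposition_tree T G s t" "H = tree_height T" "1 \<le> H"
  let ?A = "{enc_path p | p. pre_digraph.apath G s p t \<and>
     robust_cost k c p \<le> 48 * (real H * ln (real k)) * OPT G s t k c}"
  show "1 - (1 / real k + 1 / (real k * real H)) \<le> measure_pmf.prob (output_dist Robust_path x) ?A"
  \<comment> \<open>For \<open>k = 1\<close> the factor \<open>ln k\<close> vanishes and the cost
    bound would force cost 0; the required probability is at most 0 in this case.\<close>
  proof (cases "k = 1")
    case True
    then have "1 - (1 / real k + 1 / (real k * real H)) \<le> 0" by simp
    then show ?thesis using measure_nonneg order_trans by blast
  next
    case False
    then have "2 \<le> k" using k by simp
    from attempt_ratio[OF T(1) _ this candidates_nonneg[OF D(1)] D(2,3)] T(2,3)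
    have "enc_path p \<in> ?A" using path by auto
    then have "measure_pmf.prob (output_dist Robust_path x) ?A = 1" unfolding out by simp
    moreover have "0 \<le> 1 / real k + 1 / (real k * real H)" by simp
    ultimately show ?thesis by linarith
  qed
qed

end
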